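(* Let $n\ge 1$, let $\Theta\in\mathbb{R}$ be a constant, and let $u\in C^\infty(\mathbb{R}^n)$ be a solution of the special Lagrangian equation $\sum_{i=1}^n\arctan\lambda_i(D^2u(x))=\Theta$ for all $x\in\mathbb{R}^n$. Suppose that there is a constant $\gamma\in\mathbb{R}$ such that either (a) $\gamma>(\Theta-\pi)/n$ and $\arctan\lambda_{\min}(x)\ge\gamma$ for all $x\in\mathbb{R}^n$, or (b) $\gamma<(\Theta+\pi)/n$ and $\arctan\lambda_{\max}(x)\le\gamma$ for all $x\in\mathbb{R}^n$, where $\lambda_{\min}(x)$ and $\lambda_{\max}(x)$ are the smallest and largest eigenvalues of $D^2u(x)$. Then $u$ is a quadratic polynomial.
   Context: For a real-valued smooth function $u$, $\lambda_1(D^2u)\le\dots\le\lambda_n(D^2u)$ denote the eigenvalues of the Hessian matrix $D^2u$, listed with multiplicity. Here $\arctan$ takes values in $(-\pi/2,\pi/2)$. "Quadratic polynomial" means a polynomial of degree at most $2$ (equivalently, $D^2u$ is constant). *)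

theory Defs
  imports "HOL-Analysis.Analysis" "HOL-Computational_Algebra.Polynomial"
    "HOL-Library.Multiset"
begin

definition partial_deriv :: "'n::finite \<Rightarrow> (real ^ 'n \<Rightarrow> real) \<Rightarrow> real ^ 'n \<Rightarrow> real" where
  "partial_deriv i f x = frechet_derivative f (at x) (axis i 1)"

text \<open>The class \<open>C\<^sup>k(\<real>\<^sup>n)\<close>. The totalised \<^const>\<open>frechet_derivative\<close> is only iterated under an
  explicit differentiability requirement.\<close>

primrec Ck :: "nat \<Rightarrow> (real ^ 'n::finite \<Rightarrow> real) \<Rightarrow> bool" where
  "Ck 0 f \<longleftrightarrow> continuous_on UNIV f"
| "Ck (Suc k) f \<longleftrightarrow> (\<forall>x. f differentiable (at x)) \<and> (\<forall>i. Ck k (partial_deriv i f))"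

definition C_infinity :: "(real ^ 'n::finite \<Rightarrow> real) \<Rightarrow> bool" where
  "C_infinity f \<longleftrightarrow> (\<forall>k. Ck k f)"

definition hessian :: "(real ^ 'n::finite \<Rightarrow> real) \<Rightarrow> real ^ 'n \<Rightarrow> real ^ 'n ^ 'n" where
  "hessian u x = (\<chi> i j. partial_deriv i (partial_deriv j u) x)"

definition charpoly :: "real ^ 'n ^ 'n::finite \<Rightarrow> real poly" where
  "charpoly A = det (mat [:0, 1:] - (\<chi> i j. [:A $ i $ j:]))"

text \<open>The real eigenvalues in increasing order, repeated according to algebraic multiplicity.
  For a symmetric matrix the list has length \<open>CARD('n)\<close>, so that \<open>eigval A i\<close> below is the
  \<open>i\<close>-th smallest eigenvalue for \<open>1 \<le> i \<le> CARD('n)\<close>; for matrices with non-real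
  eigenvalues the list is shorter and \<open>eigval\<close> is not meaningful.\<close>

definition eigvals :: "real ^ 'n ^ 'n::finite \<Rightarrow> real list" where
  "eigvals A = sorted_list_of_multiset (proots (charpoly A))"

definition eigval :: "real ^ 'n ^ 'n::finite \<Rightarrow> nat \<Rightarrow> real" where
  "eigval A i = eigvals A ! (i - 1)"

definition quadratic_polynomial :: "(real ^ 'n::finite \<Rightarrow> real) \<Rightarrow> bool" where
  "quadratic_polynomial u \<longleftrightarrow>
     (\<exists>a b c. \<forall>x. u x = (\<Sum>i\<in>UNIV. \<Sum>j\<in>UNIV. a i j * x $ i * x $ j) + (\<Sum>i\<in>UNIV. b i * x $ i) + c)"

lemma poly_charpoly: "poly (charpoly A) t = det (mat t - A)"
  unfolding charpoly_def det_def
  by (simp add: poly_sum poly_prod mat_def if_distrib[of "\<lambda>p. poly p t"] cong: if_cong)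

lemma poly_charpoly_eq_0_iff:
  "poly (charpoly A) t = 0 \<longleftrightarrow> (\<exists>v. v \<noteq> 0 \<and> A *v v = t *\<^sub>R v)"
proof -
  have eq: "(mat t - A) *v v = t *\<^sub>R v - A *v v" for v
    by (simp add: matrix_vector_mult_diff_rdistrib) 
       (simp add: mat_def matrix_vector_mult_def vec_eq_iff if_distrib[of "\<lambda>y. y * _"] cong: if_cong)
  have "poly (charpoly A) t = 0 \<longleftrightarrow> \<not> invertible (mat t - A)"
    by (simp add: poly_charpoly invertible_det_nz)
  also have "\<dots> \<longleftrightarrow> (\<exists>v. v \<noteq> 0 \<and> (mat t - A) *v v = 0)"
    by (metis invertible_left_inverse matrix_left_invertible_ker)
  also have "\<dots> \<longleftrightarrow> (\<exists>v. v \<noteq> 0 \<and> A *v v = t *\<^sub>R v)"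
    unfolding eq by auto
  finally show ?thesis .
qed

lemma charpoly_nonzero: "charpoly A \<noteq> 0"
proof
  assume 0: "charpoly A = 0"
  define t where "t = onorm ((*v) A) + 1"
  obtain v where v: "v \<noteq> 0" "A *v v = t *\<^sub>R v"
    using 0 poly_charpoly_eq_0_iff[of A t] by auto
  have bl: "bounded_linear ((*v) A)" by simp
  have "\<bar>t\<bar> * norm v \<le> onorm ((*v) A) * norm v"
    using onorm[OF bl, of v] v by simp
  then show False
    using v(1) onorm_pos_le[OF bl] by (simp add: t_def)
qed

lemma set_eigvals: "set (eigvals A) = {t. \<exists>v. v \<noteq> 0 \<and> A *v v = t *\<^sub>R v}"
  using charpoly_nonzero[of A] by (simp add: eigvals_def poly_charpoly_eq_0_iff)

lemma sorted_eigvals: "sorted (eigvals A)"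
  by (simp add: eigvals_def)

end

theory Submission
  imports Defs
begin

text \<open>Replacing \<open>u\<close> by \<open>- u\<close> exchanges the two cases, so assume \<open>arctan \<lambda>\<^sub>i \<ge> \<gamma>\<close> with
  \<open>\<Theta> - n \<gamma> < \<pi>\<close>, and \<open>n \<ge> 2\<close>. Rotate the Lagrangian graph of \<open>D u\<close> by the angle
  \<open>\<beta> = (\<Theta> + (n - 2) \<pi> / 2) / n\<close>. The rotated angles \<open>\<phi>\<^sub>i = arctan \<lambda>\<^sub>i - \<beta>\<close> stay in a compact
  subinterval of \<open>(-\<pi>/2, \<pi>/2)\<close>, so the rotated graph is again an entire gradient graph, with
  bounded Hessian \<open>M\<close>, and \<open>\<Sum> \<phi>\<^sub>i = - (n - 2) \<pi> / 2\<close> is exactly the critical phase.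
  At this phase the level set of \<open>\<Sum> arctan\<close> has a convexity property which makes every function
  \<open>w\<^sub>e = e \<bullet> M e\<close> a supersolution of the uniformly elliptic linearized operator.

  By sliding paraboloids (Savin), an entire nonnegative supersolution with infimum \<open>0\<close> is small
  outside a set of arbitrarily small density in large balls. Hence finitely many of the functions
  \<open>w\<^sub>e\<close> are simultaneously almost minimal at a common point, and by a net argument on the sphere there
  is, for each \<open>\<epsilon> > 0\<close>, a point \<open>x\<close> with \<open>M x \<le> M z + \<epsilon>\<close> for all \<open>z\<close>. Since \<open>\<Sum> arctan\<close>
  of the eigenvalues is strictly increasing and constant along \<open>M\<close>, this forces \<open>M\<close>, and therefore
  \<open>D\<^sup>2 u\<close>, to be constant.\<close>

section \<open>Symmetric matrices and trace functions\<close>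

text \<open>The obstacle is one-sidedness. At the critical phase each \<open>w e\<close> satisfies
  only a differential inequality, and bounded entire supersolutions need not be constant in
  dimension at least 3, so no Liouville theorem applies to a single \<open>w e\<close>. What
  survives is scale invariant: the share of a ball where a nonnegative supersolution exceeds a large
  multiple of one value taken near the centre can be made small, with constants that ignore the
  radius. Finitely many such exceptional sets cannot cover a large ball. Constancy then comes from
  the equation rather than from the inequality: bounded symmetric matrices of equal phase that are
  ordered up to eps differ by O(eps). The bound on \<open>\<gamma>\<close> is equivalent to
  \<open>\<beta> - \<gamma> < pi / 2\<close>, that is, to the smallest rotated angle staying away
  from - pi / 2. Eigenvalues of a smooth matrix field need not be smooth, so all differentiation is
  done on matrices and traces, and eigenframes enter one point at a time.\<close>

definition orthonormal :: "('n::finite \<Rightarrow> real ^ 'n) \<Rightarrow> bool" where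
  "orthonormal v \<longleftrightarrow> (\<forall>i j. v i \<bullet> v j = (if i = j then 1 else 0))"

text \<open>The eigenvalues are unordered and indexed by the index type of the matrix. Keeping this
  a relation lets later statements quantify over every eigenbasis instead of selecting one.\<close>

definition eigenbasis :: "real ^ 'n ^ 'n::finite \<Rightarrow> ('n \<Rightarrow> real ^ 'n) \<Rightarrow> ('n \<Rightarrow> real) \<Rightarrow> bool" where
  "eigenbasis A v l \<longleftrightarrow> orthonormal v \<and> (\<forall>i. A *v v i = l i *\<^sub>R v i)"

lemma orthonormalD: "orthonormal v \<Longrightarrow> v i \<bullet> v j = (if i = j then 1 else 0)"
  by (simp add: orthonormal_def)

lemma orthonormal_matrix:
  assumes "orthonormal v"
  shows "(\<chi> i. v i) ** transpose (\<chi> i. v i) = mat 1" "transpose (\<chi> i. v i) ** (\<chi> i. v i) = mat 1"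
proof -
  show "(\<chi> i. v i) ** transpose (\<chi> i. v i) = mat 1"
    using assms by (simp add: orthonormal_def matrix_matrix_mult_def transpose_def mat_def vec_eq_iff inner_vec_def)
  then show "transpose (\<chi> i. v i) ** (\<chi> i. v i) = mat 1"
    using matrix_left_right_inverse by blast
qed

lemma orthonormal_expand:
  assumes "orthonormal v"
  shows "(\<Sum>i\<in>UNIV. (v i \<bullet> x) *\<^sub>R v i) = x"
proof -
  have "x = (transpose (\<chi> i. v i) ** (\<chi> i. v i)) *v x"
    using orthonormal_matrix(2)[OF assms] by simp
  also have "\<dots> = transpose (\<chi> i. v i) *v ((\<chi> i. v i) *v x)"
    by (simp add: matrix_vector_mul_assoc)
  also have "\<dots> = (\<Sum>i\<in>UNIV. (v i \<bullet> x) *\<^sub>R v i)"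
    by (simp add: vec_eq_iff matrix_vector_mult_def transpose_def inner_vec_def mult.commute)
  finally show ?thesis by simp
qed

lemma orthonormal_parseval:
  assumes "orthonormal v"
  shows "x \<bullet> y = (\<Sum>i\<in>UNIV. (v i \<bullet> x) * (v i \<bullet> y))"
proof -
  have "x \<bullet> y = (\<Sum>i\<in>UNIV. (v i \<bullet> x) *\<^sub>R v i) \<bullet> y"
    using orthonormal_expand[OF assms, of x] by simp
  then show ?thesis by (simp add: inner_sum_left)
qed

lemma orthonormal_norm:
  assumes "orthonormal v"
  shows "(norm x)\<^sup>2 = (\<Sum>i\<in>UNIV. (v i \<bullet> x)\<^sup>2)"
  using orthonormal_parseval[OF assms, of x x] by (simp only: power2_norm_eq_inner) (simp add: power2_eq_square)

lemma norm_orthonormal: "orthonormal v \<Longrightarrow> norm (v i) = 1"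
  by (simp add: norm_eq_1 orthonormal_def)

lemma orthonormal_eq_iff:
  assumes "orthonormal v"
  shows "x = y \<longleftrightarrow> (\<forall>i. v i \<bullet> x = v i \<bullet> y)"
proof
  assume "\<forall>i. v i \<bullet> x = v i \<bullet> y"
  then have "(\<Sum>i\<in>UNIV. (v i \<bullet> x) *\<^sub>R v i) = (\<Sum>i\<in>UNIV. (v i \<bullet> y) *\<^sub>R v i)" by simp
  then show "x = y" by (simp only: orthonormal_expand[OF assms])
qed simp

lemma inner_matrix_transpose:
  fixes A :: "real ^ 'n ^ 'n::finite"
  shows "x \<bullet> (A *v y) = (transpose A *v x) \<bullet> y"
  by (simp add: dot_lmul_matrix)

lemma symmetric_inner:
  fixes A :: "real ^ 'n ^ 'n::finite"
  assumes "transpose A = A"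
  shows "x \<bullet> (A *v y) = (A *v x) \<bullet> y"
  using inner_matrix_transpose[of x A y] assms by simp

lemma orthonormal_trace:
  fixes A :: "real ^ 'n ^ 'n::finite"
  assumes "orthonormal v"
  shows "(\<Sum>i\<in>UNIV. v i \<bullet> (A *v v i)) = trace A"
proof -
  let ?V = "\<chi> i. v i"
  have "(\<Sum>i\<in>UNIV. v i \<bullet> (A *v v i)) = trace (?V ** (A ** transpose ?V))"
    by (simp add: trace_def matrix_matrix_mult_def inner_vec_def matrix_vector_mult_def transpose_def)
  also have "\<dots> = trace ((A ** transpose ?V) ** ?V)" by (rule trace_mul_sym)
  also have "\<dots> = trace A"
    using orthonormal_matrix(2)[OF assms] by (simp add: matrix_mul_assoc[symmetric])
  finally show ?thesis .
qed

section \<open>Spectral theorem for symmetric matrices\<close>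

lemma quadratic_nonneg_linear_zero:
  fixes b c :: real
  assumes "\<And>t. 0 \<le> 2 * t * b + t\<^sup>2 * c"
  shows "b = 0"
proof (rule ccontr)
  assume b: "b \<noteq> 0"
  \<comment> \<open>Any positive k with \<open>c \<le> k\<close> serves: at t = - b / k the value is
    at most - b^2 / k.\<close>
  define k where "k = \<bar>c\<bar> + 1"
  have k: "k > 0" "c \<le> k" by (auto simp: k_def)
  have "0 \<le> 2 * (- b / k) * b + (- b / k)\<^sup>2 * c" by (rule assms)
  also have "\<dots> \<le> 2 * (- b / k) * b + (- b / k)\<^sup>2 * k"
    using k by (intro add_left_mono mult_left_mono) auto
  also have "\<dots> = - b\<^sup>2 / k"
    using k by (simp add: power2_eq_square field_simps)
  finally have "b\<^sup>2 / k \<le> 0" by simp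
  moreover have "b\<^sup>2 / k > 0" using b k by simp
  ultimately show False by simp
qed

text \<open>Induction over subsets of the index type, so the vectors come out already indexed. Each
  step maximises the quadratic form on the unit sphere of the orthogonal complement \<open>S\<close>
  of the vectors found so far; symmetry makes \<open>A\<close> preserve \<open>S\<close>.\<close>

lemma spectral_partial:
  fixes A :: "real ^ 'n ^ 'n::finite"
  assumes sym: "transpose A = A"
  shows "\<exists>v l. (\<forall>i\<in>I. \<forall>j\<in>I. v i \<bullet> v j = (if i = j then 1 else (0::real)))
    \<and> (\<forall>i\<in>(I::'n set). A *v v i = l i *\<^sub>R v i)"
proof (induction I rule: finite_induct[OF finite])
  case 1
  show ?case by simp
next
  case (2 k I)
  obtain v l where v: "\<And>i j. i \<in> I \<Longrightarrow> j \<in> I \<Longrightarrow> v i \<bullet> v j = (if i = j then 1 else (0::real))"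
    and l: "\<And>i. i \<in> I \<Longrightarrow> A *v v i = l i *\<^sub>R v i"
    using 2(3) by blast
  define S where "S = {x. \<forall>i\<in>I. v i \<bullet> x = 0}"
  have subS: "subspace S"
    by (auto simp: S_def subspace_def inner_add_right)
  have AS: "A *v x \<in> S" if "x \<in> S" for x
    using that by (auto simp: S_def symmetric_inner[OF sym] l)
  have "dim (v ` I) \<le> card (v ` I)" by (rule dim_le_card') auto
  also have "\<dots> \<le> card I" by (rule card_image_le) auto
  also have "\<dots> < card (insert k I)" using 2 by simp
  also have "\<dots> \<le> CARD('n)" by (rule card_mono) auto
  finally have "dim (v ` I) < DIM(real ^ 'n)" by simp
  then obtain x0 where x0: "x0 \<noteq> 0" "\<And>y. y \<in> span (v ` I) \<Longrightarrow> orthogonal x0 y"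
    using orthogonal_to_subspace_exists by blast
  have "x0 \<in> S"
    using x0(2) by (auto simp: S_def orthogonal_def inner_commute[of x0] span_base)
  define K where "K = S \<inter> sphere 0 1"
  have "compact K"
    unfolding K_def using subS by (simp add: closed_subspace compact_Int_closed inf_commute closed_Int_compact)
  moreover have "K \<noteq> {}"
  proof -
    have "x0 /\<^sub>R norm x0 \<in> K"
      using \<open>x0 \<in> S\<close> x0(1) subspace_scale[OF subS] by (auto simp: K_def)
    then show ?thesis by blast
  qed
  moreover have "continuous_on K (\<lambda>x. x \<bullet> (A *v x))"
    by (intro continuous_intros linear_continuous_on) (simp add: matrix_vector_mul_bounded_linear)
  ultimately obtain x where xK: "x \<in> K" and xmax: "\<And>y. y \<in> K \<Longrightarrow> y \<bullet> (A *v y) \<le> x \<bullet> (A *v x)"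
    using continuous_attains_sup[of K "\<lambda>x. x \<bullet> (A *v x)"] by blast
  define \<mu> where "\<mu> = x \<bullet> (A *v x)"
  have xS: "x \<in> S" and nx: "x \<bullet> x = 1"
    using xK by (auto simp: K_def norm_eq_1)
  have B: "0 \<le> \<mu> * (y \<bullet> y) - y \<bullet> (A *v y)" if "y \<in> S" for y
  proof (cases "y = 0")
    case False
    have "y /\<^sub>R norm y \<in> K"
      using that False subspace_scale[OF subS] by (auto simp: K_def)
    from xmax[OF this] have "(y \<bullet> (A *v y)) / (norm y)\<^sup>2 \<le> \<mu>"
      by (simp add: \<mu>_def matrix_vector_mult_scaleR power2_eq_square divide_simps)
    then show ?thesis using False by (simp add: divide_simps power2_norm_eq_inner mult.commute)
  qed simp
  \<comment> \<open>The form in \<open>B\<close> is nonnegative on \<open>S\<close> and vanishes at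
    the maximiser x, so its first variation there is zero. The residual lies in \<open>S\<close>
    itself, hence is orthogonal to itself.\<close>
  have orth: "y \<bullet> (\<mu> *\<^sub>R x - A *v x) = 0" if "y \<in> S" for y
  proof (rule quadratic_nonneg_linear_zero)
    fix t :: real
    have "x + t *\<^sub>R y \<in> S"
      using xS that subS by (simp add: subspace_add subspace_scale)
    from B[OF this] have "0 \<le> \<mu> * ((x + t *\<^sub>R y) \<bullet> (x + t *\<^sub>R y)) - (x + t *\<^sub>R y) \<bullet> (A *v (x + t *\<^sub>R y))" .
    also have "\<dots> = 2 * t * (y \<bullet> (\<mu> *\<^sub>R x - A *v x)) + t\<^sup>2 * (\<mu> * (y \<bullet> y) - y \<bullet> (A *v y))"
      using nx symmetric_inner[OF sym, of x y]
      by (simp add: \<mu>_def algebra_simps inner_simps matrix_vector_right_distrib matrix_vector_mult_scaleR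
          power2_eq_square inner_commute[of y x] inner_commute[of "A *v x" y])
    finally show "0 \<le> 2 * t * (y \<bullet> (\<mu> *\<^sub>R x - A *v x)) + t\<^sup>2 * (\<mu> * (y \<bullet> y) - y \<bullet> (A *v y))" .
  qed
  have "\<mu> *\<^sub>R x - A *v x \<in> S"
    using xS AS subS by (simp add: subspace_diff subspace_scale)
  from orth[OF this] have Ax: "A *v x = \<mu> *\<^sub>R x" by simp
  have vx: "v i \<bullet> x = 0" "x \<bullet> v i = 0" if "i \<in> I" for i
    using xS that by (auto simp: S_def inner_commute)
  show ?case
    by (rule exI[of _ "v(k := x)"], rule exI[of _ "l(k := \<mu>)"]) (use 2(2) v l vx nx Ax in auto)
qed

lemma spectral_theorem:
  fixes A :: "real ^ 'n ^ 'n::finite"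
  assumes "transpose A = A"
  shows "\<exists>v l. eigenbasis A v l"
  using spectral_partial[OF assms, of UNIV] by (auto simp: eigenbasis_def orthonormal_def)

section \<open>Eigenbases and the sorted list of eigenvalues\<close>

lemma eigenbasis_transpose:
  assumes "eigenbasis A v l"
  shows "v i \<bullet> (A *v x) = l i * (v i \<bullet> x)"
proof -
  have o: "orthonormal v" and e: "\<And>i. A *v v i = l i *\<^sub>R v i"
    using assms by (auto simp: eigenbasis_def)
  have "v i \<bullet> (A *v (\<Sum>j\<in>UNIV. (v j \<bullet> x) *\<^sub>R v j)) = l i * (v i \<bullet> x)"
    by (simp add: linear_sum[OF matrix_vector_mul_linear] matrix_vector_mult_scaleR e inner_sum_right
        orthonormalD[OF o] if_distrib cong: if_cong)
  then show ?thesis using orthonormal_expand[OF o] by simp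
qed

lemma eigenbasis_quadratic_form:
  assumes "eigenbasis A v l"
  shows "x \<bullet> (A *v x) = (\<Sum>i\<in>UNIV. l i * (v i \<bullet> x)\<^sup>2)"
proof -
  have "orthonormal v" using assms by (simp add: eigenbasis_def)
  then show ?thesis
    using orthonormal_parseval[of v x "A *v x"]
    by (simp add: eigenbasis_transpose[OF assms] power2_eq_square mult_ac)
qed

text \<open>The matrix with rows \<open>v i\<close> is orthogonal and diagonalises
  \<open>mat t - A\<close> for every real t; real polynomials that agree as functions are equal.
  This links \<open>eigvals\<close>, defined through roots, to eigenbases.\<close>

lemma charpoly_eigenbasis:
  assumes "eigenbasis A v l"
  shows "charpoly A = (\<Prod>i\<in>UNIV. [:- l i, 1:])"
proof -
  have o: "orthonormal v" and e: "\<And>i. A *v v i = l i *\<^sub>R v i"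
    using assms by (auto simp: eigenbasis_def)
  let ?V = "\<chi> i. v i"
  have "poly (charpoly A) t = poly (\<Prod>i\<in>UNIV. [:- l i, 1:]) t" for t
  proof -
    have mt: "mat t *v x = t *\<^sub>R x" for x :: "real ^ 'a"
      by (simp add: mat_def matrix_vector_mult_def vec_eq_iff if_distrib[of "\<lambda>y. y * _"] cong: if_cong)
    have "?V ** (mat t - A) ** transpose ?V = (\<chi> i j. if i = j then t - l i else 0)"
    proof -
      have "(?V ** ((mat t - A) ** transpose ?V)) $ i $ j = v i \<bullet> ((mat t - A) *v v j)" for i j
        by (simp add: matrix_matrix_mult_def inner_vec_def matrix_vector_mult_def transpose_def)
      then show ?thesis
        by (simp add: vec_eq_iff matrix_mul_assoc[symmetric] matrix_vector_mult_diff_rdistrib e mt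
            inner_diff_right orthonormalD[OF o])
    qed
    then have "det (?V ** (mat t - A) ** transpose ?V) = (\<Prod>i\<in>UNIV. t - l i)"
      by (simp add: det_diagonal)
    moreover have "det (?V ** (mat t - A) ** transpose ?V) = det (mat t - A)"
    proof -
      have "det ?V * det (transpose ?V) = 1"
        using orthonormal_matrix(1)[OF o] by (metis det_I det_mul)
      then show ?thesis by (simp add: det_mul mult_ac)
    qed
    ultimately show ?thesis by (simp add: poly_charpoly poly_prod)
  qed
  then show ?thesis by (simp add: poly_eq_poly_eq_iff[symmetric] fun_eq_iff)
qed

lemma proots_eigenbasis:
  assumes "eigenbasis A v l"
  shows "mset (eigvals A) = image_mset l (mset_set UNIV)"
proof -
  have "proots (\<Prod>i\<in>I. [:- l i, 1:]) = image_mset l (mset_set I)" if "finite I" for I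
    using that
  proof (induction I)
    case (insert i I)
    have "(\<Prod>i\<in>I. [:- l i, 1:]) \<noteq> 0" using insert by (simp add: prod_zero_iff)
    then show ?case using insert proots_mult[of "[:- l i, 1:]" "\<Prod>i\<in>I. [:- l i, 1:]"] by (simp del: mult_pCons_left)
  qed simp
  then show ?thesis by (simp add: eigvals_def charpoly_eigenbasis[OF assms])
qed

lemma length_eigvals:
  fixes A :: "real ^ 'n ^ 'n::finite"
  assumes "eigenbasis A v l" shows "length (eigvals A) = CARD('n)"
  using arg_cong[OF proots_eigenbasis[OF assms], of size] by simp

lemma sum_eigval:
  fixes A :: "real ^ 'n ^ 'n::finite" and f :: "real \<Rightarrow> real"
  assumes "eigenbasis A v l"
  shows "(\<Sum>i = 1..CARD('n). f (eigval A i)) = (\<Sum>i\<in>UNIV. f (l i))"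
proof -
  \<comment> \<open>\<open>eigval\<close> counts from 1, list access from 0.\<close>
  have "(\<Sum>i = 1..CARD('n). f (eigval A i)) = (\<Sum>i<CARD('n). f (eigvals A ! i))"
    by (rule sum.reindex_bij_witness[of _ Suc "\<lambda>i. i - 1"]) (auto simp: eigval_def)
  also have "\<dots> = sum_list (map f (eigvals A))"
    by (simp add: sum_list_sum_nth length_eigvals[OF assms] atLeast0LessThan)
  also have "\<dots> = sum_mset (image_mset f (mset (eigvals A)))"
    by (metis mset_map sum_mset_sum_list)
  also have "\<dots> = (\<Sum>i\<in>UNIV. f (l i))"
    by (simp add: proots_eigenbasis[OF assms] sum_unfold_sum_mset image_mset.compositionality o_def)
  finally show ?thesis .
qed

lemma eigval_bounds:
  fixes A :: "real ^ 'n ^ 'n::finite"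
  assumes "eigenbasis A v l"
  shows "eigval A 1 \<le> l i" "l i \<le> eigval A CARD('n)"
proof -
  have "l i \<in> set (eigvals A)"
    by (simp flip: set_mset_mset add: proots_eigenbasis[OF assms])
  then obtain k where k: "k < CARD('n)" "l i = eigvals A ! k"
    by (metis in_set_conv_nth length_eigvals[OF assms])
  show "eigval A 1 \<le> l i" "l i \<le> eigval A CARD('n)"
    using k sorted_nth_mono[OF sorted_eigvals, of 0 k A] sorted_nth_mono[OF sorted_eigvals, of k "CARD('n) - 1" A]
    by (simp_all add: eigval_def length_eigvals[OF assms])
qed

text \<open>The squared overlaps \<open>(v i \<bullet> w j)\<^sup>2\<close> of two eigenbases form a doubly stochastic matrix,
  so trace functions can be expanded to second order without any choice of continuous eigenvectors.\<close>

lemma trace_function_taylor: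
  fixes f f' :: "real \<Rightarrow> real"
  assumes A: "eigenbasis A v l" and B: "eigenbasis B w m"
    and taylor: "\<And>a b. \<bar>f b - f a - f' a * (b - a)\<bar> \<le> C * (b - a)\<^sup>2"
  shows "\<bar>(\<Sum>i\<in>UNIV. f (m i)) - (\<Sum>i\<in>UNIV. f (l i)) - (\<Sum>i\<in>UNIV. f' (l i) * (v i \<bullet> ((B - A) *v v i)))\<bar>
    \<le> C * (\<Sum>i\<in>UNIV. (norm ((B - A) *v v i))\<^sup>2)"
proof -
  have ov: "orthonormal v" and ow: "orthonormal w" and eA: "\<And>i. A *v v i = l i *\<^sub>R v i"
    using A B by (auto simp: eigenbasis_def)
  define p where "p i j = (w j \<bullet> v i)\<^sup>2" for i j
  have p1: "(\<Sum>j\<in>UNIV. p i j) = 1" for i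
    using orthonormal_norm[OF ow, of "v i"] norm_orthonormal[OF ov, of i] by (simp add: p_def)
  have p2: "(\<Sum>i\<in>UNIV. p i j) = 1" for j
    using orthonormal_norm[OF ov, of "w j"] norm_orthonormal[OF ow, of j] by (simp add: p_def inner_commute)
  have wj: "w j \<bullet> ((B - A) *v v i) = (m j - l i) * (w j \<bullet> v i)" for i j
    by (simp add: matrix_vector_mult_diff_rdistrib inner_diff_right eigenbasis_transpose[OF B] eA algebra_simps)
  have q1: "v i \<bullet> ((B - A) *v v i) = (\<Sum>j\<in>UNIV. (m j - l i) * p i j)" for i
    using orthonormal_parseval[OF ow, of "v i" "(B - A) *v v i"]
    by (simp add: wj p_def power2_eq_square mult_ac)
  have q2: "(norm ((B - A) *v v i))\<^sup>2 = (\<Sum>j\<in>UNIV. (m j - l i)\<^sup>2 * p i j)" for i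
    using orthonormal_norm[OF ow, of "(B - A) *v v i"]
    by (simp add: wj p_def power_mult_distrib)
  have "(\<Sum>i\<in>UNIV. f (m i)) = (\<Sum>j\<in>UNIV. \<Sum>i\<in>UNIV. f (m j) * p i j)"
    by (simp add: sum_distrib_left[symmetric] p2)
  also have "\<dots> = (\<Sum>i\<in>UNIV. \<Sum>j\<in>UNIV. f (m j) * p i j)" by (rule sum.swap)
  finally have s1: "(\<Sum>i\<in>UNIV. f (m i)) = (\<Sum>i\<in>UNIV. \<Sum>j\<in>UNIV. f (m j) * p i j)" .
  have s2: "(\<Sum>i\<in>UNIV. f (l i)) = (\<Sum>i\<in>UNIV. \<Sum>j\<in>UNIV. f (l i) * p i j)"
    by (simp add: sum_distrib_left[symmetric] p1)
  \<comment> \<open>Once all sums are spread over pairs (i, j), the error is a combination of scalar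
    Taylor errors with the nonnegative weights \<open>p i j\<close>.\<close>
  have "(\<Sum>i\<in>UNIV. f (m i)) - (\<Sum>i\<in>UNIV. f (l i)) - (\<Sum>i\<in>UNIV. f' (l i) * (v i \<bullet> ((B - A) *v v i)))
      = (\<Sum>i\<in>UNIV. \<Sum>j\<in>UNIV. (f (m j) - f (l i) - f' (l i) * (m j - l i)) * p i j)"
    by (simp add: s1 s2 q1 sum_distrib_left sum_subtractf left_diff_distrib right_diff_distrib mult.assoc)
  also have "\<bar>\<dots>\<bar> \<le> (\<Sum>i\<in>UNIV. \<Sum>j\<in>UNIV. C * (m j - l i)\<^sup>2 * p i j)"
  proof -
    have "\<bar>(f (m j) - f (l i) - f' (l i) * (m j - l i)) * p i j\<bar> \<le> C * (m j - l i)\<^sup>2 * p i j" for i j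
      using mult_right_mono[OF taylor[of "m j" "l i"], of "p i j"] by (simp add: abs_mult p_def)
    then have "\<bar>\<Sum>j\<in>UNIV. (f (m j) - f (l i) - f' (l i) * (m j - l i)) * p i j\<bar>
        \<le> (\<Sum>j\<in>UNIV. C * (m j - l i)\<^sup>2 * p i j)" for i
      by (rule order_trans[OF sum_abs sum_mono])
    then show ?thesis by (rule order_trans[OF sum_abs sum_mono])
  qed
  also have "\<dots> = C * (\<Sum>i\<in>UNIV. (norm ((B - A) *v v i))\<^sup>2)"
    by (simp add: q2 sum_distrib_left mult.assoc)
  finally show ?thesis .
qed

section \<open>Volume of images under maps with bounded Jacobian\<close>

text \<open>The change-of-variables theory of HOL-Analysis is stated for well-ordered index types only;
  \<open>idx\<close> is a well-ordered copy of an arbitrary finite type.\<close>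

typedef (overloaded) 'a idx = "{..<CARD('a::finite)}"
  by (rule exI[of _ 0]) simp

instance idx :: (finite) finite
proof
  have "finite (Abs_idx ` {..<CARD('a)} :: 'a idx set)" by simp
  then show "finite (UNIV :: 'a idx set)"
    by (simp only: type_definition.Abs_image[OF type_definition_idx])
qed

instantiation idx :: (finite) linorder
begin
definition less_eq_idx :: "'a idx \<Rightarrow> 'a idx \<Rightarrow> bool" where
  "less_eq_idx x y \<longleftrightarrow> Rep_idx x \<le> Rep_idx y"
definition less_idx :: "'a idx \<Rightarrow> 'a idx \<Rightarrow> bool" where
  "less_idx x y \<longleftrightarrow> Rep_idx x < Rep_idx y"
instance
proof
  fix x y z :: "'a idx"
  show "x < y \<longleftrightarrow> x \<le> y \<and> \<not> y \<le> x"
    unfolding less_eq_idx_def less_idx_def by (rule less_le_not_le)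
  show "x \<le> x" unfolding less_eq_idx_def by (rule order_refl)
  show "x \<le> y \<Longrightarrow> y \<le> z \<Longrightarrow> x \<le> z" unfolding less_eq_idx_def by (rule order_trans)
  show "x \<le> y \<Longrightarrow> y \<le> x \<Longrightarrow> x = y"
    unfolding less_eq_idx_def Rep_idx_inject[symmetric] by (rule order_antisym)
  show "x \<le> y \<or> y \<le> x" unfolding less_eq_idx_def by (rule linear)
qed
end

instance idx :: (finite) wellorder
proof
  fix P :: "'a idx \<Rightarrow> bool" and a :: "'a idx"
  assume step: "\<And>x. (\<And>y. y < x \<Longrightarrow> P y) \<Longrightarrow> P x"
  have "\<forall>x. Rep_idx x = n \<longrightarrow> P x" for n
    by (induction n rule: less_induct) (metis step less_idx_def)
  then show "P a" by blast
qed

lemma card_idx: "CARD('a::finite idx) = CARD('a)"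
  using type_definition.card[OF type_definition_idx] by simp

lemma abs_det_le:
  fixes A :: "real ^ 'n ^ 'n::finite"
  assumes "\<And>i j. \<bar>A $ i $ j\<bar> \<le> b"
  shows "\<bar>det A\<bar> \<le> fact CARD('n) * b ^ CARD('n)"
proof -
  have "\<bar>det A\<bar> \<le> (\<Sum>p | p permutes (UNIV::'n set). \<bar>of_int (sign p) * (\<Prod>i\<in>UNIV. A $ i $ p i)\<bar>)"
    unfolding det_def by (rule sum_abs)
  also have "\<dots> \<le> (\<Sum>p | p permutes (UNIV::'n set). b ^ CARD('n))"
  proof (rule sum_mono)
    fix p :: "'n \<Rightarrow> 'n"
    have "\<bar>of_int (sign p) * (\<Prod>i\<in>UNIV. A $ i $ p i)\<bar> = (\<Prod>i\<in>UNIV. \<bar>A $ i $ p i\<bar>)"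
      by (simp add: abs_mult sign_def abs_prod)
    also have "\<dots> \<le> (\<Prod>i\<in>(UNIV::'n set). b)"
      by (rule prod_mono) (use assms in auto)
    finally show "\<bar>of_int (sign p) * (\<Prod>i\<in>UNIV. A $ i $ p i)\<bar> \<le> b ^ CARD('n)" by simp
  qed
  also have "\<dots> = fact CARD('n) * b ^ CARD('n)"
    by (simp add: card_permutations[OF refl])
  finally show ?thesis .
qed

lemma measure_image_wellorder:
  fixes f :: "real ^ 'n::{finite,wellorder} \<Rightarrow> real ^ 'n::_"
  assumes S: "compact S"
    and der: "\<And>x. x \<in> S \<Longrightarrow> (f has_derivative f' x) (at x)"
    and bound: "\<And>x i j. x \<in> S \<Longrightarrow> \<bar>f' x (axis j 1) $ i\<bar> \<le> b"
  shows "measure lebesgue (f ` S) \<le> fact CARD('n) * b ^ CARD('n) * measure lebesgue S"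
proof (rule measure_bounded_differentiable_image)
  show lm: "S \<in> lmeasurable" using S by (rule lmeasurable_compact)
  show der': "(f has_derivative f' x) (at x within S)" if "x \<in> S" for x
    using der[OF that] by (rule has_derivative_at_withinI)
  show B: "\<bar>det (matrix (f' x))\<bar> \<le> fact CARD('n) * b ^ CARD('n)" if "x \<in> S" for x
    by (rule abs_det_le) (use bound[OF that] in \<open>simp add: matrix_def\<close>)
  show "(\<lambda>x. \<bar>det (matrix (f' x))\<bar>) integrable_on S"
  proof (rule measurable_bounded_by_integrable_imp_integrable)
    show "(\<lambda>x. \<bar>det (matrix (f' x))\<bar>) \<in> borel_measurable (lebesgue_on S)"
      by (intro borel_measurable_abs borel_measurable_det_Jacobian[OF _ der']) (use lm in auto)
    show "(\<lambda>x. fact CARD('n) * b ^ CARD('n)) integrable_on S"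
      using lm by (rule integrable_on_const)
    show "norm \<bar>det (matrix (f' x))\<bar> \<le> fact CARD('n) * b ^ CARD('n)" if "x \<in> S" for x
      using B[OF that] by simp
    show "S \<in> sets lebesgue" using lm by auto
  qed
qed

text \<open>The preimage of a box is the box with the same sides in another order, and
  \<open>lborel\<close> is determined by the volumes of boxes.\<close>

lemma distr_lborel_reindex:
  fixes q :: "'m::finite \<Rightarrow> 'n::finite"
  assumes q: "bij q"
  shows "distr lborel borel (\<lambda>x::real ^ 'n. (\<chi> i. x $ q i) :: real ^ 'm) = lborel"
proof (rule lborel_eqI[symmetric])
  let ?P = "\<lambda>x::real ^ 'n. (\<chi> i. x $ q i) :: real ^ 'm"
  let ?R = "\<lambda>x::real ^ 'm. (\<chi> i. x $ inv q i) :: real ^ 'n"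
  have qi: "inv q (q i) = i" "q (inv q j) = j" for i j
    using q by (simp_all add: bij_is_inj bij_is_surj inv_f_f surj_f_inv_f)
  have "?P \<in> borel_measurable borel"
    by (rule borel_measurable_continuous_onI) (intro continuous_intros)
  then have meas: "?P \<in> borel_measurable lborel" by simp
  fix l u :: "real ^ 'm"
  assume "\<And>b. b \<in> Basis \<Longrightarrow> l \<bullet> b \<le> u \<bullet> b"
  then have lu: "l $ i \<le> u $ i" for i
    by (metis cart_eq_inner_axis axis_in_Basis_iff Basis_real_def singletonI)
  have "?P -` box l u = box (?R l) (?R u)"
  proof -
    have all_q: "(\<forall>j. R j) \<longleftrightarrow> (\<forall>i. R (q i))" for R using qi(2) by metis
    show ?thesis
      by (auto simp: mem_box_cart qi all_q[of "\<lambda>j. l $ inv q j < _ $ j \<and> _ $ j < u $ inv q j"])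
  qed
  then have "emeasure (distr lborel borel ?P) (box l u) = emeasure lborel (box (?R l) (?R u))"
    using meas by (subst emeasure_distr) auto
  also have "\<dots> = (\<Prod>b\<in>Basis. (?R u - ?R l) \<bullet> b)"
    by (rule emeasure_lborel_box) (auto simp: Basis_vec_def inner_axis lu)
  also have "(\<Prod>b\<in>Basis. (?R u - ?R l) \<bullet> b) = (\<Prod>i\<in>UNIV. (?R u - ?R l) $ i)"
    by (simp add: Basis_vec_def prod.UNION_disjoint inner_axis axis_eq_axis)
  also have "\<dots> = (\<Prod>i\<in>UNIV. (u - l) $ i)"
    by (rule prod.reindex_bij_witness[of _ q "inv q"]) (auto simp: qi)
  also have "\<dots> = (\<Prod>b\<in>Basis. (u - l) \<bullet> b)"
    by (simp add: Basis_vec_def prod.UNION_disjoint inner_axis axis_eq_axis)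
  finally show "emeasure (distr lborel borel ?P) (box l u) = (\<Prod>b\<in>Basis. (u - l) \<bullet> b)" .
qed simp

text \<open>Compact sets and their continuous images are Borel, so \<open>lebesgue\<close> can be
  exchanged for \<open>lborel\<close> on both sides.\<close>

lemma measure_reindex_compact:
  fixes q :: "'m::finite \<Rightarrow> 'n::finite"
  assumes q: "bij q" and S: "compact (S :: (real ^ 'n) set)"
  shows "measure lebesgue ((\<lambda>x. (\<chi> i. x $ q i) :: real ^ 'm) ` S) = measure lebesgue S"
proof -
  let ?P = "\<lambda>x::real ^ 'n. (\<chi> i. x $ q i) :: real ^ 'm"
  have cont: "continuous_on A ?P" for A by (intro continuous_intros)
  have "?P \<in> borel_measurable borel"
    by (rule borel_measurable_continuous_onI[OF cont])
  then have meas: "?P \<in> borel_measurable lborel" by simp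
  have cS: "compact (?P ` S)" by (rule compact_continuous_image[OF cont S])
  then have bS: "?P ` S \<in> sets borel" "S \<in> sets borel" using S by (auto intro: borel_compact)
  have inj: "inj ?P"
  proof (rule injI)
    fix x y assume "?P x = ?P y"
    then have "x $ q i = y $ q i" for i by (simp add: vec_eq_iff)
    from this[of "inv q _"] show "x = y"
      using q by (simp add: vec_eq_iff bij_is_surj surj_f_inv_f)
  qed
  have "measure lborel (?P ` S) = measure (distr lborel borel ?P) (?P ` S)"
    by (simp add: distr_lborel_reindex[OF q])
  also have "\<dots> = measure lborel (?P -` (?P ` S))"
    using meas bS by (subst measure_distr) auto
  also have "?P -` (?P ` S) = S" using inj by (simp add: inj_vimage_image_eq)
  finally show ?thesis using bS by simp
qed

text \<open>Conjugation with a relabelling of coordinates by \<open>idx\<close>. The bound is put on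
  the entries of the Jacobian because entries are merely permuted by the relabelling.\<close>

lemma measure_image_bounded_jacobian:
  fixes f :: "real ^ 'n::finite \<Rightarrow> real ^ 'n"
  assumes S: "compact S"
    and der: "\<And>x. x \<in> S \<Longrightarrow> (f has_derivative f' x) (at x)"
    and bound: "\<And>x i j. x \<in> S \<Longrightarrow> \<bar>f' x (axis j 1) $ i\<bar> \<le> b"
  shows "measure lebesgue (f ` S) \<le> fact CARD('n) * b ^ CARD('n) * measure lebesgue S"
proof -
  obtain q :: "'n idx \<Rightarrow> 'n" where q: "bij q"
    using finite_same_card_bij[of "UNIV :: 'n idx set" "UNIV :: 'n set"] card_idx by auto
  have qi: "inv q (q i) = i" "q (inv q j) = j" for i j
    using q by (simp_all add: bij_is_inj bij_is_surj inv_f_f surj_f_inv_f)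
  let ?P = "\<lambda>x::real ^ 'n. (\<chi> i. x $ q i) :: real ^ 'n idx"
  let ?R = "\<lambda>x::real ^ 'n idx. (\<chi> i. x $ inv q i) :: real ^ 'n"
  have PR: "?R (?P x) = x" "?P (?R y) = y" for x y by (simp_all add: qi vec_eq_iff)
  have linP: "bounded_linear ?P"
    by (rule linear_conv_bounded_linear[THEN iffD1]) (auto intro!: linearI simp: vec_eq_iff)
  have linR: "bounded_linear ?R"
    by (rule linear_conv_bounded_linear[THEN iffD1]) (auto intro!: linearI simp: vec_eq_iff)
  have contf: "continuous_on S f"
    by (intro continuous_at_imp_continuous_on ballI has_derivative_continuous[OF der])
  have cf: "compact (f ` S)" by (rule compact_continuous_image[OF contf S])
  have cP: "compact (?P ` S)"
    by (rule compact_continuous_image[OF linear_continuous_on[OF linP] S])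
  have "measure lebesgue ((\<lambda>y. ?P (f (?R y))) ` (?P ` S))
      \<le> fact CARD('n idx) * b ^ CARD('n idx) * measure lebesgue (?P ` S)"
  proof (rule measure_image_wellorder[OF cP])
    fix y assume "y \<in> ?P ` S"
    then have yS: "?R y \<in> S" using PR by auto
    show "((\<lambda>y. ?P (f (?R y))) has_derivative (\<lambda>h. ?P (f' (?R y) (?R h)))) (at y)"
      by (rule bounded_linear.has_derivative[OF linP])
        (rule has_derivative_compose[OF bounded_linear_imp_has_derivative[OF linR] der[OF yS]])
    fix i j
    have "?R (axis j 1) = axis (q j) 1" by (auto simp: vec_eq_iff axis_def qi)
    then show "\<bar>?P (f' (?R y) (?R (axis j 1))) $ i\<bar> \<le> b"
      using bound[OF yS] by simp
  qed
  moreover have "(\<lambda>y. ?P (f (?R y))) ` (?P ` S) = ?P ` (f ` S)"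
    by (simp add: image_image qi)
  ultimately show ?thesis
    by (simp add: measure_reindex_compact[OF q cf] measure_reindex_compact[OF q S] card_idx)
qed

section \<open>Entire supersolutions\<close>

text \<open>If c were negative, f' would be negative just after 0, and the mean value theorem would
  push f below f 0.\<close>

lemma min_second_derivative_nonneg:
  fixes f f' :: "real \<Rightarrow> real"
  assumes f: "\<And>t. (f has_real_derivative f' t) (at t)"
    and f': "(f' has_real_derivative c) (at 0)"
    and d: "0 < d" and min: "\<And>t. \<bar>t\<bar> < d \<Longrightarrow> f 0 \<le> f t"
  shows "f' 0 = 0" "0 \<le> c"
proof -
  show z: "f' 0 = 0"
    by (rule DERIV_local_min[OF f d]) (use min in auto)
  show "0 \<le> c"
  proof (rule ccontr)
    assume "\<not> 0 \<le> c"
    then obtain e where e: "e > 0" "\<And>h. 0 < h \<Longrightarrow> h < e \<Longrightarrow> f' h < 0"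
      using DERIV_neg_dec_right[OF f'] z by auto
    define t where "t = min e d / 2"
    have t: "0 < t" "t < e" "t < d" using e d by (auto simp: t_def)
    obtain s where s: "0 < s" "s < t" "f t - f 0 = (t - 0) * f' s"
      using MVT2[of 0 t f f'] f t by blast
    have "f' s < 0" using e(2)[of s] s t by simp
    then have "(t - 0) * f' s < 0" using t by (simp add: mult_pos_neg)
    then show False using min[of t] s t by simp
  qed
qed

text \<open>Ellipticity turns the weighted trace into a bound for the trace, which dominates each
  diagonal entry of a positive semidefinite matrix. Testing with \<open>axis i 1\<close> plus and
  minus \<open>axis j 1\<close> bounds the other entries.\<close>

lemma psd_entry_bound:
  fixes F :: "real ^ 'n ^ 'n::finite"
  assumes sym: "transpose F = F" and psd: "\<And>x. 0 \<le> x \<bullet> (F *v x)"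
    and v: "orthonormal v" and \<kappa>: "0 < \<kappa>" and \<nu>: "\<And>i. \<kappa> \<le> \<nu> i"
    and le: "(\<Sum>i\<in>UNIV. \<nu> i * (v i \<bullet> (F *v v i))) \<le> m"
  shows "\<bar>F $ i $ j\<bar> \<le> m / \<kappa>"
proof -
  have e: "axis p 1 \<bullet> (F *v axis q 1) = F $ p $ q" for p q
    by (simp add: inner_axis' matrix_vector_mul_component inner_axis)
  have Fs: "F $ p $ q = F $ q $ p" for p q
    using sym by (metis transpose_def vec_lambda_beta)
  have "\<kappa> * trace F = (\<Sum>i\<in>UNIV. \<kappa> * (v i \<bullet> (F *v v i)))"
    by (simp add: orthonormal_trace[OF v, symmetric] sum_distrib_left)
  also have "\<dots> \<le> (\<Sum>i\<in>UNIV. \<nu> i * (v i \<bullet> (F *v v i)))"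
    by (intro sum_mono mult_right_mono \<nu> psd)
  finally have tr: "trace F \<le> m / \<kappa>" using le \<kappa> by (simp add: field_simps)
  have diag: "0 \<le> F $ p $ p" for p using psd[of "axis p 1"] by (simp add: e)
  have dle: "F $ p $ p \<le> m / \<kappa>" for p
  proof -
    have "F $ p $ p \<le> trace F"
      unfolding trace_def by (rule member_le_sum) (auto simp: diag)
    then show ?thesis using tr by simp
  qed
  have "0 \<le> F $ i $ i + F $ j $ j + 2 * F $ i $ j"
    using psd[of "axis i 1 + axis j 1"]
    by (simp add: matrix_vector_right_distrib inner_add_left inner_add_right e Fs[of j i])
  moreover have "0 \<le> F $ i $ i + F $ j $ j - 2 * F $ i $ j"
    using psd[of "axis i 1 - axis j 1"]
    by (simp add: matrix_vector_mult_diff_distrib inner_diff_left inner_diff_right e Fs[of j i])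
  ultimately show ?thesis using dle[of i] dle[of j] by (simp add: abs_le_iff)
qed

text \<open>Points where a concave paraboloid of opening \<open>a\<close> with vertex in
  \<open>Y\<close>, raised from below, first touches the graph of \<open>w\<close>.\<close>

definition contact :: "('a::real_inner \<Rightarrow> real) \<Rightarrow> real \<Rightarrow> 'a set \<Rightarrow> 'a set" where
  "contact w a Y = {x. \<exists>y\<in>Y. \<forall>z. w x + a / 2 * (norm (x - y))\<^sup>2 \<le> w z + a / 2 * (norm (z - y))\<^sup>2}"

lemma norm_line: "(norm (x + t *\<^sub>R v - y))\<^sup>2 = (norm (x - y))\<^sup>2 + 2 * t * (v \<bullet> (x - y)) + t\<^sup>2 * (norm v)\<^sup>2"
  for x v y :: "'a::real_inner"
proof -
  have "x + t *\<^sub>R v - y = (x - y) + t *\<^sub>R v" by simp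
  then show ?thesis
    by (simp only: power2_norm_eq_inner inner_add_left inner_add_right inner_scaleR_left inner_scaleR_right
        inner_commute[of "x - y" v]) (simp add: power2_eq_square algebra_simps)
qed

text \<open>On the annulus of \<open>barrier\<close> the scaled squared distance s is at least 1/16.
  The value makes 4 alpha^2 kappa s - 2 alpha n at least alpha (8 n + 4) / 4 - 2 alpha n =
  alpha.\<close>

definition barrier_exponent :: "nat \<Rightarrow> real \<Rightarrow> real" where
  "barrier_exponent n \<kappa> = (8 * real n + 4) / \<kappa>"

text \<open>The scaled squared distance is at most 36 there, so this height times exp (- alpha s) is
  at least n, which beats the contribution \<open>a * n\<close> of the paraboloid.\<close>

definition barrier_height :: "nat \<Rightarrow> real \<Rightarrow> real" where
  "barrier_height n \<kappa> = real n * exp (36 * barrier_exponent n \<kappa>)"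

text \<open>Opening \<open>a\<close> plus an added opening of 7 times the barrier height times
  \<open>a\<close>; see the numerical inequality in \<open>contact_growth\<close> for the 7.\<close>

definition opening_ratio :: "nat \<Rightarrow> real \<Rightarrow> real" where
  "opening_ratio n \<kappa> = 1 + 7 * barrier_height n \<kappa>"

text \<open>Leibniz bound for a determinant whose entries are at most
  \<open>n / \<kappa>\<close>.\<close>

definition jacobian_bound :: "nat \<Rightarrow> real \<Rightarrow> real" where
  "jacobian_bound n \<kappa> = fact n * (real n / \<kappa>) ^ n"

text \<open>In \<open>noncontact_covering\<close> a ball of radius 5 r / 2 is compared with vertices
  filling a ball of radius (r / 4) / 8; the ratio of the radii is 80.\<close>

definition covering_constant :: "nat \<Rightarrow> real \<Rightarrow> real" where
  "covering_constant n \<kappa> = 80 ^ n * jacobian_bound n \<kappa>"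

text \<open>The coefficient matrix appears only through a frame and weights given at each point
  separately, because the eigenframes of \<open>M\<close> cannot in general be chosen continuously.
  The larger ellipticity constant is normalised to 1.\<close>

locale supersolution =
  fixes \<kappa> :: real and w :: "real ^ 'n::finite \<Rightarrow> real" and D :: "real ^ 'n \<Rightarrow> real ^ 'n"
    and E :: "real ^ 'n \<Rightarrow> real ^ 'n ^ 'n"
  assumes kappa: "0 < \<kappa>" "\<kappa> \<le> 1"
    and nonneg: "0 \<le> w x"
    and has_gradient: "(w has_derivative (\<lambda>h. D x \<bullet> h)) (at x)"
    and has_hessian: "(D has_derivative (\<lambda>h. E x *v h)) (at x)"
    and hessian_symmetric: "transpose (E x) = E x"
    and elliptic: "\<exists>v \<nu>. orthonormal v \<and> (\<forall>i. \<kappa> \<le> \<nu> i \<and> \<nu> i \<le> 1)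
      \<and> (\<Sum>i\<in>UNIV. \<nu> i * (v i \<bullet> (E x *v v i))) \<le> 0"
begin

section \<open>Contact sets of sliding paraboloids\<close>

lemma card_ge_1: "1 \<le> real CARD('n)"
  using zero_less_card_finite[where 'a='n] by linarith

lemma exponent_ge_1: "1 \<le> barrier_exponent CARD('n) \<kappa>"
proof -
  have "\<kappa> \<le> 8 * real CARD('n) + 4" using kappa card_ge_1 by linarith
  then show ?thesis using kappa by (simp add: barrier_exponent_def)
qed

lemma height_ge_1: "1 \<le> barrier_height CARD('n) \<kappa>"
  unfolding barrier_height_def
  using card_ge_1 exponent_ge_1 mult_mono[of 1 "real CARD('n)" 1 "exp (36 * barrier_exponent CARD('n) \<kappa>)"] by simp

lemma jacobian_bound_ge_1: "1 \<le> jacobian_bound CARD('n) \<kappa>"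
proof -
  have "\<kappa> \<le> real CARD('n)" using kappa card_ge_1 by linarith
  then have "1 \<le> real CARD('n) / \<kappa>" using kappa by simp
  then have "1 \<le> (real CARD('n) / \<kappa>) ^ CARD('n)" by simp
  moreover have "(1::real) \<le> fact CARD('n)" by simp
  ultimately show ?thesis
    unfolding jacobian_bound_def using mult_mono[of 1 "fact CARD('n)" 1 "(real CARD('n) / \<kappa>) ^ CARD('n)"] by simp
qed

lemma covering_constant_ge_1: "1 \<le> covering_constant CARD('n) \<kappa>"
proof -
  have "(1::real) \<le> 80 ^ CARD('n)" by simp
  then show ?thesis
    unfolding covering_constant_def using jacobian_bound_ge_1 mult_mono[of 1 "80 ^ CARD('n)" 1 "jacobian_bound CARD('n) \<kappa>"] by simp
qed

lemma continuous_w: "continuous_on S w"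
  by (intro continuous_at_imp_continuous_on ballI has_derivative_continuous[OF has_gradient])

lemma line_derivative: "((\<lambda>t. w (x + t *\<^sub>R v)) has_real_derivative D (x + t *\<^sub>R v) \<bullet> v) (at t)"
proof -
  have "((\<lambda>t. x + t *\<^sub>R v) has_derivative (\<lambda>h. h *\<^sub>R v)) (at t)"
    by (auto intro!: derivative_eq_intros)
  from has_derivative_compose[OF this has_gradient]
  show ?thesis by (simp add: has_field_derivative_def mult_commute_abs)
qed

lemma line_second_derivative: "((\<lambda>t. D (x + t *\<^sub>R v) \<bullet> v) has_real_derivative v \<bullet> (E x *v v)) (at 0)"
proof -
  have "((\<lambda>t. x + t *\<^sub>R v) has_derivative (\<lambda>h. h *\<^sub>R v)) (at 0)"
    by (auto intro!: derivative_eq_intros)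
  from has_derivative_compose[OF this, of D "\<lambda>h. E x *v h"] has_hessian[of x]
  have "((\<lambda>t. D (x + t *\<^sub>R v)) has_derivative (\<lambda>h. E x *v (h *\<^sub>R v))) (at 0)" by simp
  from has_derivative_inner_left[OF this, of v]
  show ?thesis
    by (simp add: has_field_derivative_def matrix_vector_mult_scaleR mult_commute_abs inner_commute)
qed

text \<open>The sum of \<open>w\<close> and the paraboloid has a global minimum at x; the conditions
  are the one-dimensional ones on every line through x.\<close>

lemma contact_critical:
  assumes x: "\<And>z. w x + a / 2 * (norm (x - y))\<^sup>2 \<le> w z + a / 2 * (norm (z - y))\<^sup>2"
  shows "D x + a *\<^sub>R (x - y) = 0" "0 \<le> v \<bullet> (E x *v v) + a * (norm v)\<^sup>2"
proof -
  let ?f = "\<lambda>v t. w (x + t *\<^sub>R v) + a / 2 * ((norm (x - y))\<^sup>2 + 2 * t * (v \<bullet> (x - y)) + t\<^sup>2 * (norm v)\<^sup>2)"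
  let ?f' = "\<lambda>v t. D (x + t *\<^sub>R v) \<bullet> v + (a * (v \<bullet> (x - y)) + a * t * (norm v)\<^sup>2)"
  have 1: "(?f v has_real_derivative ?f' v t) (at t)" for v t
    by (rule DERIV_add[OF line_derivative]) (auto intro!: derivative_eq_intros simp: field_simps)
  have 2: "(?f' v has_real_derivative v \<bullet> (E x *v v) + a * (norm v)\<^sup>2) (at 0)" for v
    by (rule DERIV_add[OF line_second_derivative]) (auto intro!: derivative_eq_intros)
  have 3: "?f v 0 \<le> ?f v t" for v t
    using x[of "x + t *\<^sub>R v"] by (simp add: norm_line)
  note min = min_second_derivative_nonneg[OF 1 2 zero_less_one 3]
  show "0 \<le> v \<bullet> (E x *v v) + a * (norm v)\<^sup>2" by (rule min(2))
  have "v \<bullet> (D x + a *\<^sub>R (x - y)) = 0" for v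
    using min(1)[of v] by (simp add: inner_add_right inner_commute)
  from this[of "D x + a *\<^sub>R (x - y)"] show "D x + a *\<^sub>R (x - y) = 0" by simp
qed

lemma contact_exists:
  assumes a: "0 < a"
  obtains x where "\<And>z. w x + a / 2 * (norm (x - y))\<^sup>2 \<le> w z + a / 2 * (norm (z - y))\<^sup>2"
proof -
  \<comment> \<open>Outside this ball the paraboloid term alone is at least \<open>w y\<close>, the
    value at z = y, so a minimum over the ball is global because \<open>w\<close> is
    nonnegative.\<close>
  define R where "R = sqrt (2 * w y / a)"
  have R: "0 \<le> R" "a / 2 * R\<^sup>2 = w y" using a nonneg[of y] by (auto simp: R_def)
  have "continuous_on (cball y R) (\<lambda>z. w z + a / 2 * (norm (z - y))\<^sup>2)"
    by (intro continuous_intros continuous_w)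
  moreover have "compact (cball y R)" "cball y R \<noteq> {}" using R by auto
  ultimately obtain x where x: "\<And>z. z \<in> cball y R \<Longrightarrow> w x + a / 2 * (norm (x - y))\<^sup>2 \<le> w z + a / 2 * (norm (z - y))\<^sup>2"
    using continuous_attains_inf[of "cball y R" "\<lambda>z. w z + a / 2 * (norm (z - y))\<^sup>2"] by blast
  show ?thesis
  proof
    fix z
    show "w x + a / 2 * (norm (x - y))\<^sup>2 \<le> w z + a / 2 * (norm (z - y))\<^sup>2"
    proof (cases "z \<in> cball y R")
      case False
      then have "R \<le> norm (z - y)" by (simp add: dist_norm norm_minus_commute)
      then have "R\<^sup>2 \<le> (norm (z - y))\<^sup>2" using R by (simp add: power_mono)
      then have "w y \<le> a / 2 * (norm (z - y))\<^sup>2"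
        using R(2) mult_left_mono[of "R\<^sup>2" "(norm (z - y))\<^sup>2" "a / 2"] a by simp
      moreover have "w x + a / 2 * (norm (x - y))\<^sup>2 \<le> w y" using x[of y] R by simp
      ultimately show ?thesis using nonneg[of z] by simp
    qed (rule x)
  qed
qed

text \<open>The contact set is the projection of a closed set of pairs (point, vertex). Comparison
  with z = 0 and \<open>nonneg\<close> bound the distance from a contact point to its
  vertex.\<close>

lemma compact_contact:
  assumes a: "0 < a" and Y: "compact Y"
  shows "compact (contact w a Y)"
proof -
  obtain M where M: "\<And>y. y \<in> Y \<Longrightarrow> norm y \<le> M"
    using compact_imp_bounded[OF Y] by (auto simp: bounded_iff)
  define R where "R = M + sqrt (2 / a * (w 0 + a / 2 * M\<^sup>2))"
  let ?K = "(cball 0 R \<times> Y) \<inter> {p. \<forall>z. w (fst p) + a / 2 * (norm (fst p - snd p))\<^sup>2 \<le> w z + a / 2 * (norm (z - snd p))\<^sup>2}"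
  have "closed {p. \<forall>z. w (fst p) + a / 2 * (norm (fst p - snd p))\<^sup>2 \<le> w z + a / 2 * (norm (z - snd p))\<^sup>2}"
  proof (intro closed_Collect_all closed_Collect_le continuous_intros)
    show "continuous_on UNIV (\<lambda>p::(real^'n) \<times> (real^'n). w (fst p))"
      by (rule continuous_on_compose2[OF continuous_w[of UNIV]]) (auto intro: continuous_intros)
  qed
  then have "compact ?K" using Y by (intro compact_Int_closed compact_Times) auto
  then have "compact (fst ` ?K)" by (intro compact_continuous_image continuous_intros)
  moreover have "fst ` ?K = contact w a Y"
  proof
    show "fst ` ?K \<subseteq> contact w a Y" by (force simp: contact_def)
    show "contact w a Y \<subseteq> fst ` ?K"
    proof
      fix x assume "x \<in> contact w a Y"
      then obtain y where y: "y \<in> Y" "\<And>z. w x + a / 2 * (norm (x - y))\<^sup>2 \<le> w z + a / 2 * (norm (z - y))\<^sup>2"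
        by (auto simp: contact_def)
      have "a / 2 * (norm (x - y))\<^sup>2 \<le> w 0 + a / 2 * (norm y)\<^sup>2"
        using y(2)[of 0] nonneg[of x] by simp
      also have "\<dots> \<le> w 0 + a / 2 * M\<^sup>2"
        using a M[OF y(1)] by (simp add: power_mono)
      finally have "(norm (x - y))\<^sup>2 \<le> 2 / a * (w 0 + a / 2 * M\<^sup>2)"
        using a by (simp add: field_simps)
      then have "norm (x - y) \<le> sqrt (2 / a * (w 0 + a / 2 * M\<^sup>2))"
        by (simp add: real_le_rsqrt)
      then have "norm x \<le> R"
        using norm_triangle_ineq[of "x - y" y] M[OF y(1)] by (simp add: R_def)
      then show "x \<in> fst ` ?K"
        using y by (intro image_eqI[of _ _ "(x, y)"]) auto
    qed
  qed
  ultimately show ?thesis by simp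
qed

text \<open>The vertex is recovered from the contact point as \<open>x + D x / a\<close>. At a contact point the
  Jacobian of this map is nonnegative, and the differential inequality bounds its trace.\<close>

lemma measure_vertices_le_contact:
  assumes a: "0 < a" and Y: "compact Y"
  shows "measure lebesgue Y \<le> jacobian_bound CARD('n) \<kappa> * measure lebesgue (contact w a Y)"
proof -
  let ?T = "contact w a Y"
  let ?\<Phi> = "\<lambda>x. x + (1 / a) *\<^sub>R D x"
  have der: "(?\<Phi> has_derivative (\<lambda>h. h + (1 / a) *\<^sub>R (E x *v h))) (at x)" for x
    by (intro derivative_intros has_hessian)
  have bound: "\<bar>(axis j 1 + (1 / a) *\<^sub>R (E x *v axis j 1)) $ i\<bar> \<le> real CARD('n) / \<kappa>" if x: "x \<in> ?T" for x i j
  proof -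
    obtain y where y: "\<And>z. w x + a / 2 * (norm (x - y))\<^sup>2 \<le> w z + a / 2 * (norm (z - y))\<^sup>2"
      using x by (auto simp: contact_def)
    obtain v \<nu> where v: "orthonormal v" and \<nu>: "\<And>i. \<kappa> \<le> \<nu> i" "\<And>i. \<nu> i \<le> 1"
      and le: "(\<Sum>i\<in>UNIV. \<nu> i * (v i \<bullet> (E x *v v i))) \<le> 0"
      using elliptic[of x] by blast
    define F where "F = mat 1 + (1 / a) *\<^sub>R E x"
    have F: "F *v h = h + (1 / a) *\<^sub>R (E x *v h)" for h
      by (simp add: F_def matrix_vector_mult_add_rdistrib scaleR_matrix_vector_assoc)
    have sym: "transpose F = F"
      using hessian_symmetric[of x] by (simp add: F_def transpose_def mat_def vec_eq_iff)
    have psd: "0 \<le> h \<bullet> (F *v h)" for h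
    proof -
      have "0 \<le> (h \<bullet> (E x *v h) + a * (norm h)\<^sup>2) / a"
        using contact_critical(2)[OF y, of h] a by simp
      also have "\<dots> = h \<bullet> (F *v h)"
        using a by (simp add: F inner_add_right power2_norm_eq_inner field_simps)
      finally show ?thesis .
    qed
    have "(\<Sum>i\<in>UNIV. \<nu> i * (v i \<bullet> (F *v v i))) = (\<Sum>i\<in>UNIV. \<nu> i) + (\<Sum>i\<in>UNIV. \<nu> i * (v i \<bullet> (E x *v v i))) / a"
      by (simp add: F inner_add_right orthonormalD[OF v] distrib_left sum.distrib sum_divide_distrib)
    also have "\<dots> \<le> (\<Sum>i\<in>(UNIV::'n set). 1) + 0"
      using le a \<nu>(2) by (intro add_mono sum_mono) (auto simp: divide_nonpos_pos)
    finally have "(\<Sum>i\<in>UNIV. \<nu> i * (v i \<bullet> (F *v v i))) \<le> real CARD('n)" by simp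
    from psd_entry_bound[OF sym psd v kappa(1) \<nu>(1) this, of i j]
    have "\<bar>F $ i $ j\<bar> \<le> real CARD('n) / \<kappa>" .
    moreover have "(F *v axis j 1) $ i = F $ i $ j"
      by (simp add: matrix_vector_mul_component inner_axis)
    ultimately show ?thesis by (simp add: F)
  qed
  have "measure lebesgue (?\<Phi> ` ?T) \<le> jacobian_bound CARD('n) \<kappa> * measure lebesgue ?T"
    unfolding jacobian_bound_def
    by (rule measure_image_bounded_jacobian[OF compact_contact[OF a Y] der bound])
  moreover have "Y \<subseteq> ?\<Phi> ` ?T"
  proof
    fix y assume y: "y \<in> Y"
    obtain x where x: "\<And>z. w x + a / 2 * (norm (x - y))\<^sup>2 \<le> w z + a / 2 * (norm (z - y))\<^sup>2"
      using contact_exists[OF a] by blast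
    have "D x + a *\<^sub>R (x - y) = 0" by (rule contact_critical(1)[OF x])
    then have "D x = a *\<^sub>R (y - x)" by (simp add: algebra_simps eq_neg_iff_add_eq_0 add_eq_0_iff)
    then have "?\<Phi> x = y" using a by simp
    moreover have "x \<in> ?T" using x y by (auto simp: contact_def)
    ultimately show "y \<in> ?\<Phi> ` ?T" by force
  qed
  moreover have "compact (?\<Phi> ` ?T)"
    by (intro compact_continuous_image compact_contact[OF a Y] continuous_at_imp_continuous_on ballI
        has_derivative_continuous[OF der])
  ultimately show ?thesis
    using measure_mono_fmeasurable[of Y "?\<Phi> ` ?T" lebesgue] Y
    by (meson fmeasurableD lmeasurable_compact order_trans)
qed


text \<open>Hopf barrier \<open>exp (- \<alpha> |z - x1|\<^sup>2 / r\<^sup>2)\<close> on the annulus \<open>r/4 < |z - x1| < 6r\<close>.\<close>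

lemma barrier:
  assumes a: "0 < a" and r: "0 < r" and x0: "norm (x0 - x1) \<le> 5 * r"
    and touch: "\<And>z. w x0 + a / 2 * (norm (x0 - p))\<^sup>2 \<le> w z + a / 2 * (norm (z - p))\<^sup>2"
  obtains z where "norm (z - x1) \<le> r / 4"
    "w z + a / 2 * (norm (z - p))\<^sup>2 \<le> w x0 + a / 2 * (norm (x0 - p))\<^sup>2 + barrier_height CARD('n) \<kappa> * a * r\<^sup>2"
proof (cases "norm (x0 - x1) \<le> r / 4")
  case True
  have "0 \<le> barrier_height CARD('n) \<kappa> * a * r\<^sup>2" using height_ge_1 a by simp
  then show ?thesis using that[of x0] True by simp
next
  case far: False
  define \<alpha> where "\<alpha> = barrier_exponent CARD('n) \<kappa>"
  define B where "B = barrier_height CARD('n) \<kappa>"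
  \<comment> \<open>Zero on the sphere of radius 6 r, positive inside it, at most
    \<open>B * a * r\<^sup>2\<close> everywhere.\<close>
  define \<psi> where "\<psi> z = B * a * r\<^sup>2 * (exp (- \<alpha> * (norm (z - x1))\<^sup>2 / r\<^sup>2) - exp (- 36 * \<alpha>))" for z
  define q where "q z = w z + a / 2 * (norm (z - p))\<^sup>2 - (w x0 + a / 2 * (norm (x0 - p))\<^sup>2)" for z
  have \<alpha>1: "1 \<le> \<alpha>" using exponent_ge_1 by (simp add: \<alpha>_def)
  have B1: "1 \<le> B" using height_ge_1 by (simp add: B_def)
  have q0: "0 \<le> q z" for z using touch[of z] by (simp add: q_def)
  have cont: "continuous_on S (\<lambda>z. q z - \<psi> z)" for S
    unfolding q_def \<psi>_def by (intro continuous_intros continuous_w) (use r in auto)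
  let ?A = "cball x1 (6 * r) - ball x1 (r / 4)"
  have "compact ?A" by (simp add: compact_diff)
  moreover have x0A: "x0 \<in> ?A" using far x0 r by (simp add: dist_norm norm_minus_commute)
  ultimately obtain y where yA: "y \<in> ?A" and ymin: "\<And>z. z \<in> ?A \<Longrightarrow> q y - \<psi> y \<le> q z - \<psi> z"
    using continuous_attains_inf[OF _ _ cont, of ?A] by blast
  have "(norm (x0 - x1))\<^sup>2 \<le> (5 * r)\<^sup>2" by (rule power_mono[OF x0]) simp
  moreover have "0 < r\<^sup>2" using r by simp
  ultimately have "(norm (x0 - x1))\<^sup>2 < 36 * r\<^sup>2"
    by (simp only: power_mult_distrib power2_eq_square[of 5])
  then have "(norm (x0 - x1))\<^sup>2 / r\<^sup>2 < 36" using r by (simp add: field_simps)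
  then have "\<alpha> * ((norm (x0 - x1))\<^sup>2 / r\<^sup>2) < \<alpha> * 36" using \<alpha>1 by (intro mult_strict_left_mono) auto
  then have "exp (- 36 * \<alpha>) < exp (- \<alpha> * (norm (x0 - x1))\<^sup>2 / r\<^sup>2)" by simp
  then have "0 < \<psi> x0" using B1 a r by (simp add: \<psi>_def)
  moreover have "q x0 = 0" by (simp add: q_def)
  ultimately have neg: "q y < \<psi> y" using ymin[OF x0A] by simp
  \<comment> \<open>The minimum point y of \<open>q - \<psi>\<close> must lie on the inner sphere:
    on the outer one \<open>\<psi>\<close> vanishes while \<open>q\<close> is nonnegative, against
    \<open>neg\<close>, and at an interior point the weighted second derivatives would sum to
    something negative.\<close>
  show ?thesis
  proof (cases "norm (y - x1) \<le> r / 4")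
    case True
    have "\<psi> y \<le> B * a * r\<^sup>2 * 1"
      unfolding \<psi>_def
    proof (rule mult_left_mono)
      have "exp (- \<alpha> * (norm (y - x1))\<^sup>2 / r\<^sup>2) \<le> 1" using \<alpha>1 by simp
      then show "exp (- \<alpha> * (norm (y - x1))\<^sup>2 / r\<^sup>2) - exp (- 36 * \<alpha>) \<le> 1"
        using exp_gt_zero[of "- 36 * \<alpha>"] by linarith
    qed (use B1 a in simp)
    then show ?thesis using that[OF True] neg by (simp add: q_def B_def)
  next
    case False
    have "norm (y - x1) \<noteq> 6 * r"
    proof
      assume "norm (y - x1) = 6 * r"
      then have "\<psi> y = 0" using r by (simp add: \<psi>_def power_mult_distrib)
      then show False using neg q0[of y] by simp
    qed
    moreover have "norm (y - x1) \<le> 6 * r" using yA by (simp add: dist_norm norm_minus_commute)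
    ultimately have "y \<in> ball x1 (6 * r) - cball x1 (r / 4)"
      using False by (simp add: dist_norm norm_minus_commute)
    moreover have "open (ball x1 (6 * r) - cball x1 (r / 4))" by (simp add: open_Diff)
    ultimately obtain e where e: "0 < e" "ball y e \<subseteq> ball x1 (6 * r) - cball x1 (r / 4)"
      using open_contains_ball by blast
    then have eA: "ball y e \<subseteq> ?A" by auto
    obtain v \<nu> where v: "orthonormal v" and \<nu>: "\<And>i. \<kappa> \<le> \<nu> i" "\<And>i. \<nu> i \<le> 1"
      and le: "(\<Sum>i\<in>UNIV. \<nu> i * (v i \<bullet> (E y *v v i))) \<le> 0"
      using elliptic[of y] by blast
    have nv: "norm (v i) = 1" for i by (rule norm_orthonormal[OF v])
    define s where "s = (norm (y - x1))\<^sup>2 / r\<^sup>2"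
    have s: "1 / 16 \<le> s" "s \<le> 36"
    proof -
      have "(r / 4)\<^sup>2 \<le> (norm (y - x1))\<^sup>2" using False r by (intro power_mono) auto
      then show "1 / 16 \<le> s" using r by (simp add: s_def power_divide field_simps)
      have "(norm (y - x1))\<^sup>2 \<le> (6 * r)\<^sup>2" using \<open>norm (y - x1) \<le> 6 * r\<close> by (intro power_mono) auto
      then show "s \<le> 36" using r by (simp add: s_def power_mult_distrib field_simps)
    qed
    define b where "b i = v i \<bullet> (y - x1)" for i
    have second: "0 \<le> v i \<bullet> (E y *v v i) + a - B * a * exp (- \<alpha> * s) * (4 * \<alpha>\<^sup>2 * (b i)\<^sup>2 / r\<^sup>2 - 2 * \<alpha>)" for i
    proof (rule min_second_derivative_nonneg(2))
      let ?g = "\<lambda>t. - \<alpha> * ((norm (y - x1))\<^sup>2 + 2 * t * b i + t\<^sup>2) / r\<^sup>2"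
      let ?f = "\<lambda>t. w (y + t *\<^sub>R v i) + (a / 2 * ((norm (y - p))\<^sup>2 + 2 * t * (v i \<bullet> (y - p)) + t\<^sup>2)
        - B * a * r\<^sup>2 * exp (?g t))"
      let ?f' = "\<lambda>t. D (y + t *\<^sub>R v i) \<bullet> v i + (a * (v i \<bullet> (y - p)) + a * t + 2 * B * a * \<alpha> * (b i + t) * exp (?g t))"
      show "(?f has_real_derivative ?f' t) (at t)" for t
        by (rule DERIV_add[OF line_derivative])
          (use r in \<open>auto intro!: derivative_eq_intros simp: field_simps power2_eq_square\<close>)
      have "?g 0 = - \<alpha> * s" by (simp add: s_def)
      have "((\<lambda>t. a * (v i \<bullet> (y - p)) + a * t + 2 * B * a * \<alpha> * (b i + t) * exp (?g t)) has_real_derivative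
          a - B * a * exp (?g 0) * (4 * \<alpha>\<^sup>2 * (b i)\<^sup>2 / r\<^sup>2 - 2 * \<alpha>)) (at 0)"
        by (use r in \<open>auto intro!: derivative_eq_intros simp: field_simps power2_eq_square\<close>)
      from DERIV_add[OF line_second_derivative this]
      show "(?f' has_real_derivative v i \<bullet> (E y *v v i) + a - B * a * exp (- \<alpha> * s) * (4 * \<alpha>\<^sup>2 * (b i)\<^sup>2 / r\<^sup>2 - 2 * \<alpha>)) (at 0)"
        unfolding \<open>?g 0 = - \<alpha> * s\<close> by (simp add: algebra_simps)
      show "0 < e" by (rule e(1))
      fix t :: real assume "\<bar>t\<bar> < e"
      then have "y + t *\<^sub>R v i \<in> ball y e" by (simp add: dist_norm nv)
      from ymin[OF subsetD[OF eA this]] show "?f 0 \<le> ?f t"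
        by (simp add: q_def \<psi>_def norm_line nv b_def algebra_simps)
    qed
    have "0 \<le> (\<Sum>i\<in>UNIV. \<nu> i * (v i \<bullet> (E y *v v i) + a - B * a * exp (- \<alpha> * s) * (4 * \<alpha>\<^sup>2 * (b i)\<^sup>2 / r\<^sup>2 - 2 * \<alpha>)))"
      using \<nu>(1) kappa(1) second by (intro sum_nonneg mult_nonneg_nonneg) (auto intro: order_trans[OF less_imp_le])
    also have "\<dots> = (\<Sum>i\<in>UNIV. \<nu> i * (v i \<bullet> (E y *v v i))) + a * (\<Sum>i\<in>UNIV. \<nu> i)
        - B * a * exp (- \<alpha> * s) * (4 * \<alpha>\<^sup>2 / r\<^sup>2 * (\<Sum>i\<in>UNIV. \<nu> i * (b i)\<^sup>2) - 2 * \<alpha> * (\<Sum>i\<in>UNIV. \<nu> i))"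
    proof -
      have "\<nu> i * (v i \<bullet> (E y *v v i) + a - B * a * exp (- \<alpha> * s) * (4 * \<alpha>\<^sup>2 * (b i)\<^sup>2 / r\<^sup>2 - 2 * \<alpha>))
          = \<nu> i * (v i \<bullet> (E y *v v i)) + a * \<nu> i
            - B * a * exp (- \<alpha> * s) * (4 * \<alpha>\<^sup>2 / r\<^sup>2 * (\<nu> i * (b i)\<^sup>2) - 2 * \<alpha> * \<nu> i)" for i
        by (simp add: algebra_simps)
      then show ?thesis
        by (simp only: sum.distrib sum_subtractf sum_distrib_left[symmetric])
    qed
    also have "\<dots> \<le> 0 + a * real CARD('n) - B * a * exp (- \<alpha> * s) * \<alpha>"
    proof (intro diff_mono add_mono mult_left_mono le)
      have n: "(\<Sum>i\<in>UNIV. \<nu> i) \<le> real CARD('n)"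
        using sum_mono[of UNIV \<nu> "\<lambda>_. 1"] \<nu>(2) by simp
      then show "(\<Sum>i\<in>UNIV. \<nu> i) \<le> real CARD('n)" .
      have "\<kappa> * (norm (y - x1))\<^sup>2 = (\<Sum>i\<in>UNIV. \<kappa> * (b i)\<^sup>2)"
        by (simp add: orthonormal_norm[OF v, of "y - x1"] b_def sum_distrib_left)
      also have "\<dots> \<le> (\<Sum>i\<in>UNIV. \<nu> i * (b i)\<^sup>2)"
        by (intro sum_mono mult_right_mono \<nu>(1)) auto
      finally have "4 * \<alpha>\<^sup>2 / r\<^sup>2 * (\<kappa> * (norm (y - x1))\<^sup>2) \<le> 4 * \<alpha>\<^sup>2 / r\<^sup>2 * (\<Sum>i\<in>UNIV. \<nu> i * (b i)\<^sup>2)"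
        by (intro mult_left_mono) auto
      moreover have "4 * \<alpha>\<^sup>2 / r\<^sup>2 * (\<kappa> * (norm (y - x1))\<^sup>2) = 4 * \<alpha>\<^sup>2 * \<kappa> * s" by (simp add: s_def)
      moreover have "\<alpha> * \<alpha> * \<kappa> = \<alpha> * (8 * real CARD('n) + 4)"
        using kappa by (simp add: \<alpha>_def barrier_exponent_def)
      then have "4 * \<alpha>\<^sup>2 * \<kappa> * s = 4 * (\<alpha> * (8 * real CARD('n) + 4)) * s"
        by (simp add: power2_eq_square)
      moreover have "4 * (\<alpha> * (8 * real CARD('n) + 4)) * s \<ge> 4 * (\<alpha> * (8 * real CARD('n) + 4)) * (1 / 16)"
        using s(1) \<alpha>1 by (intro mult_left_mono) auto
      moreover have "2 * \<alpha> * (\<Sum>i\<in>UNIV. \<nu> i) \<le> 2 * \<alpha> * real CARD('n)"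
        using n \<alpha>1 by (intro mult_left_mono) auto
      ultimately have "4 * \<alpha>\<^sup>2 / r\<^sup>2 * (\<Sum>i\<in>UNIV. \<nu> i * (b i)\<^sup>2) - 2 * \<alpha> * (\<Sum>i\<in>UNIV. \<nu> i)
          \<ge> 4 * (\<alpha> * (8 * real CARD('n) + 4)) * (1 / 16) - 2 * \<alpha> * real CARD('n)" by linarith
      then show "\<alpha> \<le> 4 * \<alpha>\<^sup>2 / r\<^sup>2 * (\<Sum>i\<in>UNIV. \<nu> i * (b i)\<^sup>2) - 2 * \<alpha> * (\<Sum>i\<in>UNIV. \<nu> i)"
        by (simp add: algebra_simps)
    qed (use a B1 in auto)
    also have "\<dots> < 0"
    proof -
      have "real CARD('n) * 1 \<le> real CARD('n) * exp (36 * \<alpha> - \<alpha> * s)"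
        using s(2) \<alpha>1 by (intro mult_left_mono) (auto simp: mult.commute)
      also have "\<dots> = B * exp (- \<alpha> * s)"
        by (simp add: B_def barrier_height_def \<alpha>_def exp_add[symmetric] algebra_simps)
      finally have 1: "real CARD('n) \<le> B * exp (- \<alpha> * s)" by simp
      have "\<alpha> > 1"
      proof -
        have "\<kappa> < 8 * real CARD('n) + 4" using kappa card_ge_1 by linarith
        then show ?thesis using kappa by (simp add: \<alpha>_def barrier_exponent_def)
      qed
      then have "B * exp (- \<alpha> * s) * 1 < B * exp (- \<alpha> * s) * \<alpha>" using B1 by (intro mult_strict_left_mono) auto
      with 1 have "real CARD('n) < B * exp (- \<alpha> * s) * \<alpha>" by simp
      then have "a * real CARD('n) < a * (B * exp (- \<alpha> * s) * \<alpha>)" using a by simp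
      then show ?thesis by (simp add: algebra_simps)
    qed
    finally show ?thesis by simp
  qed
qed

section \<open>Growth of the contact set with the opening\<close>

lemma content_cball_eq:
  "0 \<le> r \<Longrightarrow> measure lebesgue (cball (c :: real ^ 'n) r) = r ^ CARD('n) * measure lebesgue (ball (0 :: real ^ 'n) 1)"
  using content_ball_conv_unit_ball[of r c] by (simp add: content_cball_conv_ball)

text \<open>\<open>barrier\<close> provides a point \<open>z1\<close> near \<open>x1\<close> where
  the paraboloid touching at \<open>x0\<close> is almost tight. Adding a second paraboloid of
  opening b with vertex y near \<open>x1\<close> forces the minimum into \<open>ball x1 r\<close>.
  The sum is again a paraboloid, of opening a + b, and its vertices fill a ball of radius r / 8, so
  \<open>measure_vertices_le_contact\<close> gives the volume.\<close>

lemma contact_growth: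
  assumes a: "0 < a" and r: "0 < r" and x0: "norm (x0 - x1) \<le> 5 * r"
    and sub: "cball x1 r \<subseteq> cball 0 \<rho>" and contact: "x0 \<in> contact w a (cball 0 \<rho>)"
  shows "(r / 8) ^ CARD('n) * measure lebesgue (ball (0 :: real ^ 'n) 1)
    \<le> jacobian_bound CARD('n) \<kappa> * measure lebesgue (contact w (opening_ratio CARD('n) \<kappa> * a) (cball 0 \<rho>) \<inter> ball x1 r)"
proof -
  define B where "B = barrier_height CARD('n) \<kappa>"
  define b where "b = 7 * B * a"
  have B1: "1 \<le> B" using height_ge_1 by (simp add: B_def)
  have b: "0 < b" "a \<le> b" using B1 a by (auto simp: b_def)
  have ab: "opening_ratio CARD('n) \<kappa> * a = a + b"
    by (simp add: opening_ratio_def b_def B_def algebra_simps)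
  obtain p where p: "p \<in> cball 0 \<rho>"
    and touch: "\<And>z. w x0 + a / 2 * (norm (x0 - p))\<^sup>2 \<le> w z + a / 2 * (norm (z - p))\<^sup>2"
    using contact by (auto simp: contact_def)
  obtain z1 where z1: "norm (z1 - x1) \<le> r / 4"
    "w z1 + a / 2 * (norm (z1 - p))\<^sup>2 \<le> w x0 + a / 2 * (norm (x0 - p))\<^sup>2 + B * a * r\<^sup>2"
    using barrier[OF a r x0 touch] unfolding B_def by blast
  \<comment> \<open>The vertex of the combined paraboloid for y = \<open>x1\<close>. Letting y range
    over distance r / 4 moves the combined vertex by at least r / 8, since
    \<open>a \<le> b\<close>.\<close>
  define c where "c = (a / (a + b)) *\<^sub>R p + (b / (a + b)) *\<^sub>R x1"
  define Y where "Y = cball c (r / 8)"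
  have vertex: "x \<in> ball x1 r" "y' \<in> cball 0 \<rho>"
    if y': "y' \<in> Y" and min: "\<And>z. w x + (a + b) / 2 * (norm (x - y'))\<^sup>2 \<le> w z + (a + b) / 2 * (norm (z - y'))\<^sup>2" for x y'
  proof -
    define y where "y = x1 + ((a + b) / b) *\<^sub>R (y' - c)"
    have "norm (y - x1) = (a + b) / b * norm (y' - c)"
      using a b by (simp add: y_def)
    also have "\<dots> \<le> 2 * (r / 8)"
      using y' a b by (intro mult_mono) (auto simp: Y_def dist_norm norm_minus_commute field_simps)
    finally have y1: "norm (y - x1) \<le> r / 4" by simp
    have y'eq: "y' = (a / (a + b)) *\<^sub>R p + (b / (a + b)) *\<^sub>R y"
    proof -
      have "(b / (a + b)) *\<^sub>R (y - x1) = y' - c" using a b by (simp add: y_def)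
      then show ?thesis by (simp add: c_def scaleR_diff_right algebra_simps)
    qed
    have "y \<in> cball 0 \<rho>" using sub y1 r by (auto simp: dist_norm norm_minus_commute subset_iff)
    then show "y' \<in> cball 0 \<rho>"
      unfolding y'eq using p a b convexD[OF convex_cball, of p 0 \<rho> y "a / (a + b)" "b / (a + b)"]
      by (simp add: add_divide_distrib[symmetric])
    \<comment> \<open>Completing the square: the last term does not depend on z, so minimising
      either side over z is the same.\<close>
    have split: "(a + b) / 2 * (norm (z - y'))\<^sup>2 = a / 2 * (norm (z - p))\<^sup>2 + b / 2 * (norm (z - y))\<^sup>2
        - a * b / (2 * (a + b)) * (norm (p - y))\<^sup>2" for z
    proof -
      have "(a + b) *\<^sub>R (z - y') = a *\<^sub>R (z - p) + b *\<^sub>R (z - y)"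
      proof -
        have "a + b \<noteq> 0" using a b by simp
        then have "(a + b) *\<^sub>R y' = a *\<^sub>R p + b *\<^sub>R y" by (simp add: y'eq scaleR_add_right)
        then show ?thesis by (simp add: scaleR_diff_right scaleR_add_left)
      qed
      then have "(norm ((a + b) *\<^sub>R (z - y')))\<^sup>2 = (norm (a *\<^sub>R (z - p) + b *\<^sub>R (z - y)))\<^sup>2" by simp
      moreover have "(norm (a *\<^sub>R U + b *\<^sub>R V))\<^sup>2 = a\<^sup>2 * (norm U)\<^sup>2 + 2 * a * b * (U \<bullet> V) + b\<^sup>2 * (norm V)\<^sup>2"
        for U V :: "real ^ 'n"
        by (simp only: power2_norm_eq_inner inner_add_left inner_add_right inner_scaleR_left inner_scaleR_right
            inner_commute[of V U]) (simp add: power2_eq_square algebra_simps)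
      moreover have "(norm ((a + b) *\<^sub>R (z - y')))\<^sup>2 = (a + b)\<^sup>2 * (norm (z - y'))\<^sup>2"
        by (simp add: power_mult_distrib)
      ultimately have "(a + b)\<^sup>2 * (norm (z - y'))\<^sup>2 = a\<^sup>2 * (norm (z - p))\<^sup>2 + 2 * a * b * ((z - p) \<bullet> (z - y)) + b\<^sup>2 * (norm (z - y))\<^sup>2"
        by simp
      moreover have "(norm (p - y))\<^sup>2 = (norm (z - p))\<^sup>2 + (norm (z - y))\<^sup>2 - 2 * ((z - p) \<bullet> (z - y))"
        using dot_norm_neg[of "z - p" "z - y"] by (simp add: norm_minus_commute[of y p])
      moreover have "(a + b) / 2 * N = a / 2 * P + b / 2 * Q - a * b / (2 * (a + b)) * M"
        if "(a + b)\<^sup>2 * N = a\<^sup>2 * P + 2 * a * b * I + b\<^sup>2 * Q" "M = P + Q - 2 * I" for N P Q I M :: real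
      proof -
        have "(a + b) * ((a + b) * N) = (a + b) * (a * P + b * Q) - a * b * M" using that by algebra
        then have "(a + b) * N = a * P + b * Q - a * b * M / (a + b)" using a b by (simp add: field_simps)
        then show ?thesis using a b by (simp add: field_simps)
      qed
      ultimately show ?thesis by blast
    qed
    have "w x + a / 2 * (norm (x - p))\<^sup>2 + b / 2 * (norm (x - y))\<^sup>2
        \<le> w z1 + a / 2 * (norm (z1 - p))\<^sup>2 + b / 2 * (norm (z1 - y))\<^sup>2"
      using min[of z1] unfolding split by linarith
    with z1(2) touch[of x] have 1: "b / 2 * (norm (x - y))\<^sup>2 \<le> B * a * r\<^sup>2 + b / 2 * (norm (z1 - y))\<^sup>2" by linarith
    have "norm (z1 - y) \<le> r / 2"
      using z1(1) y1 norm_triangle_ineq4[of "z1 - x1" "y - x1"] by simp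
    then have "(norm (z1 - y))\<^sup>2 \<le> (r / 2)\<^sup>2" by (simp add: power_mono)
    then have "b / 2 * (norm (z1 - y))\<^sup>2 \<le> b / 2 * (r / 2)\<^sup>2" using b by (intro mult_left_mono) auto
    with 1 have "b / 2 * (norm (x - y))\<^sup>2 \<le> b / 7 * r\<^sup>2 + b / 2 * (r / 2)\<^sup>2" by (simp add: b_def)
    \<comment> \<open>This is 1/7 + 1/8 < 9/32, the origin of the factor 7 in
      \<open>opening_ratio\<close>.\<close>
    also have "\<dots> < b / 2 * (3 * r / 4)\<^sup>2" using b r by (simp add: power2_eq_square field_simps)
    finally have "(norm (x - y))\<^sup>2 < (3 * r / 4)\<^sup>2" using b by simp
    then have "norm (x - y) < 3 * r / 4" by (rule power2_less_imp_less) (use r in simp)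
    then have "norm (x - x1) < r" using y1 norm_triangle_ineq[of "x - y" "y - x1"] by simp
    then show "x \<in> ball x1 r" by (simp add: dist_norm norm_minus_commute)
  qed
  have T: "contact w (a + b) Y \<subseteq> contact w (a + b) (cball 0 \<rho>) \<inter> ball x1 r"
  proof
    fix x assume "x \<in> contact w (a + b) Y"
    then obtain y where y: "y \<in> Y" "\<And>z. w x + (a + b) / 2 * (norm (x - y))\<^sup>2 \<le> w z + (a + b) / 2 * (norm (z - y))\<^sup>2"
      by (auto simp: contact_def)
    from vertex[OF y] y(2) show "x \<in> contact w (a + b) (cball 0 \<rho>) \<inter> ball x1 r"
      unfolding contact_def by blast
  qed
  have "(r / 8) ^ CARD('n) * measure lebesgue (ball (0 :: real ^ 'n) 1) = measure lebesgue Y"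
    unfolding Y_def by (rule content_cball_eq[symmetric]) (use r in simp)
  also have "\<dots> \<le> jacobian_bound CARD('n) \<kappa> * measure lebesgue (contact w (a + b) Y)"
    by (rule measure_vertices_le_contact) (use a b in \<open>auto simp: Y_def\<close>)
  also have "\<dots> \<le> jacobian_bound CARD('n) \<kappa> * measure lebesgue (contact w (a + b) (cball 0 \<rho>) \<inter> ball x1 r)"
  proof (rule mult_left_mono[OF measure_mono_fmeasurable[OF T]])
    have Yc: "compact Y" by (simp add: Y_def)
    show "contact w (a + b) Y \<in> sets lebesgue"
      using compact_contact[OF _ Yc, of "a + b"] a b lmeasurable_compact by (meson add_pos_pos fmeasurableD)
    have "contact w (a + b) (cball 0 \<rho>) \<in> lmeasurable"
      using compact_contact[of "a + b" "cball 0 \<rho>"] a b by (simp add: lmeasurable_compact)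
    then show "contact w (a + b) (cball 0 \<rho>) \<inter> ball x1 r \<in> lmeasurable"
      by (simp add: fmeasurable.Int)
  qed (use jacobian_bound_ge_1 in simp)
  finally show ?thesis unfolding ab .
qed


text \<open>A steeper concave paraboloid tangent at x to the given one lies below it. Its vertex is
  the point \<open>y'\<close> of the segment from x to y, and convexity keeps \<open>y'\<close> in
  the ball because x lies there.\<close>

lemma contact_mono:
  assumes a: "0 < a" and ab: "a \<le> b" and x: "x \<in> contact w a (cball 0 \<rho>)" "x \<in> cball 0 \<rho>"
  shows "x \<in> contact w b (cball 0 \<rho>)"
proof -
  obtain y where y: "y \<in> cball 0 \<rho>"
    and touch: "\<And>z. w x + a / 2 * (norm (x - y))\<^sup>2 \<le> w z + a / 2 * (norm (z - y))\<^sup>2"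
    using x by (auto simp: contact_def)
  define y' where "y' = (1 - a / b) *\<^sub>R x + (a / b) *\<^sub>R y"
  have "y' \<in> cball 0 \<rho>"
    unfolding y'_def using a ab by (intro convexD[OF convex_cball x(2) y]) auto
  moreover have "w x + b / 2 * (norm (x - y'))\<^sup>2 \<le> w z + b / 2 * (norm (z - y'))\<^sup>2" for z
  proof -
    have e: "(norm (z - q))\<^sup>2 = (norm (x - q))\<^sup>2 + 2 * ((z - x) \<bullet> (x - q)) + (norm (z - x))\<^sup>2" for q
      using norm_line[of x 1 "z - x" q] by simp
    have xy': "x - y' = (a / b) *\<^sub>R (x - y)" by (simp add: y'_def algebra_simps)
    have "b * ((z - x) \<bullet> (x - y')) = a * ((z - x) \<bullet> (x - y))"
      using a ab by (simp add: xy')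
    moreover have "a * (norm (z - x))\<^sup>2 \<le> b * (norm (z - x))\<^sup>2" using ab by (simp add: mult_right_mono)
    moreover have "w x \<le> w z + a * ((z - x) \<bullet> (x - y)) + a / 2 * (norm (z - x))\<^sup>2"
      using touch[of z] unfolding e[of y] by (simp add: algebra_simps)
    ultimately show ?thesis unfolding e[of y'] by (simp add: algebra_simps)
  qed
  ultimately show ?thesis unfolding contact_def by blast
qed

lemma lmeasurable_contact: "0 < a \<Longrightarrow> contact w a (cball 0 \<rho>) \<in> lmeasurable"
  by (simp add: lmeasurable_compact compact_contact)

text \<open>Vitali covering of the non-contact set by balls whose radius is half the distance to the contact set;
  a fixed proportion of each ball consists of contact points for the larger opening.\<close>

lemma noncontact_covering:
  assumes a: "0 < a" and \<rho>: "0 < \<rho>" and ne: "contact w a (cball 0 \<rho>) \<inter> cball 0 \<rho> \<noteq> {}"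
  defines "N \<equiv> ball 0 \<rho> - contact w a (cball 0 \<rho>)"
    and "T \<equiv> contact w (opening_ratio CARD('n) \<kappa> * a) (cball 0 \<rho>)"
  shows "measure lebesgue N \<le> covering_constant CARD('n) \<kappa> * measure lebesgue (N \<inter> T)"
proof -
  let ?\<mu> = "measure lebesgue"
  let ?S = "contact w a (cball 0 \<rho>) \<inter> cball 0 \<rho>"
  let ?\<omega> = "?\<mu> (ball (0 :: real ^ 'n) 1)"
  have \<Lambda>a: "0 < opening_ratio CARD('n) \<kappa> * a"
    using a height_ge_1 by (simp add: opening_ratio_def)
  have T: "T \<in> lmeasurable" unfolding T_def by (rule lmeasurable_contact[OF \<Lambda>a])
  have N: "N \<in> lmeasurable"
    unfolding N_def by (intro fmeasurable.Diff lmeasurable_ball lmeasurable_contact a)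
  have cS: "compact ?S" by (intro compact_Int_closed compact_contact a) auto
  define r where "r x = infdist x ?S" for x
  have r0: "0 < r x" if "x \<in> N" for x
  proof -
    have "x \<notin> ?S" using that by (auto simp: N_def)
    then show ?thesis
      unfolding r_def using ne infdist_pos_not_in_closed[OF compact_imp_closed[OF cS]] by simp
  qed
  have r2: "r x \<le> 2 * \<rho>" if "x \<in> N" for x
  proof -
    obtain s where s: "s \<in> ?S" using ne by blast
    have "r x \<le> dist x s" unfolding r_def by (rule infdist_le[OF s])
    also have "\<dots> \<le> 2 * \<rho>" using s that dist_triangle[of x s 0] by (simp add: N_def dist_commute)
    finally show ?thesis .
  qed
  \<comment> \<open>The centre is pulled towards 0 by at most r x / 4, so that the ball of radius r
    x / 4 around it stays inside \<open>cball 0 \<rho>\<close> even for x close to the boundary.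
    Since r x is at most 2 rho, the factor is nonnegative.\<close>
  define c where "c x = (1 - r x / (4 * \<rho>)) *\<^sub>R x" for x :: "real ^ 'n"
  have key: "?\<mu> (cball x (5 * (r x / 2))) \<le> covering_constant CARD('n) \<kappa> * ?\<mu> (T \<inter> ball (c x) (r x / 4))"
    and inside: "ball (c x) (r x / 4) \<subseteq> cball x (r x / 2) \<inter> N" if x: "x \<in> N" for x
  proof -
    note r = r0[OF x] r2[OF x]
    have nx: "norm x < \<rho>" using x by (auto simp: N_def dist_norm)
    have "norm (c x - x) = r x / (4 * \<rho>) * norm x"
    proof -
      have "c x - x = - (r x / (4 * \<rho>)) *\<^sub>R x" by (simp add: c_def algebra_simps)
      then show ?thesis using r \<rho> by simp
    qed
    also have "\<dots> \<le> r x / (4 * \<rho>) * \<rho>" using nx r \<rho> by (intro mult_left_mono) auto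
    finally have cx: "norm (c x - x) \<le> r x / 4" using \<rho> by simp
    have "norm (c x) = (1 - r x / (4 * \<rho>)) * norm x"
    proof -
      have "0 \<le> 1 - r x / (4 * \<rho>)" using r \<rho> by (simp add: field_simps)
      then show ?thesis by (simp add: c_def)
    qed
    also have "\<dots> \<le> (1 - r x / (4 * \<rho>)) * \<rho>"
      using nx r \<rho> by (intro mult_left_mono) (auto simp: field_simps)
    also have "\<dots> = \<rho> - r x / 4" using \<rho> by (simp add: left_diff_distrib)
    finally have nc: "norm (c x) + r x / 4 \<le> \<rho>" by simp
    have sub\<rho>: "cball (c x) (r x / 4) \<subseteq> cball 0 \<rho>"
      using nc by (simp add: cball_subset_cball_iff)
    have sub\<rho>': "ball (c x) (r x / 4) \<subseteq> ball 0 \<rho>"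
      using nc by (simp add: ball_subset_ball_iff)
    have subx: "ball (c x) (r x / 4) \<subseteq> cball x (r x / 2)"
    proof
      fix y assume "y \<in> ball (c x) (r x / 4)"
      then show "y \<in> cball x (r x / 2)"
        using cx dist_triangle[of x y "c x"] by (simp add: dist_norm norm_minus_commute)
    qed
    have "y \<notin> contact w a (cball 0 \<rho>)" if "y \<in> ball (c x) (r x / 4)" for y
    proof
      assume "y \<in> contact w a (cball 0 \<rho>)"
      moreover have "y \<in> cball 0 \<rho>" using that sub\<rho>' by auto
      ultimately have "r x \<le> dist x y" unfolding r_def by (intro infdist_le) auto
      moreover have "dist x y \<le> r x / 2" using that subx by auto
      ultimately show False using r by simp
    qed
    then show "ball (c x) (r x / 4) \<subseteq> cball x (r x / 2) \<inter> N"
      using subx sub\<rho>' by (auto simp: N_def)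
    obtain s where s: "s \<in> ?S" "r x = dist x s"
      using infdist_attains_inf[OF compact_imp_closed[OF cS] ne, of x] unfolding r_def by blast
    have "norm (s - c x) \<le> 5 * (r x / 4)"
      using s(2) cx norm_triangle_ineq[of "s - x" "x - c x"] by (simp add: dist_norm norm_minus_commute)
    from contact_growth[OF a _ this sub\<rho>] s(1) r(1)
    have "(r x / 4 / 8) ^ CARD('n) * ?\<omega> \<le> jacobian_bound CARD('n) \<kappa> * ?\<mu> (T \<inter> ball (c x) (r x / 4))"
      by (simp only: T_def Int_iff)
    then have "80 ^ CARD('n) * ((r x / 4 / 8) ^ CARD('n) * ?\<omega>)
        \<le> 80 ^ CARD('n) * (jacobian_bound CARD('n) \<kappa> * ?\<mu> (T \<inter> ball (c x) (r x / 4)))"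
      by (intro mult_left_mono) auto
    moreover have "80 ^ CARD('n) * ((r x / 4 / 8) ^ CARD('n) * ?\<omega>) = (5 * (r x / 2)) ^ CARD('n) * ?\<omega>"
      unfolding mult.assoc[symmetric] power_mult_distrib[symmetric] by simp
    moreover have "?\<mu> (cball x (5 * (r x / 2))) = (5 * (r x / 2)) ^ CARD('n) * ?\<omega>"
      by (rule content_cball_eq) (use r in simp)
    ultimately show "?\<mu> (cball x (5 * (r x / 2))) \<le> covering_constant CARD('n) \<kappa> * ?\<mu> (T \<inter> ball (c x) (r x / 4))"
      unfolding covering_constant_def by (simp only: mult.assoc)
  qed
  \<comment> \<open>The selected balls of half the distance are disjoint, hence so are the smaller
    balls around \<open>c x\<close> inside them; the fivefold enlargements still cover
    \<open>N\<close>.\<close>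
  obtain C where C: "countable C" "C \<subseteq> N"
    "pairwise (\<lambda>i j. disjnt (cball i (r i / 2)) (cball j (r j / 2))) C"
    "N \<subseteq> (\<Union>i\<in>C. cball i (5 * (r i / 2)))"
  proof (rule Vitali_covering_lemma_cballs[where K=N and S=N and a="\<lambda>x. x" and r="\<lambda>x. r x / 2" and B=\<rho>])
    show "N \<subseteq> (\<Union>i\<in>N. cball i (r i / 2))"
    proof
      fix x assume x: "x \<in> N"
      then have "x \<in> cball x (r x / 2)" using r0[OF x] by simp
      then show "x \<in> (\<Union>i\<in>N. cball i (r i / 2))" using x by blast
    qed
    show "0 < r i / 2 \<and> r i / 2 \<le> \<rho>" if "i \<in> N" for i using r0[OF that] r2[OF that] by simp
  qed
  have fin: "?\<mu> (\<Union>i\<in>I. cball i (5 * (r i / 2))) \<le> covering_constant CARD('n) \<kappa> * ?\<mu> (N \<inter> T)"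
    if I: "I \<subseteq> C" "finite I" for I
  proof -
    have IN: "i \<in> N" if "i \<in> I" for i using that I C by auto
    have "?\<mu> (\<Union>i\<in>I. cball i (5 * (r i / 2))) \<le> (\<Sum>i\<in>I. ?\<mu> (cball i (5 * (r i / 2))))"
      by (rule measure_UNION_le) (use I in auto)
    also have "\<dots> \<le> (\<Sum>i\<in>I. covering_constant CARD('n) \<kappa> * ?\<mu> (T \<inter> ball (c i) (r i / 4)))"
      by (intro sum_mono key IN)
    also have "\<dots> = covering_constant CARD('n) \<kappa> * (\<Sum>i\<in>I. ?\<mu> (T \<inter> ball (c i) (r i / 4)))"
      by (simp only: sum_distrib_left)
    also have "(\<Sum>i\<in>I. ?\<mu> (T \<inter> ball (c i) (r i / 4))) = ?\<mu> (\<Union>i\<in>I. T \<inter> ball (c i) (r i / 4))"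
    proof (rule measure_UNION'[symmetric])
      show "finite I" by (rule I(2))
      show "T \<inter> ball (c i) (r i / 4) \<in> lmeasurable" if "i \<in> I" for i
        using T by (intro fmeasurable.Int lmeasurable_ball)
      show "pairwise (\<lambda>i j. disjnt (T \<inter> ball (c i) (r i / 4)) (T \<inter> ball (c j) (r j / 4))) I"
        unfolding pairwise_def
      proof (intro ballI impI)
        fix i j assume ij: "i \<in> I" "j \<in> I" "i \<noteq> j"
        then have "disjnt (cball i (r i / 2)) (cball j (r j / 2))"
          using C(3) I(1) by (auto simp: pairwise_def)
        then show "disjnt (T \<inter> ball (c i) (r i / 4)) (T \<inter> ball (c j) (r j / 4))"
          using inside[OF IN[OF ij(1)]] inside[OF IN[OF ij(2)]] by (auto simp: disjnt_def)
      qed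
    qed
    also have "covering_constant CARD('n) \<kappa> * ?\<mu> (\<Union>i\<in>I. T \<inter> ball (c i) (r i / 4))
        \<le> covering_constant CARD('n) \<kappa> * ?\<mu> (N \<inter> T)"
    proof (intro mult_left_mono measure_mono_fmeasurable)
      show "(\<Union>i\<in>I. T \<inter> ball (c i) (r i / 4)) \<subseteq> N \<inter> T" using inside IN by blast
      show "(\<Union>i\<in>I. T \<inter> ball (c i) (r i / 4)) \<in> sets lebesgue"
        using T I(2) by (intro sets.finite_UN sets.Int fmeasurableD) auto
      show "N \<inter> T \<in> lmeasurable" using N T by (rule fmeasurable.Int)
    qed (use covering_constant_ge_1 in simp)
    finally show ?thesis .
  qed
  have cb: "cball i (5 * (r i / 2)) \<in> lmeasurable" for i by (rule lmeasurable_cball)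
  have "?\<mu> N \<le> ?\<mu> (\<Union>i\<in>C. cball i (5 * (r i / 2)))"
    using C(4) N fmeasurable_UN_bound[OF C(1) cb fin] by (intro measure_mono_fmeasurable) (auto intro: fmeasurableD)
  also have "\<dots> \<le> covering_constant CARD('n) \<kappa> * ?\<mu> (N \<inter> T)"
    by (rule measure_UN_bound[OF C(1) cb fin])
  finally show ?thesis .
qed

text \<open>Each enlargement of the opening removes at least the share
  \<open>1 / covering_constant\<close> of what is left, and \<open>contact_mono\<close> keeps
  earlier contact points. Nonemptiness is carried along because the covering needs it at every
  step.\<close>

lemma noncontact_decay:
  assumes a: "0 < a" and \<rho>: "0 < \<rho>" and ne: "contact w a (cball 0 \<rho>) \<inter> cball 0 \<rho> \<noteq> {}"
  shows "contact w (opening_ratio CARD('n) \<kappa> ^ k * a) (cball 0 \<rho>) \<inter> cball 0 \<rho> \<noteq> {} \<and>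
    measure lebesgue (ball 0 \<rho> - contact w (opening_ratio CARD('n) \<kappa> ^ k * a) (cball 0 \<rho>))
      \<le> (1 - 1 / covering_constant CARD('n) \<kappa>) ^ k * measure lebesgue (ball (0 :: real ^ 'n) \<rho>)"
proof (induction k)
  case 0
  have "measure lebesgue (ball 0 \<rho> - contact w a (cball 0 \<rho>)) \<le> measure lebesgue (ball (0 :: real ^ 'n) \<rho>)"
    using a by (intro measure_mono_fmeasurable sets.Diff fmeasurableD lmeasurable_contact lmeasurable_ball) auto
  then show ?case using ne by simp
next
  case (Suc k)
  let ?\<mu> = "measure lebesgue"
  let ?\<Lambda> = "opening_ratio CARD('n) \<kappa>"
  let ?C = "covering_constant CARD('n) \<kappa>"
  define b where "b = ?\<Lambda> ^ k * a"
  have \<Lambda>: "1 \<le> ?\<Lambda>" using height_ge_1 by (simp add: opening_ratio_def)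
  have b: "0 < b" using a \<Lambda> by (simp add: b_def)
  have bb: "b \<le> ?\<Lambda> * b" "0 < ?\<Lambda> * b" using b \<Lambda> by simp_all
  have Sb: "?\<Lambda> ^ Suc k * a = ?\<Lambda> * b" by (simp add: b_def)
  define N where "N = ball 0 \<rho> - contact w b (cball 0 \<rho>)"
  define T where "T = contact w (?\<Lambda> * b) (cball 0 \<rho>)"
  have ne': "contact w b (cball 0 \<rho>) \<inter> cball 0 \<rho> \<noteq> {}" using Suc by (simp add: b_def)
  have mN: "N \<in> lmeasurable"
    unfolding N_def by (intro fmeasurable.Diff lmeasurable_ball lmeasurable_contact b)
  have mT: "T \<in> lmeasurable" unfolding T_def by (rule lmeasurable_contact[OF bb(2)])
  have sub: "contact w b (cball 0 \<rho>) \<inter> cball 0 \<rho> \<subseteq> T"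
    unfolding T_def using contact_mono[OF b bb(1)] by blast
  then have "ball 0 \<rho> - T = N - T" by (force simp: N_def)
  then have "?\<mu> (ball 0 \<rho> - T) = ?\<mu> (N - N \<inter> T)" by (simp add: Diff_Int)
  also have "\<dots> = ?\<mu> N - ?\<mu> (N \<inter> T)"
    using mN mT by (intro measurable_measure_Diff) auto
  also have "\<dots> \<le> ?\<mu> N - ?\<mu> N / ?C"
    using noncontact_covering[OF b \<rho> ne'] covering_constant_ge_1
    unfolding N_def T_def by (intro diff_left_mono) (simp only: divide_le_eq mult.commute, simp)
  also have "\<dots> = (1 - 1 / ?C) * ?\<mu> N" by (simp add: left_diff_distrib)
  also have "\<dots> \<le> (1 - 1 / ?C) * ((1 - 1 / ?C) ^ k * ?\<mu> (ball (0 :: real ^ 'n) \<rho>))"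
    using Suc covering_constant_ge_1 unfolding N_def b_def by (intro mult_left_mono) simp_all
  finally have "?\<mu> (ball 0 \<rho> - T) \<le> (1 - 1 / ?C) ^ Suc k * ?\<mu> (ball (0 :: real ^ 'n) \<rho>)"
    by (simp only: power_Suc mult.assoc)
  moreover have "T \<inter> cball 0 \<rho> \<noteq> {}" using ne' sub by blast
  ultimately show ?case unfolding Sb T_def by blast
qed

text \<open>With a = 4 eta / rho^2 the paraboloid with vertex 0 must touch inside the ball: outside
  it would be worth at least 2 eta, against at most 9/8 eta at \<open>x0\<close>. At a contact point
  of the enlarged opening b, comparison with \<open>x0\<close> bounds \<open>w\<close> by eta + b /
  2 (2 rho)^2.\<close>

lemma measure_large_values:
  assumes \<eta>: "0 < \<eta>" and \<rho>: "0 < \<rho>" and x0: "norm x0 \<le> \<rho> / 4" "w x0 \<le> \<eta>"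
  obtains N where "N \<in> lmeasurable"
    "measure lebesgue N \<le> (1 - 1 / covering_constant CARD('n) \<kappa>) ^ k * measure lebesgue (ball (0 :: real ^ 'n) \<rho>)"
    "\<And>x. x \<in> ball 0 \<rho> - N \<Longrightarrow> w x \<le> \<eta> * (1 + 8 * opening_ratio CARD('n) \<kappa> ^ k)"
proof -
  define a where "a = 4 * \<eta> / \<rho>\<^sup>2"
  define b where "b = opening_ratio CARD('n) \<kappa> ^ k * a"
  have a: "0 < a" and a\<rho>: "a * \<rho>\<^sup>2 = 4 * \<eta>" using \<eta> \<rho> by (auto simp: a_def)
  have \<Lambda>: "1 \<le> opening_ratio CARD('n) \<kappa>" using height_ge_1 by (simp add: opening_ratio_def)
  have b: "0 < b" using a \<Lambda> by (simp add: b_def)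
  have sq: "(norm x0)\<^sup>2 \<le> \<rho>\<^sup>2 / 16"
    using power_mono[OF x0(1), of 2] by (simp add: power_divide)
  obtain x1 where x1: "\<And>z. w x1 + a / 2 * (norm (x1 - 0))\<^sup>2 \<le> w z + a / 2 * (norm (z - 0))\<^sup>2"
    using contact_exists[OF a, of 0] by blast
  have "x1 \<in> cball 0 \<rho>"
  proof (rule ccontr)
    assume "x1 \<notin> cball 0 \<rho>"
    then have "\<rho>\<^sup>2 \<le> (norm x1)\<^sup>2" using \<rho> by (intro power_mono) auto
    then have "a * \<rho>\<^sup>2 \<le> a * (norm x1)\<^sup>2" using a by simp
    moreover have "a * (norm x0)\<^sup>2 \<le> a * (\<rho>\<^sup>2 / 16)" using a sq by (intro mult_left_mono) auto
    moreover have "w x1 + a / 2 * (norm x1)\<^sup>2 \<le> w x0 + a / 2 * (norm x0)\<^sup>2" using x1[of x0] by simp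
    ultimately show False using nonneg[of x1] x0(2) a\<rho> \<eta> by (simp add: field_simps)
  qed
  moreover have "x1 \<in> contact w a (cball 0 \<rho>)"
    unfolding contact_def using x1 \<rho> by (auto intro!: bexI[of _ 0])
  ultimately have ne: "contact w a (cball 0 \<rho>) \<inter> cball 0 \<rho> \<noteq> {}" by blast
  show ?thesis
  proof (rule that[of "ball 0 \<rho> - contact w b (cball 0 \<rho>)"])
    show "ball 0 \<rho> - contact w b (cball 0 \<rho>) \<in> lmeasurable"
      by (intro fmeasurable.Diff lmeasurable_ball lmeasurable_contact b)
    show "measure lebesgue (ball 0 \<rho> - contact w b (cball 0 \<rho>))
        \<le> (1 - 1 / covering_constant CARD('n) \<kappa>) ^ k * measure lebesgue (ball (0 :: real ^ 'n) \<rho>)"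
      using noncontact_decay[OF a \<rho> ne, of k] unfolding b_def by blast
    fix x assume "x \<in> ball 0 \<rho> - (ball 0 \<rho> - contact w b (cball 0 \<rho>))"
    then have "x \<in> contact w b (cball 0 \<rho>)" by blast
    then obtain y where y: "y \<in> cball 0 \<rho>" "\<And>z. w x + b / 2 * (norm (x - y))\<^sup>2 \<le> w z + b / 2 * (norm (z - y))\<^sup>2"
      by (auto simp: contact_def)
    have "0 \<le> b / 2 * (norm (x - y))\<^sup>2" using b by simp
    then have "w x \<le> w x0 + b / 2 * (norm (x0 - y))\<^sup>2" using y(2)[of x0] by linarith
    also have "norm (x0 - y) \<le> 2 * \<rho>"
      using y(1) x0(1) \<rho> norm_triangle_ineq4[of x0 y] by simp
    then have "b / 2 * (norm (x0 - y))\<^sup>2 \<le> b / 2 * (2 * \<rho>)\<^sup>2"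
      using b by (intro mult_left_mono power_mono) auto
    also have "b / 2 * (2 * \<rho>)\<^sup>2 = opening_ratio CARD('n) \<kappa> ^ k * 2 * (a * \<rho>\<^sup>2)"
      by (simp add: b_def power_mult_distrib)
    finally show "w x \<le> \<eta> * (1 + 8 * opening_ratio CARD('n) \<kappa> ^ k)"
      using x0(2) by (simp add: a\<rho> algebra_simps)
  qed
qed

end

text \<open>The order of choices is the point. First k, making each exceptional share of a ball
  smaller than 1 / (2 card I); then \<open>\<eta>\<close>, absorbing the loss factor for this k;
  then points where the functions are below \<open>\<eta>\<close>; last the radius, large enough for
  all these points. This works because k does not depend on the radius.\<close>

theorem common_near_infimum:
  fixes w :: "'i \<Rightarrow> real ^ 'n::finite \<Rightarrow> real"
  assumes fin: "finite I" and super: "\<And>i. i \<in> I \<Longrightarrow> \<exists>D E. supersolution \<kappa> (w i) D E"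
    and inf: "\<And>i \<eta>. i \<in> I \<Longrightarrow> 0 < \<eta> \<Longrightarrow> \<exists>x. w i x \<le> \<eta>"
    and \<epsilon>: "0 < \<epsilon>"
  shows "\<exists>x. \<forall>i\<in>I. w i x \<le> \<epsilon>"
proof (cases "I = {}")
  case False
  let ?\<mu> = "measure lebesgue"
  let ?\<Lambda> = "opening_ratio CARD('n) \<kappa>"
  let ?C = "covering_constant CARD('n) \<kappa>"
  obtain i0 D0 E0 where i0: "i0 \<in> I" "supersolution \<kappa> (w i0) D0 E0" using super False by blast
  have C: "1 \<le> ?C" and \<Lambda>: "1 \<le> ?\<Lambda>"
    using supersolution.covering_constant_ge_1[OF i0(2)] supersolution.height_ge_1[OF i0(2)]
    by (simp_all add: opening_ratio_def)
  have "(\<lambda>k. (1 - 1 / ?C) ^ k) \<longlonglongrightarrow> 0"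
    by (rule LIMSEQ_power_zero) (use C in auto)
  then have "\<forall>\<^sub>F k in sequentially. (1 - 1 / ?C) ^ k < 1 / (2 * real (card I))"
    by (rule order_tendstoD(2)) (use False fin in \<open>simp add: card_gt_0_iff\<close>)
  then obtain k where k: "(1 - 1 / ?C) ^ k < 1 / (2 * real (card I))"
    by (auto simp: eventually_sequentially)
  define \<eta> where "\<eta> = \<epsilon> / (1 + 8 * ?\<Lambda> ^ k)"
  have pos: "0 < 1 + 8 * ?\<Lambda> ^ k" using \<Lambda> by (simp add: add_pos_nonneg)
  have \<eta>: "0 < \<eta>" "\<eta> * (1 + 8 * ?\<Lambda> ^ k) = \<epsilon>" using pos \<epsilon> by (auto simp: \<eta>_def)
  obtain p where p: "\<And>i. i \<in> I \<Longrightarrow> w i (p i) \<le> \<eta>" using inf[OF _ \<eta>(1)] by metis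
  define \<rho> where "\<rho> = 4 * (\<Sum>i\<in>I. norm (p i)) + 1"
  have \<rho>: "0 < \<rho>" unfolding \<rho>_def by (simp add: add_nonneg_pos sum_nonneg)
  have p\<rho>: "norm (p i) \<le> \<rho> / 4" if "i \<in> I" for i
    using member_le_sum[OF that, of "\<lambda>i. norm (p i)"] fin by (simp add: \<rho>_def)
  have "\<exists>N. N \<in> lmeasurable \<and> ?\<mu> N \<le> (1 - 1 / ?C) ^ k * ?\<mu> (ball (0 :: real ^ 'n) \<rho>)
      \<and> (\<forall>x\<in>ball 0 \<rho> - N. w i x \<le> \<epsilon>)" if i: "i \<in> I" for i
  proof -
    obtain D E where "supersolution \<kappa> (w i) D E" using super[OF i] by blast
    show ?thesis
    proof (rule supersolution.measure_large_values[OF \<open>supersolution \<kappa> (w i) D E\<close> \<eta>(1) \<rho> p\<rho>[OF i] p[OF i], of k])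
      fix N assume "N \<in> lmeasurable"
        "?\<mu> N \<le> (1 - 1 / ?C) ^ k * ?\<mu> (ball (0 :: real ^ 'n) \<rho>)"
        "\<And>x. x \<in> ball 0 \<rho> - N \<Longrightarrow> w i x \<le> \<eta> * (1 + 8 * ?\<Lambda> ^ k)"
      then show ?thesis unfolding \<eta>(2) by blast
    qed
  qed
  then obtain N where N: "\<And>i. i \<in> I \<Longrightarrow> N i \<in> lmeasurable"
    "\<And>i. i \<in> I \<Longrightarrow> ?\<mu> (N i) \<le> (1 - 1 / ?C) ^ k * ?\<mu> (ball (0 :: real ^ 'n) \<rho>)"
    "\<And>i x. i \<in> I \<Longrightarrow> x \<in> ball 0 \<rho> - N i \<Longrightarrow> w i x \<le> \<epsilon>" by metis
  have ball0: "0 < ?\<mu> (ball (0 :: real ^ 'n) \<rho>)"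
    using content_ball_pos[OF \<rho>, of "0 :: real ^ 'n"] by simp
  have "?\<mu> (\<Union>i\<in>I. N i) \<le> (\<Sum>i\<in>I. ?\<mu> (N i))"
    using fin N(1) by (intro measure_UNION_le) auto
  also have "\<dots> \<le> (\<Sum>i\<in>I. (1 - 1 / ?C) ^ k * ?\<mu> (ball (0 :: real ^ 'n) \<rho>))" by (intro sum_mono N(2))
  also have "\<dots> = real (card I) * (1 - 1 / ?C) ^ k * ?\<mu> (ball (0 :: real ^ 'n) \<rho>)" by simp
  also have "\<dots> < 1 * ?\<mu> (ball (0 :: real ^ 'n) \<rho>)"
  proof (rule mult_strict_right_mono[OF _ ball0])
    have "real (card I) * (1 - 1 / ?C) ^ k \<le> real (card I) * (1 / (2 * real (card I)))"
      using k by (intro mult_left_mono) auto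
    also have "\<dots> < 1" by simp
    finally show "real (card I) * (1 - 1 / ?C) ^ k < 1" .
  qed
  finally have lt: "?\<mu> (\<Union>i\<in>I. N i) < ?\<mu> (ball (0 :: real ^ 'n) \<rho>)" by simp
  have "\<not> ball 0 \<rho> \<subseteq> (\<Union>i\<in>I. N i)"
  proof
    assume "ball 0 \<rho> \<subseteq> (\<Union>i\<in>I. N i)"
    then have "?\<mu> (ball (0 :: real ^ 'n) \<rho>) \<le> ?\<mu> (\<Union>i\<in>I. N i)"
      using fin N(1) by (intro measure_mono_fmeasurable fmeasurable.finite_UN) auto
    then show False using lt by simp
  qed
  then obtain x where "x \<in> ball 0 \<rho>" "x \<notin> (\<Union>i\<in>I. N i)" by blast
  then show ?thesis using N(3) by blast
qed simp

section \<open>The critical phase and derivatives of matrix functions\<close>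

text \<open>The denominator 1 - tan x tan y of the addition formula lies in (0, 1].\<close>

lemma tan_add_ge:
  fixes x y :: real
  assumes "0 \<le> x" "0 \<le> y" "x + y < pi / 2"
  shows "tan x + tan y \<le> tan (x + y)"
proof -
  have c: "0 < cos x" "0 < cos y" "0 < cos (x + y)"
    using assms by (auto intro!: cos_gt_zero_pi)
  have t: "0 \<le> tan x" "0 \<le> tan y" using assms by (auto intro!: tan_pos_pi2_le)
  have d: "1 - tan x * tan y = cos (x + y) / (cos x * cos y)"
    using c by (simp add: tan_def cos_add field_simps)
  have "0 < 1 - tan x * tan y" unfolding d using c by simp
  then have "tan x + tan y \<le> (tan x + tan y) / (1 - tan x * tan y)"
    using t by (simp add: pos_le_divide_eq mult_left_le)
  also have "\<dots> = tan (x + y)" using c by (intro tan_add[symmetric]) auto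
  finally show ?thesis .
qed

lemma sum_tan_le:
  fixes a :: "'i \<Rightarrow> real"
  assumes "finite J" "\<And>j. j \<in> J \<Longrightarrow> 0 \<le> a j" "(\<Sum>j\<in>J. a j) < pi / 2"
  shows "(\<Sum>j\<in>J. tan (a j)) \<le> tan (\<Sum>j\<in>J. a j)"
  using assms
proof (induction J rule: finite_induct)
  case (insert i J)
  have s: "0 \<le> (\<Sum>j\<in>J. a j)" using insert by (intro sum_nonneg) auto
  have "(\<Sum>j\<in>J. tan (a j)) \<le> tan (\<Sum>j\<in>J. a j)"
  proof (rule insert.IH)
    have "0 \<le> a i" using insert by simp
    moreover have "a i + (\<Sum>j\<in>J. a j) < pi / 2" using insert by simp
    ultimately show "(\<Sum>j\<in>J. a j) < pi / 2" by linarith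
  qed (use insert in auto)
  moreover have "tan (a i) + tan (\<Sum>j\<in>J. a j) \<le> tan (a i + (\<Sum>j\<in>J. a j))"
    using insert s by (intro tan_add_ge) auto
  ultimately show ?case using insert by simp
qed simp

text \<open>Each of the other n - 2 angles exceeds - pi / 2, so together they already account for at
  least the whole critical phase. In particular at most one angle is positive.\<close>

lemma critical_phase_pair:
  fixes \<phi> :: "'n::finite \<Rightarrow> real"
  assumes \<phi>: "\<And>i. \<bar>\<phi> i\<bar> < pi / 2"
    and crit: "(\<Sum>i\<in>UNIV. \<phi> i) = - (real CARD('n) - 2) * pi / 2" and ij: "i \<noteq> j"
  shows "\<phi> i + \<phi> j \<le> 0"
proof -
  let ?J = "UNIV - {i, j}"
  have "card ?J = CARD('n) - 2" using ij by (simp add: card_Diff_subset)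
  moreover have "2 \<le> CARD('n)" using card_mono[of UNIV "{i, j}"] ij by simp
  ultimately have cJ: "real (card ?J) = real CARD('n) - 2" by simp
  have "(\<Sum>k\<in>?J. - (pi / 2)) \<le> (\<Sum>k\<in>?J. \<phi> k)"
    using \<phi> by (intro sum_mono) (smt (verit))
  then have "- (real CARD('n) - 2) * pi / 2 \<le> (\<Sum>k\<in>?J. \<phi> k)"
    by (simp add: cJ) (simp add: field_simps)
  moreover have "(\<Sum>k\<in>UNIV. \<phi> k) = (\<Sum>k\<in>{i, j}. \<phi> k) + (\<Sum>k\<in>?J. \<phi> k)"
    by (rule sum.subset_diff[of "{i,j}" UNIV, simplified add.commute]) auto
  ultimately show ?thesis using crit ij by simp
qed

text \<open>At the critical phase the level set of \<open>\<Sum> arctan\<close> has a convexity property; the inequality is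
  Cauchy--Schwarz together with \<open>\<Sum> cot\<close> being controlled by superadditivity of the tangent.\<close>

lemma critical_phase_diagonal:
  fixes \<phi> \<eta> :: "'n::finite \<Rightarrow> real"
  assumes \<phi>: "\<And>i. \<bar>\<phi> i\<bar> < pi / 2"
    and crit: "(\<Sum>i\<in>UNIV. \<phi> i) = - (real CARD('n) - 2) * pi / 2"
    and \<eta>: "(\<Sum>i\<in>UNIV. \<eta> i) = 0"
  shows "(\<Sum>i\<in>UNIV. tan (\<phi> i) * (\<eta> i)\<^sup>2) \<le> 0"
proof (cases "\<exists>k. 0 < \<phi> k")
  case False
  have "tan (\<phi> i) \<le> 0" for i
  proof -
    have "0 \<le> tan (- \<phi> i)" using \<phi>[of i] False by (intro tan_pos_pi2_le) (auto simp: not_less)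
    then show ?thesis by simp
  qed
  then show ?thesis by (intro sum_nonpos) (auto intro: mult_nonpos_nonneg)
next
  case True
  then obtain k where k: "0 < \<phi> k" by blast
  let ?J = "UNIV - {k}"
  define \<tau> where "\<tau> j = - tan (\<phi> j)" for j
  have neg: "\<phi> j < 0" if "j \<in> ?J" for j
    using critical_phase_pair[OF \<phi> crit, of k j] that k by auto
  have \<tau>: "0 < \<tau> j" if "j \<in> ?J" for j
  proof -
    have "0 < tan (- \<phi> j)" using \<phi>[of j] neg[OF that] by (intro tan_gt_zero) auto
    then show ?thesis by (simp add: \<tau>_def)
  qed
  have split: "(\<Sum>i\<in>UNIV. f i) = f k + (\<Sum>i\<in>?J. f i)" for f :: "'n \<Rightarrow> real"
    by (rule sum.remove) auto
  have cot: "tan (pi / 2 - x) = 1 / tan x" for x :: real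
    by (simp add: tan_cot inverse_eq_divide)
  \<comment> \<open>Here criticality is used: the angles complementary to the negative ones add up
    exactly to the complement of the positive one.\<close>
  have a: "(\<Sum>j\<in>?J. pi / 2 + \<phi> j) = pi / 2 - \<phi> k"
  proof -
    have "(\<Sum>j\<in>?J. pi / 2 + \<phi> j) = real (card ?J) * (pi / 2) + (\<Sum>j\<in>?J. \<phi> j)" by (simp add: sum.distrib)
    moreover have "real (card ?J) = real CARD('n) - 1"
      using zero_less_card_finite[where 'a='n] by (simp add: card_Diff_subset of_nat_diff Suc_leI)
    moreover have "(\<Sum>j\<in>?J. \<phi> j) = - (real CARD('n) - 2) * pi / 2 - \<phi> k" using crit split[of \<phi>] by simp
    ultimately show ?thesis by (simp add: algebra_simps add_divide_distrib diff_divide_distrib)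
  qed
  have "(\<Sum>j\<in>?J. tan (pi / 2 + \<phi> j)) \<le> tan (\<Sum>j\<in>?J. pi / 2 + \<phi> j)"
  proof (rule sum_tan_le)
    show "0 \<le> pi / 2 + \<phi> j" for j using \<phi>[of j] by linarith
    show "(\<Sum>j\<in>?J. pi / 2 + \<phi> j) < pi / 2" using a k by simp
  qed simp
  moreover have "tan (pi / 2 + \<phi> j) = 1 / \<tau> j" for j
    using cot[of "- \<phi> j"] by (simp add: \<tau>_def)
  ultimately have le: "(\<Sum>j\<in>?J. 1 / \<tau> j) \<le> 1 / tan (\<phi> k)" unfolding a cot by simp
  have tk: "0 < tan (\<phi> k)" using \<phi>[of k] k by (intro tan_gt_zero) auto
  have "(\<eta> k)\<^sup>2 = (\<Sum>j\<in>?J. \<eta> j)\<^sup>2"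
  proof -
    have "\<eta> k = - (\<Sum>j\<in>?J. \<eta> j)" using \<eta> split[of \<eta>] by simp
    then show ?thesis by simp
  qed
  also have "(\<Sum>j\<in>?J. \<eta> j) = (\<Sum>j\<in>?J. (sqrt (\<tau> j) * \<eta> j) * (1 / sqrt (\<tau> j)))"
    by (rule sum.cong) (use \<tau> in \<open>auto simp: less_imp_neq[symmetric]\<close>)
  also have "\<dots>\<^sup>2 \<le> (\<Sum>j\<in>?J. (sqrt (\<tau> j) * \<eta> j)\<^sup>2) * (\<Sum>j\<in>?J. (1 / sqrt (\<tau> j))\<^sup>2)"
    by (rule Cauchy_Schwarz_ineq_sum)
  also have "(\<Sum>j\<in>?J. (sqrt (\<tau> j) * \<eta> j)\<^sup>2) = (\<Sum>j\<in>?J. \<tau> j * (\<eta> j)\<^sup>2)"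
    by (rule sum.cong) (use \<tau> in \<open>auto simp: power_mult_distrib less_imp_le\<close>)
  also have "(\<Sum>j\<in>?J. (1 / sqrt (\<tau> j))\<^sup>2) = (\<Sum>j\<in>?J. 1 / \<tau> j)"
    by (rule sum.cong) (use \<tau> in \<open>auto simp: power_divide less_imp_le\<close>)
  also have "(\<Sum>j\<in>?J. \<tau> j * (\<eta> j)\<^sup>2) * (\<Sum>j\<in>?J. 1 / \<tau> j) \<le> (\<Sum>j\<in>?J. \<tau> j * (\<eta> j)\<^sup>2) * (1 / tan (\<phi> k))"
    using \<tau> by (intro mult_left_mono le sum_nonneg mult_nonneg_nonneg) (auto intro: less_imp_le)
  finally have "tan (\<phi> k) * (\<eta> k)\<^sup>2 \<le> (\<Sum>j\<in>?J. \<tau> j * (\<eta> j)\<^sup>2)"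
    using tk by (simp add: field_simps)
  moreover have "(\<Sum>j\<in>?J. tan (\<phi> j) * (\<eta> j)\<^sup>2) = - (\<Sum>j\<in>?J. \<tau> j * (\<eta> j)\<^sup>2)"
    by (simp add: \<tau>_def sum_negf)
  ultimately show ?thesis using split[of "\<lambda>i. tan (\<phi> i) * (\<eta> i)\<^sup>2"] by simp
qed

text \<open>By the mean value theorem the error is (b - a) times a difference of slopes, and the
  slope 1 / (1 + x^2) has Lipschitz constant 1. The factor 1 is written out to match
  \<open>C\<close> in \<open>trace_function_taylor\<close>.\<close>

lemma arctan_taylor:
  fixes a b :: real
  shows "\<bar>arctan b - arctan a - 1 / (1 + a\<^sup>2) * (b - a)\<bar> \<le> 1 * (b - a)\<^sup>2"
proof -
  have "\<exists>z. \<bar>z - a\<bar> \<le> \<bar>b - a\<bar> \<and> arctan b - arctan a = (b - a) * (1 / (1 + z\<^sup>2))"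
  proof (cases a b rule: linorder_cases)
    case less
    then obtain z where "a < z" "z < b" "arctan b - arctan a = (b - a) * inverse (1 + z\<^sup>2)"
      using MVT2[of a b arctan "\<lambda>x. inverse (1 + x\<^sup>2)"] DERIV_arctan by blast
    then show ?thesis by (intro exI[of _ z]) (auto simp: inverse_eq_divide)
  next
    case greater
    then obtain z where "b < z" "z < a" "arctan a - arctan b = (a - b) * inverse (1 + z\<^sup>2)"
      using MVT2[of b a arctan "\<lambda>x. inverse (1 + x\<^sup>2)"] DERIV_arctan by blast
    then show ?thesis
      by (intro exI[of _ z]) (auto simp: inverse_eq_divide algebra_simps diff_divide_distrib)
  qed auto
  then obtain z where z: "\<bar>z - a\<bar> \<le> \<bar>b - a\<bar>" "arctan b - arctan a = (b - a) * (1 / (1 + z\<^sup>2))" by blast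
  have pos: "0 < 1 + z\<^sup>2" "0 < 1 + a\<^sup>2" by (auto intro: add_pos_nonneg)
  have "\<bar>a + z\<bar> \<le> (1 + z\<^sup>2) * (1 + a\<^sup>2)"
  proof -
    have "\<bar>a\<bar> \<le> (1 + a\<^sup>2) / 2" "\<bar>z\<bar> \<le> (1 + z\<^sup>2) / 2"
      using sum_squares_bound[of 1 "\<bar>a\<bar>"] sum_squares_bound[of 1 "\<bar>z\<bar>"] by auto
    then have "\<bar>a + z\<bar> \<le> 1 + a\<^sup>2 + z\<^sup>2" using abs_triangle_ineq[of a z] zero_le_power2[of a] zero_le_power2[of z]
      by argo
    also have "\<dots> \<le> (1 + z\<^sup>2) * (1 + a\<^sup>2)" by (simp add: algebra_simps)
    finally show ?thesis .
  qed
  then have "\<bar>a + z\<bar> / ((1 + z\<^sup>2) * (1 + a\<^sup>2)) \<le> 1" using pos by simp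
  moreover have "1 / (1 + z\<^sup>2) - 1 / (1 + a\<^sup>2) = (a - z) * ((a + z) / ((1 + z\<^sup>2) * (1 + a\<^sup>2)))"
    using pos by (simp add: field_simps power2_eq_square)
  ultimately have "\<bar>1 / (1 + z\<^sup>2) - 1 / (1 + a\<^sup>2)\<bar> \<le> \<bar>a - z\<bar> * 1"
    using pos by (simp only: abs_mult abs_divide) (intro mult_left_mono, auto)
  then have "\<bar>b - a\<bar> * \<bar>1 / (1 + z\<^sup>2) - 1 / (1 + a\<^sup>2)\<bar> \<le> \<bar>b - a\<bar> * \<bar>b - a\<bar>"
    using z(1) by (intro mult_left_mono) auto
  moreover have "arctan b - arctan a - 1 / (1 + a\<^sup>2) * (b - a) = (b - a) * (1 / (1 + z\<^sup>2) - 1 / (1 + a\<^sup>2))"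
    unfolding z(2) by (simp add: algebra_simps)
  ultimately show ?thesis by (simp only: abs_mult abs_mult_self_eq power2_eq_square mult_1)
qed

section \<open>Derivatives of matrix products and inverses\<close>

lemma bounded_bilinear_matrix_mult: "bounded_bilinear (\<lambda>(A :: real ^ 'n::finite ^ 'm::finite) (B :: real ^ 'k::finite ^ 'n). A ** B)"
proof -
  have "bilinear (\<lambda>(A :: real ^ 'n ^ 'm) (B :: real ^ 'k ^ 'n). A ** B)"
    unfolding bilinear_def
    by (auto intro!: linearI simp: matrix_add_ldistrib vec_eq_iff matrix_matrix_mult_def sum_distrib_left
        algebra_simps sum.distrib)
  then show ?thesis using bilinear_conv_bounded_bilinear by blast
qed

lemma bounded_bilinear_matrix_vector_mult: "bounded_bilinear (\<lambda>(A :: real ^ 'n::finite ^ 'm::finite) x. A *v x)"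
proof -
  have "bilinear (\<lambda>(A :: real ^ 'n ^ 'm) x. A *v x)"
    unfolding bilinear_def
    by (auto intro!: linearI simp: vec_eq_iff matrix_vector_mult_def sum_distrib_left algebra_simps sum.distrib)
  then show ?thesis using bilinear_conv_bounded_bilinear by blast
qed

lemmas has_derivative_matrix_mult = bounded_bilinear.FDERIV[OF bounded_bilinear_matrix_mult]
lemmas has_derivative_matrix_vector_mult = bounded_bilinear.FDERIV[OF bounded_bilinear_matrix_vector_mult]

text \<open>Passes from an operator bound to the norm of the vector type of matrices, in which
  \<open>has_derivative_matrix_inverse\<close> is stated.\<close>

lemma norm_matrix_le:
  fixes A :: "real ^ 'n ^ 'n::finite"
  assumes "\<And>x. norm (A *v x) \<le> b * norm x"
  shows "norm A \<le> real CARD('n) * (real CARD('n) * b)"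
proof -
  have "\<bar>A $ i $ j\<bar> \<le> b" for i j
  proof -
    have "\<bar>A $ i $ j\<bar> = \<bar>(A *v axis j 1) $ i\<bar>" by (simp add: matrix_vector_mul_component inner_axis)
    also have "\<dots> \<le> norm (A *v axis j 1)" by (rule component_le_norm_cart)
    also have "\<dots> \<le> b" using assms[of "axis j 1"] by simp
    finally show ?thesis .
  qed
  then have "norm (A $ i) \<le> real CARD('n) * b" for i
    using norm_le_l1_cart[of "A $ i"] sum_mono[of UNIV "\<lambda>j. \<bar>A $ i $ j\<bar>" "\<lambda>_. b"] by fastforce
  then have "(\<Sum>i\<in>UNIV. norm (A $ i)) \<le> real CARD('n) * (real CARD('n) * b)"
    using sum_mono[of UNIV "\<lambda>i. norm (A $ i)" "\<lambda>_. real CARD('n) * b"] by simp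
  moreover have "norm A \<le> (\<Sum>i\<in>UNIV. norm (A $ i))"
    unfolding norm_vec_def by (rule L2_set_le_sum) simp
  ultimately show ?thesis by simp
qed

text \<open>Resolvent identity P y - P x = - P x (R y - R x) P y. With the uniform bound it yields
  first continuity of P and then the derivative.\<close>

lemma has_derivative_matrix_inverse:
  fixes R P :: "'a::real_normed_vector \<Rightarrow> real ^ 'n ^ 'n::finite"
  assumes R: "(R has_derivative R') (at x)" and inv: "\<And>y. R y ** P y = mat 1"
    and bnd: "\<And>y. norm (P y) \<le> b"
  shows "(P has_derivative (\<lambda>h. - (P x ** R' h ** P x))) (at x)"
proof -
  interpret mm: bounded_bilinear "\<lambda>(A :: real ^ 'n ^ 'n) (B :: real ^ 'n ^ 'n). A ** B" by (rule bounded_bilinear_matrix_mult)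
  obtain K where K: "0 \<le> K" "\<And>(A :: real ^ 'n ^ 'n) (B :: real ^ 'n ^ 'n). norm (A ** B) \<le> norm A * norm B * K"
    using mm.nonneg_bounded by blast
  have b0: "0 \<le> b" using bnd[of x] norm_ge_zero order_trans by blast
  have inv': "P y ** R y = mat 1" for y using inv matrix_left_right_inverse by blast
  have diff: "P y - P x = - (P x ** (R y - R x) ** P y)" for y
    by (simp add: mm.diff_right mm.diff_left inv' matrix_mul_assoc[symmetric] inv)
  interpret R': bounded_linear R' using R by (rule has_derivative_bounded_linear)
  have lin: "bounded_linear (\<lambda>h. - (P x ** R' h ** P x))"
    by (intro bounded_linear_minus bounded_linear_compose[OF mm.bounded_linear_left]
        bounded_linear_compose[OF mm.bounded_linear_right] R'.bounded_linear_axioms)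
  have Rc: "(R \<longlongrightarrow> R x) (at x)" using has_derivative_continuous[OF R] by (simp add: continuous_at)
  have Pc: "(P \<longlongrightarrow> P x) (at x)"
  proof (rule LIM_zero_cancel, rule tendsto_norm_zero_cancel,
      rule tendsto_sandwich[where f="\<lambda>_. 0" and h="\<lambda>y. norm (P x) * norm (R y - R x) * K * b * K"])
    show "((\<lambda>y. norm (P x) * norm (R y - R x) * K * b * K) \<longlongrightarrow> 0) (at x)"
    proof -
      have "((\<lambda>y. norm (P x) * norm (R y - R x) * K * b * K) \<longlongrightarrow> norm (P x) * norm (R x - R x) * K * b * K) (at x)"
        by (intro tendsto_intros Rc)
      then show ?thesis by simp
    qed
    show "\<forall>\<^sub>F y in at x. norm (P y - P x) \<le> norm (P x) * norm (R y - R x) * K * b * K"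
    proof (rule always_eventually, rule allI)
      fix y
      have "norm (P y - P x) \<le> norm (P x ** (R y - R x)) * norm (P y) * K"
        unfolding diff[of y] norm_minus_cancel by (rule K(2))
      also have "\<dots> \<le> (norm (P x) * norm (R y - R x) * K) * b * K"
        using K b0 bnd[of y] by (intro mult_mono mult_nonneg_nonneg) auto
      finally show "norm (P y - P x) \<le> norm (P x) * norm (R y - R x) * K * b * K" by simp
    qed
  qed (auto intro: tendsto_const)
  obtain L where L: "\<And>h. norm (R' h) \<le> norm h * L" "0 \<le> L" using R'.nonneg_bounded by blast
  have Rq: "((\<lambda>y. norm (R y - R x - R' (y - x)) / norm (y - x)) \<longlongrightarrow> 0) (at x)"
    using R by (simp add: has_derivative_iff_norm)
  show ?thesis
    unfolding has_derivative_iff_norm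
  proof (intro conjI lin)
    let ?u = "\<lambda>y. norm (P x) * (norm (R y - R x - R' (y - x)) / norm (y - x)) * K * b * K
        + norm (P x) * L * K * norm (P y - P x) * K"
    show "((\<lambda>y. norm (P y - P x - - (P x ** R' (y - x) ** P x)) / norm (y - x)) \<longlongrightarrow> 0) (at x)"
    proof (rule tendsto_sandwich[where f="\<lambda>_. 0" and h="?u"])
      have "(?u \<longlongrightarrow> norm (P x) * 0 * K * b * K + norm (P x) * L * K * norm (P x - P x) * K) (at x)"
        by (intro tendsto_intros Rq Pc)
      then show "(?u \<longlongrightarrow> 0) (at x)" by simp
      show "\<forall>\<^sub>F y in at x. norm (P y - P x - - (P x ** R' (y - x) ** P x)) / norm (y - x) \<le> ?u y"
      proof (rule eventually_at_filter[THEN iffD2], rule always_eventually, intro allI impI)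
        fix y assume y: "y \<noteq> x"
        \<comment> \<open>The first term is small by differentiability of R, the second by
          continuity of P.\<close>
        have "P y - P x - - (P x ** R' (y - x) ** P x)
            = - (P x ** (R y - R x - R' (y - x)) ** P y) - P x ** R' (y - x) ** (P y - P x)"
        proof -
          define X Y Z where "X = P x ** (R y - R x) ** P y" and "Y = P x ** R' (y - x) ** P y"
            and "Z = P x ** R' (y - x) ** P x"
          have "P x ** (R y - R x - R' (y - x)) ** P y = X - Y" "P x ** R' (y - x) ** (P y - P x) = Y - Z"
            by (simp_all only: X_def Y_def Z_def mm.diff_right mm.diff_left)
          moreover have "P y - P x = - X" unfolding X_def by (rule diff)
          ultimately show ?thesis unfolding Z_def[symmetric] by simp
        qed
        then have "norm (P y - P x - - (P x ** R' (y - x) ** P x))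
            \<le> norm (P x ** (R y - R x - R' (y - x)) ** P y) + norm (P x ** R' (y - x) ** (P y - P x))"
          by (metis norm_minus_cancel norm_triangle_ineq4)
        also have "norm (P x ** (R y - R x - R' (y - x)) ** P y)
            \<le> (norm (P x) * norm (R y - R x - R' (y - x)) * K) * b * K"
          using K b0 bnd[of y] by (intro order_trans[OF K(2)] mult_mono mult_nonneg_nonneg) auto
        also have "norm (P x ** R' (y - x) ** (P y - P x)) \<le> (norm (P x) * (norm (y - x) * L) * K) * norm (P y - P x) * K"
          using K L by (intro order_trans[OF K(2)] mult_right_mono mult_left_mono mult_nonneg_nonneg) (auto intro: order_trans[OF K(2)] mult_right_mono mult_left_mono)
        finally show "norm (P y - P x - - (P x ** R' (y - x) ** P x)) / norm (y - x) \<le> ?u y"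
          using y by (simp add: field_simps)
      qed
    qed (auto intro: tendsto_const)
  qed
qed

section \<open>Lewy rotation\<close>

lemma eigenbasis_symmetric:
  assumes "eigenbasis A v l"
  shows "transpose A = A"
proof -
  have o: "orthonormal v" and e: "\<And>i. A *v v i = l i *\<^sub>R v i"
    using assms by (auto simp: eigenbasis_def)
  have "transpose A *v x = A *v x" for x
    unfolding orthonormal_eq_iff[OF o]
    using inner_matrix_transpose[of _ "transpose A" x] by (simp add: eigenbasis_transpose[OF assms] e)
  then show ?thesis by (simp add: matrix_eq)
qed

lemmas matrix_mult_linear =
  bounded_bilinear.scaleR_left[OF bounded_bilinear_matrix_mult]
  bounded_bilinear.scaleR_right[OF bounded_bilinear_matrix_mult]
  bounded_bilinear.add_left[OF bounded_bilinear_matrix_mult]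
  bounded_bilinear.add_right[OF bounded_bilinear_matrix_mult]
  bounded_bilinear.diff_left[OF bounded_bilinear_matrix_mult]
  bounded_bilinear.diff_right[OF bounded_bilinear_matrix_mult]
  bounded_bilinear.minus_left[OF bounded_bilinear_matrix_mult]
  bounded_bilinear.minus_right[OF bounded_bilinear_matrix_mult]

lemmas matrix_vector_mult_linear =
  bounded_bilinear.scaleR_left[OF bounded_bilinear_matrix_vector_mult]
  bounded_bilinear.scaleR_right[OF bounded_bilinear_matrix_vector_mult]
  bounded_bilinear.add_left[OF bounded_bilinear_matrix_vector_mult]
  bounded_bilinear.add_right[OF bounded_bilinear_matrix_vector_mult]
  bounded_bilinear.diff_left[OF bounded_bilinear_matrix_vector_mult]
  bounded_bilinear.diff_right[OF bounded_bilinear_matrix_vector_mult]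
  bounded_bilinear.minus_left[OF bounded_bilinear_matrix_vector_mult]
  bounded_bilinear.minus_right[OF bounded_bilinear_matrix_vector_mult]

lemma mat_1_vector [simp]: "(c *\<^sub>R mat 1) *v x = c *\<^sub>R (x :: real ^ 'n::finite)"
  by (simp flip: scaleR_matrix_vector_assoc)

lemma cos_pos_bounded: "\<bar>x\<bar> \<le> b \<Longrightarrow> b < pi / 2 \<Longrightarrow> 0 < cos b \<and> cos b \<le> cos x"
  using cos_monotone_0_pi_le[of "\<bar>x\<bar>" b] cos_gt_zero_pi[of b] by auto

text \<open>The gradient of u and its derivatives up to fourth order of u, with directions as vector
  arguments; the first direction of \<open>W\<close> is the one differentiated last. The swap laws
  express the symmetry of third and fourth derivatives. Detached from u, the package can simply be
  negated.\<close>

locale gradient_jet =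
  fixes g :: "real ^ 'n::finite \<Rightarrow> real ^ 'n"
    and H :: "real ^ 'n \<Rightarrow> real ^ 'n ^ 'n"
    and C :: "real ^ 'n \<Rightarrow> real ^ 'n \<Rightarrow> real ^ 'n ^ 'n"
    and W :: "real ^ 'n \<Rightarrow> real ^ 'n \<Rightarrow> real ^ 'n \<Rightarrow> real ^ 'n ^ 'n"
  assumes dg: "(g has_derivative (\<lambda>h. H x *v h)) (at x)"
    and dH: "(H has_derivative C x) (at x)"
    and dC: "((\<lambda>x. C x h) has_derivative (\<lambda>k. W x k h)) (at x)"
    and H_transpose: "transpose (H x) = H x"
    and C_transpose: "transpose (C x h) = C x h"
    and C_swap: "C x h *v k = C x k *v h"
    and W_transpose: "transpose (W x h k) = W x h k"
    and W_linear: "linear (W x h)"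
    and W_swap: "W x h k *v p = W x p k *v h"

text \<open>Only case (a). For n = 1 the critical phase - (n - 2) pi / 2 would be pi / 2, a vertical
  rotated line, whence \<open>dim\<close>.\<close>

locale special_lagrangian_jet = gradient_jet g H C W
  for g :: "real ^ 'n::finite \<Rightarrow> real ^ 'n" and H C W +
  fixes \<Theta> \<gamma> :: real
  assumes phase_sum: "eigenbasis (H x) v l \<Longrightarrow> (\<Sum>i\<in>UNIV. arctan (l i)) = \<Theta>"
    and phase_ge: "eigenbasis (H x) v l \<Longrightarrow> \<gamma> \<le> arctan (l i)"
    and gamma: "(\<Theta> - pi) / real CARD('n) < \<gamma>"
    and dim: "2 \<le> CARD('n)"
begin

text \<open>The Lewy rotation angle is chosen so that the rotated phase is exactly critical.\<close>

definition \<beta> :: real where "\<beta> = (\<Theta> + (real CARD('n) - 2) * pi / 2) / real CARD('n)"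
definition \<phi>\<^sub>0 :: real where "\<phi>\<^sub>0 = max (\<beta> - \<gamma>) (\<Theta> - (real CARD('n) - 1) * \<gamma> - \<beta>)"
definition c\<^sub>0 :: real where "c\<^sub>0 = cos \<phi>\<^sub>0"

lemma n_beta: "real CARD('n) * \<beta> = \<Theta> + (real CARD('n) - 2) * pi / 2"
  using dim by (simp add: \<beta>_def)

text \<open>Put n delta = pi - Theta + n gamma, which is positive exactly by the hypothesis on
  \<open>\<gamma>\<close>. The two candidates in \<open>\<phi>\<^sub>0\<close> are pi / 2 - delta
  and pi / 2 - (n - 1) delta.\<close>

lemma phi0_less: "\<phi>\<^sub>0 < pi / 2"
proof -
  let ?n = "real CARD('n)"
  define \<delta> where "\<delta> = (pi - (\<Theta> - ?n * \<gamma>)) / ?n"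
  have n: "2 \<le> ?n" using dim by simp
  have "?n * \<delta> = pi - (\<Theta> - ?n * \<gamma>)" using n by (simp add: \<delta>_def)
  moreover have s: "\<Theta> - ?n * \<gamma> < pi" using gamma n by (simp add: divide_less_eq algebra_simps)
  ultimately have \<delta>: "0 < \<delta>" "?n * \<delta> = pi - \<Theta> + ?n * \<gamma>" using n by (auto simp: zero_less_mult_iff \<delta>_def)
  have "?n * (\<beta> - \<gamma>) = ?n * (pi / 2 - \<delta>)"
    using n_beta \<delta>(2) by (simp add: field_simps)
  then have b: "\<beta> - \<gamma> = pi / 2 - \<delta>" using n by simp
  have "\<Theta> - (?n - 1) * \<gamma> - \<beta> = (\<Theta> - ?n * \<gamma>) - (\<beta> - \<gamma>)" by (simp add: algebra_simps)
  also have "\<dots> = pi / 2 - (?n - 1) * \<delta>" unfolding b using \<delta>(2) by (simp add: algebra_simps)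
  also have "\<dots> < pi / 2" using n \<delta>(1) by simp
  finally have "\<Theta> - (?n - 1) * \<gamma> - \<beta> < pi / 2" .
  moreover have "\<beta> - \<gamma> < pi / 2" using b \<delta>(1) by linarith
  ultimately show ?thesis by (simp only: \<phi>\<^sub>0_def max_less_iff_conj)
qed

text \<open>The lower bound is the pinching; the upper one follows since the total is fixed and the
  other n - 1 angles are at least \<open>\<gamma>\<close>.\<close>

lemma phase_bound:
  assumes e: "eigenbasis (H x) v l"
  shows "\<bar>arctan (l i) - \<beta>\<bar> \<le> \<phi>\<^sub>0"
    and "(\<Sum>i\<in>UNIV. arctan (l i) - \<beta>) = - (real CARD('n) - 2) * pi / 2"
proof -
  have "(\<Sum>j\<in>UNIV - {i}. \<gamma>) \<le> (\<Sum>j\<in>UNIV - {i}. arctan (l j))"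
    by (intro sum_mono phase_ge[OF e])
  moreover have "real (card (UNIV - {i})) = real CARD('n) - 1"
    using dim by (simp add: card_Diff_subset of_nat_diff)
  moreover have "\<Theta> = arctan (l i) + (\<Sum>j\<in>UNIV - {i}. arctan (l j))"
    using phase_sum[OF e] sum.remove[of UNIV i "\<lambda>j. arctan (l j)"] by simp
  ultimately have "arctan (l i) \<le> \<Theta> - (real CARD('n) - 1) * \<gamma>" by simp
  then show "\<bar>arctan (l i) - \<beta>\<bar> \<le> \<phi>\<^sub>0" using phase_ge[OF e, of i] unfolding \<phi>\<^sub>0_def by linarith
  show "(\<Sum>i\<in>UNIV. arctan (l i) - \<beta>) = - (real CARD('n) - 2) * pi / 2"
    using phase_sum[OF e] n_beta by (simp add: sum_subtractf algebra_simps add_divide_distrib diff_divide_distrib)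
qed

lemma spectral_H: obtains v l where "eigenbasis (H x) v l"
  using spectral_theorem[OF H_transpose] by blast

lemma c0: "0 < c\<^sub>0" "c\<^sub>0 \<le> 1"
proof -
  obtain v l where e: "eigenbasis (H undefined) v l" by (rule spectral_H)
  show "0 < c\<^sub>0" "c\<^sub>0 \<le> 1"
    using cos_pos_bounded[OF phase_bound(1)[OF e] phi0_less] by (simp_all add: c\<^sub>0_def)
qed

lemma cos_phase: "eigenbasis (H x) v l \<Longrightarrow> c\<^sub>0 \<le> cos (arctan (l i) - \<beta>)"
  unfolding c\<^sub>0_def using cos_pos_bounded[OF phase_bound(1) phi0_less] by blast

section \<open>The rotated base coordinate and its inverse\<close>

definition R :: "real ^ 'n \<Rightarrow> real ^ 'n ^ 'n" where
  "R x = cos \<beta> *\<^sub>R mat 1 + sin \<beta> *\<^sub>R H x"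

lemma R_vector: "R x *v h = cos \<beta> *\<^sub>R h + sin \<beta> *\<^sub>R (H x *v h)"
  by (simp add: R_def matrix_vector_mult_add_rdistrib scaleR_matrix_vector_assoc)

lemma R_transpose: "transpose (R x) = R x"
  using H_transpose[of x] by (simp add: R_def transpose_def mat_def vec_eq_iff)

text \<open>Rotating the vector (1, tan theta) = (cos theta, sin theta) / cos theta by - beta: its
  new base and fibre coordinates.\<close>

lemma cos_sin_arctan: "cos \<beta> + sin \<beta> * l = cos (arctan l - \<beta>) / cos (arctan l)"
  "cos \<beta> * l - sin \<beta> = sin (arctan l - \<beta>) / cos (arctan l)"
proof -
  have c: "cos (arctan l) \<noteq> 0" by simp
  have l: "l = sin (arctan l) / cos (arctan l)" using tan_arctan[of l] by (simp add: tan_def)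
  show "cos \<beta> + sin \<beta> * l = cos (arctan l - \<beta>) / cos (arctan l)"
    by (subst l) (use c in \<open>simp add: cos_diff field_simps\<close>)
  show "cos \<beta> * l - sin \<beta> = sin (arctan l - \<beta>) / cos (arctan l)"
    by (subst l) (use c in \<open>simp add: sin_diff field_simps\<close>)
qed

lemma R_eigenbasis:
  assumes "eigenbasis (H x) v l"
  shows "eigenbasis (R x) v (\<lambda>i. cos (arctan (l i) - \<beta>) / cos (arctan (l i)))"
  using assms by (simp add: eigenbasis_def R_vector cos_sin_arctan(1)[symmetric] scaleR_add_left)

text \<open>Uniform although \<open>H\<close> may be unbounded: dividing by cos (arctan l), which is
  at most 1, only enlarges the eigenvalue.\<close>

lemma R_lower: "c\<^sub>0 * (norm h)\<^sup>2 \<le> h \<bullet> (R x *v h)"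
proof -
  obtain v l where e: "eigenbasis (H x) v l" by (rule spectral_H)
  have o: "orthonormal v" using e by (simp add: eigenbasis_def)
  have "c\<^sub>0 \<le> cos (arctan (l i) - \<beta>) / cos (arctan (l i))" for i
  proof -
    have "0 < cos (arctan (l i))" "cos (arctan (l i)) \<le> 1"
      using arctan_bounded[of "l i"] by (auto intro: cos_gt_zero_pi)
    moreover have "c\<^sub>0 \<le> cos (arctan (l i) - \<beta>)" by (rule cos_phase[OF e])
    moreover have "c\<^sub>0 * cos (arctan (l i)) \<le> c\<^sub>0 * 1"
      using c0 \<open>cos (arctan (l i)) \<le> 1\<close> by (intro mult_left_mono) auto
    ultimately show ?thesis by (simp add: pos_le_divide_eq)
  qed
  then have "(\<Sum>i\<in>UNIV. c\<^sub>0 * (v i \<bullet> h)\<^sup>2) \<le> h \<bullet> (R x *v h)"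
    unfolding eigenbasis_quadratic_form[OF R_eigenbasis[OF e]] by (intro sum_mono mult_right_mono) auto
  then show ?thesis by (simp add: orthonormal_norm[OF o] sum_distrib_left)
qed

definition Q :: "real ^ 'n \<Rightarrow> real ^ 'n ^ 'n" where "Q x = matrix_inv (R x)"

lemma RQ: "R x ** Q x = mat 1" and QR: "Q x ** R x = mat 1"
proof -
  have "h = 0" if "R x *v h = 0" for h
    using R_lower[of h x] that c0 by (simp add: mult_le_0_iff)
  then have "invertible (R x)"
    by (metis invertible_left_inverse matrix_left_invertible_ker)
  then have "R x ** Q x = mat 1 \<and> Q x ** R x = mat 1"
    unfolding Q_def matrix_inv_def invertible_def by (rule someI_ex)
  then show "R x ** Q x = mat 1" "Q x ** R x = mat 1" by blast+
qed

lemma QR_vector [simp]: "Q x *v (R x *v h) = h" "R x *v (Q x *v h) = h"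
  by (simp_all add: matrix_vector_mul_assoc RQ QR)

lemma Q_transpose: "transpose (Q x) = Q x"
proof -
  have "transpose (Q x) ** R x = mat 1"
    using arg_cong[OF RQ[of x], of transpose] by (simp add: matrix_transpose_mul R_transpose transpose_mat)
  then have "transpose (Q x) ** (R x ** Q x) = Q x" by (simp add: matrix_mul_assoc)
  then show ?thesis by (simp add: RQ)
qed

lemma Q_bound: "norm (Q x *v h) \<le> (1 / c\<^sub>0) * norm h"
proof (cases "Q x *v h = 0")
  case False
  have "c\<^sub>0 * (norm (Q x *v h))\<^sup>2 \<le> (Q x *v h) \<bullet> h" using R_lower[of "Q x *v h" x] by simp
  also have "\<dots> \<le> norm (Q x *v h) * norm h" by (rule norm_cauchy_schwarz)
  finally have "norm (Q x *v h) * (c\<^sub>0 * norm (Q x *v h)) \<le> norm (Q x *v h) * norm h"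
    by (simp add: power2_eq_square mult_ac)
  then have "c\<^sub>0 * norm (Q x *v h) \<le> norm h" using False by simp
  then show ?thesis using c0 by (simp add: field_simps)
qed (use c0 in simp)

definition X :: "real ^ 'n \<Rightarrow> real ^ 'n" where "X x = cos \<beta> *\<^sub>R x + sin \<beta> *\<^sub>R g x"

lemma dX: "(X has_derivative (\<lambda>h. R x *v h)) (at x)"
  unfolding X_def[abs_def] R_vector by (intro derivative_intros dg)

text \<open>\<open>X\<close> is strongly monotone, by \<open>R_lower\<close> and the mean value
  theorem along the segment; Cauchy-Schwarz then gives expansion.\<close>

lemma X_expansive: "c\<^sub>0 * norm (x - y) \<le> norm (X x - X y)"
proof (cases "x = y")
  case False
  let ?f = "\<lambda>t. X (y + t *\<^sub>R (x - y)) \<bullet> (x - y)"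
  have d: "(?f has_real_derivative (R (y + t *\<^sub>R (x - y)) *v (x - y)) \<bullet> (x - y)) (at t)" for t
  proof -
    have "((\<lambda>t. y + t *\<^sub>R (x - y)) has_derivative (\<lambda>h. h *\<^sub>R (x - y))) (at t)"
      by (auto intro!: derivative_eq_intros)
    from has_derivative_inner_left[OF has_derivative_compose[OF this dX], of "x - y"]
    show ?thesis
      by (simp add: has_field_derivative_def matrix_vector_mult_scaleR mult_commute_abs)
  qed
  obtain z where z: "?f 1 - ?f 0 = (1 - 0) * ((R (y + z *\<^sub>R (x - y)) *v (x - y)) \<bullet> (x - y))"
    using MVT2[of 0 1 ?f "\<lambda>t. (R (y + t *\<^sub>R (x - y)) *v (x - y)) \<bullet> (x - y)"] d by auto
  have "c\<^sub>0 * (norm (x - y))\<^sup>2 \<le> (X x - X y) \<bullet> (x - y)"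
  proof -
    have "(X x - X y) \<bullet> (x - y) = (R (y + z *\<^sub>R (x - y)) *v (x - y)) \<bullet> (x - y)"
      using z unfolding inner_diff_left[of "X x"] by simp
    then show ?thesis
      using R_lower[of "x - y" "y + z *\<^sub>R (x - y)"] by (simp only: inner_commute[of "x - y"])
  qed
  also have "\<dots> \<le> norm (X x - X y) * norm (x - y)" by (rule norm_cauchy_schwarz)
  finally have "norm (x - y) * (c\<^sub>0 * norm (x - y)) \<le> norm (x - y) * norm (X x - X y)"
    by (simp add: power2_eq_square mult_ac)
  then show ?thesis using False by simp
qed simp

lemma continuous_X: "continuous_on S X"
  by (intro continuous_at_imp_continuous_on ballI has_derivative_continuous[OF dX])

lemma inj_X: "inj X"
proof (rule injI)
  fix x y assume "X x = X y"
  then have "c\<^sub>0 * norm (x - y) \<le> 0" using X_expansive[of x y] by simp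
  then show "x = y" using c0 by (simp add: mult_le_0_iff)
qed

text \<open>The range is open by invariance of domain and closed because expansion makes preimages
  of Cauchy sequences Cauchy; the space is connected. So the rotated graph is again entire.\<close>

lemma surj_X: "range X = UNIV"
proof -
  have "open (range X)"
    using invariance_of_domain[OF continuous_X open_UNIV] inj_X by simp
  moreover have "closed (range X)"
    unfolding closed_sequential_limits
  proof (intro allI impI, elim conjE)
    fix s p assume s: "\<forall>k. s k \<in> range X" "s \<longlonglongrightarrow> p"
    define q where "q k = inv X (s k)" for k
    have q: "s k = X (q k)" for k
      using s(1) by (simp add: q_def f_inv_into_f)
    have "Cauchy q"
    proof (rule metric_CauchyI)
      fix e :: real assume "0 < e"
      then have "0 < c\<^sub>0 * e" using c0 by simp
      then obtain N where N: "\<And>m k. m \<ge> N \<Longrightarrow> k \<ge> N \<Longrightarrow> dist (s m) (s k) < c\<^sub>0 * e"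
        using metric_CauchyD[OF LIMSEQ_imp_Cauchy[OF s(2)]] by blast
      have "dist (q m) (q k) < e" if "m \<ge> N" "k \<ge> N" for m k
      proof -
        have "c\<^sub>0 * dist (q m) (q k) < c\<^sub>0 * e"
          using X_expansive[of "q m" "q k"] N[OF that] by (simp add: q dist_norm)
        then show ?thesis using c0 by simp
      qed
      then show "\<exists>M. \<forall>m\<ge>M. \<forall>n\<ge>M. dist (q m) (q n) < e" by blast
    qed
    then obtain l where "q \<longlonglongrightarrow> l" using Cauchy_convergent convergent_def by blast
    then have "(\<lambda>k. X (q k)) \<longlonglongrightarrow> X l"
      using continuous_X[of UNIV] by (simp add: continuous_on_eq_continuous_at isCont_tendsto_compose)
    then have "p = X l" using s(2) LIMSEQ_unique by (simp add: q[symmetric]) blast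
    then show "p \<in> range X" by simp
  qed
  ultimately show ?thesis
    using clopen[of "range X"] by auto
qed

definition Z :: "real ^ 'n \<Rightarrow> real ^ 'n" where "Z = inv X"

lemma X_Z [simp]: "X (Z y) = y" and Z_X [simp]: "Z (X x) = x"
  using surj_X inj_X by (simp_all add: Z_def surj_f_inv_f)

definition P :: "real ^ 'n \<Rightarrow> real ^ 'n ^ 'n" where "P y = Q (Z y)"

text \<open>Expansion of \<open>X\<close> makes \<open>Z\<close> Lipschitz, and a continuous inverse
  is differentiable where the derivative is invertible.\<close>

lemma dZ: "(Z has_derivative (\<lambda>h. P y *v h)) (at y)"
proof (rule has_derivative_inverse_basic[of X "\<lambda>h. R (Z y) *v h" Z y "\<lambda>h. P y *v h" UNIV])
  show "(X has_derivative (\<lambda>h. R (Z y) *v h)) (at (Z y))" by (rule dX)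
  show "bounded_linear (\<lambda>h. P y *v h)" by (rule matrix_vector_mul_bounded_linear)
  show "(\<lambda>h. P y *v h) \<circ> (\<lambda>h. R (Z y) *v h) = id" by (auto simp: P_def)
  have "dist (Z y') (Z y) \<le> (1 / c\<^sub>0) * dist y' y" for y'
    using X_expansive[of "Z y'" "Z y"] c0 by (simp add: dist_norm field_simps)
  then have "(1 / c\<^sub>0)-lipschitz_on UNIV Z"
    using X_expansive c0 by (intro lipschitz_onI) (auto simp: dist_norm field_simps, metis X_Z mult.commute)
  then show "continuous (at y) Z"
    using lipschitz_on_continuous_on continuous_on_eq_continuous_at open_UNIV by blast
qed auto

text \<open>Directional derivative of \<open>H\<close> read in the rotated coordinate, as
  \<open>dHZ\<close> shows.\<close>

definition K :: "real ^ 'n \<Rightarrow> real ^ 'n \<Rightarrow> real ^ 'n ^ 'n" where "K y h = C (Z y) (P y *v h)"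

text \<open>Derivative of the rotated fibre coordinate cos beta g - sin beta x with respect to the
  rotated base coordinate: the Hessian of the rotated potential.\<close>

definition M :: "real ^ 'n \<Rightarrow> real ^ 'n ^ 'n" where
  "M y = (cos \<beta> *\<^sub>R H (Z y) - sin \<beta> *\<^sub>R mat 1) ** P y"

lemma P_transpose: "transpose (P y) = P y" by (simp add: P_def Q_transpose)
lemma K_transpose: "transpose (K y h) = K y h" by (simp add: K_def C_transpose)
lemma K_swap: "K y h *v (P y *v k) = K y k *v (P y *v h)" unfolding K_def by (rule C_swap)

lemma RP: "R (Z y) ** P y = mat 1" by (simp add: P_def RQ)

lemma dHZ: "((\<lambda>y. H (Z y)) has_derivative K y) (at y)"
  using has_derivative_compose[OF dZ dH] by (simp add: K_def[abs_def])

lemma dRZ: "((\<lambda>y. R (Z y)) has_derivative (\<lambda>h. sin \<beta> *\<^sub>R K y h)) (at y)"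
  unfolding R_def by (auto intro!: derivative_eq_intros dHZ)

lemma dP: "(P has_derivative (\<lambda>h. - sin \<beta> *\<^sub>R (P y ** K y h ** P y))) (at y)"
proof -
  have "norm (P y) \<le> real CARD('n) * (real CARD('n) * (1 / c\<^sub>0))" for y
    unfolding P_def by (rule norm_matrix_le) (rule Q_bound)
  from has_derivative_matrix_inverse[OF dRZ RP this]
  show ?thesis
    by (simp add: matrix_mult_linear)
qed

end

lemma linear_axis_expansion:
  fixes f :: "real ^ 'n::finite \<Rightarrow> 'b::real_vector"
  assumes "linear f"
  shows "f x = (\<Sum>i\<in>UNIV. x $ i *\<^sub>R f (axis i 1))"
proof -
  have "x = (\<Sum>i\<in>UNIV. x $ i *\<^sub>R axis i 1)"
    using basis_expansion[of x] by (simp add: scalar_mult_eq_scaleR)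
  then have "f x = f (\<Sum>i\<in>UNIV. x $ i *\<^sub>R axis i 1)" by simp
  then show ?thesis by (simp add: linear_sum[OF assms] linear_scale[OF assms])
qed

lemma sum_sum_le_diagonal:
  fixes f :: "'i::finite \<Rightarrow> 'i \<Rightarrow> real"
  assumes "\<And>i j. i \<noteq> j \<Longrightarrow> f i j \<le> 0"
  shows "(\<Sum>i\<in>UNIV. \<Sum>j\<in>UNIV. f i j) \<le> (\<Sum>i\<in>UNIV. f i i)"
proof (rule sum_mono)
  fix i
  have "(\<Sum>j\<in>UNIV - {i}. f i j) \<le> 0" using assms by (intro sum_nonpos) auto
  then show "(\<Sum>j\<in>UNIV. f i j) \<le> f i i" using sum.remove[of UNIV i "f i"] by simp
qed

section \<open>The rotated Hessian and its derivatives\<close>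

context special_lagrangian_jet
begin

text \<open>The quotient of the two identities in \<open>cos_sin_arctan\<close>: rotation subtracts
  \<open>\<beta>\<close> from every angle.\<close>

lemma M_eigenbasis:
  assumes e: "eigenbasis (H (Z y)) v l"
  shows "eigenbasis (M y) v (\<lambda>i. tan (arctan (l i) - \<beta>))"
proof -
  have "M y *v v i = tan (arctan (l i) - \<beta>) *\<^sub>R v i" for i
  proof -
    let ?r = "cos (arctan (l i) - \<beta>) / cos (arctan (l i))"
    have c: "0 < cos (arctan (l i) - \<beta>)" using cos_phase[OF e, of i] c0 by simp
    have Hv: "H (Z y) *v v i = l i *\<^sub>R v i" using e by (simp add: eigenbasis_def)
    have "R (Z y) *v v i = ?r *\<^sub>R v i" using R_eigenbasis[OF e] by (simp add: eigenbasis_def)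
    then have "v i = ?r *\<^sub>R (P y *v v i)"
      using QR_vector(1)[of "Z y" "v i"] by (simp add: P_def matrix_vector_mult_scaleR)
    then have Pv: "P y *v v i = (cos (arctan (l i)) / cos (arctan (l i) - \<beta>)) *\<^sub>R v i"
      using c by (metis (no_types, lifting) cos_arctan_not_zero divide_self_if less_irrefl scaleR_one scaleR_scaleR times_divide_times_eq mult.commute no_zero_divisors)
    have "M y *v v i = (cos \<beta> *\<^sub>R H (Z y) - sin \<beta> *\<^sub>R mat 1) *v (P y *v v i)"
      by (simp add: M_def matrix_vector_mul_assoc)
    also have "\<dots> = (cos (arctan (l i)) / cos (arctan (l i) - \<beta>)) *\<^sub>R ((cos \<beta> * l i - sin \<beta>) *\<^sub>R v i)"
      by (simp add: Pv matrix_vector_mult_linear Hv scaleR_diff_left scaleR_diff_right)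
    also have "\<dots> = tan (arctan (l i) - \<beta>) *\<^sub>R v i"
      using c by (simp add: cos_sin_arctan(2) tan_def)
    finally show ?thesis .
  qed
  then show ?thesis using e by (simp add: eigenbasis_def)
qed

lemma M_spectral:
  obtains v \<phi> where "eigenbasis (M y) v (\<lambda>i. tan (\<phi> i))" "\<And>i. \<bar>\<phi> i\<bar> \<le> \<phi>\<^sub>0"
    "(\<Sum>i\<in>UNIV. \<phi> i) = - (real CARD('n) - 2) * pi / 2"
  using spectral_H[of "Z y"] M_eigenbasis phase_bound by metis

lemma M_transpose: "transpose (M y) = M y"
  using M_spectral[of y] eigenbasis_symmetric by metis

text \<open>Derivative of \<open>M\<close> in direction h, see \<open>dM\<close>; thus the third
  derivatives of the rotated potential.\<close>

definition S :: "real ^ 'n \<Rightarrow> real ^ 'n \<Rightarrow> real ^ 'n ^ 'n" where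
  "S y h = P y ** K y h ** P y"

lemma S_transpose: "transpose (S y h) = S y h"
  by (simp add: S_def matrix_transpose_mul P_transpose K_transpose matrix_mul_assoc)

lemma S_vector: "S y h *v k = P y *v (K y h *v (P y *v k))"
  by (simp add: S_def matrix_vector_mul_assoc matrix_mul_assoc)

lemma S_swap: "S y h *v k = S y k *v h"
  by (simp add: S_vector K_swap[of y h k])

text \<open>Rotating back, x is cos beta times the base coordinate minus sin beta times the fibre
  coordinate; differentiate with respect to the base coordinate.\<close>

lemma P_eq: "P y = cos \<beta> *\<^sub>R mat 1 - sin \<beta> *\<^sub>R M y"
proof -
  have "cos \<beta> *\<^sub>R mat 1 - sin \<beta> *\<^sub>R M y
      = (cos \<beta> *\<^sub>R R (Z y) - sin \<beta> *\<^sub>R (cos \<beta> *\<^sub>R H (Z y) - sin \<beta> *\<^sub>R mat 1)) ** P y"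
    by (simp add: M_def matrix_mult_linear RP)
  also have "cos \<beta> *\<^sub>R R (Z y) - sin \<beta> *\<^sub>R (cos \<beta> *\<^sub>R H (Z y) - sin \<beta> *\<^sub>R mat 1)
      = (cos \<beta> * cos \<beta> + sin \<beta> * sin \<beta>) *\<^sub>R mat 1"
    by (simp add: R_def algebra_simps) (simp flip: scaleR_add_left)
  also have "cos \<beta> * cos \<beta> + sin \<beta> * sin \<beta> = 1"
    using sin_cos_squared_add3 by simp
  finally show ?thesis by simp
qed

text \<open>The product rule gives (cos beta - sin beta M) K P, whose first factor is
  \<open>P\<close> by \<open>P_eq\<close>.\<close>

lemma dM: "(M has_derivative S y) (at y)"
proof -
  have "((\<lambda>y. cos \<beta> *\<^sub>R H (Z y) - sin \<beta> *\<^sub>R mat 1) has_derivative (\<lambda>h. cos \<beta> *\<^sub>R K y h)) (at y)"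
    by (auto intro!: derivative_eq_intros dHZ)
  from has_derivative_matrix_mult[OF this dP]
  have "(M has_derivative (\<lambda>h. (cos \<beta> *\<^sub>R H (Z y) - sin \<beta> *\<^sub>R mat 1) ** (- sin \<beta> *\<^sub>R (P y ** K y h ** P y))
      + cos \<beta> *\<^sub>R K y h ** P y)) (at y)"
    by (simp add: M_def[abs_def])
  moreover have "(cos \<beta> *\<^sub>R H (Z y) - sin \<beta> *\<^sub>R mat 1) ** (- sin \<beta> *\<^sub>R (P y ** K y h ** P y)) + cos \<beta> *\<^sub>R K y h ** P y
      = S y h" for h
  proof -
    have "S y h = (cos \<beta> *\<^sub>R mat 1 - sin \<beta> *\<^sub>R M y) ** K y h ** P y" by (simp add: S_def P_eq[symmetric])
    also have "\<dots> = cos \<beta> *\<^sub>R K y h ** P y - sin \<beta> *\<^sub>R (M y ** K y h ** P y)"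
      by (simp add: matrix_mult_linear)
    finally show ?thesis by (simp add: M_def matrix_mult_linear matrix_mul_assoc)
  qed
  ultimately show ?thesis by simp
qed

lemma C_linear: "linear (C x)"
  using dH[of x] has_derivative_linear by blast

text \<open>Derivative of \<open>K y e\<close> in direction m: one term from the moving base point
  \<open>Z y\<close>, one from the moving direction \<open>P y *v e\<close>.\<close>

definition KK :: "real ^ 'n \<Rightarrow> real ^ 'n \<Rightarrow> real ^ 'n \<Rightarrow> real ^ 'n ^ 'n" where
  "KK y m e = W (Z y) (P y *v m) (P y *v e) + C (Z y) (- sin \<beta> *\<^sub>R (S y m *v e))"

text \<open>\<open>C\<close> can be differentiated only with its direction held fixed, so the moving
  direction is first expanded along the axes.\<close>

lemma dK: "((\<lambda>y. K y e) has_derivative (\<lambda>m. KK y m e)) (at y)"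
proof -
  have dPe: "((\<lambda>y. (P y *v e) $ i) has_derivative (\<lambda>m. (- sin \<beta> *\<^sub>R (S y m *v e)) $ i)) (at y)" for i
  proof -
    have "((\<lambda>y. P y *v e) has_derivative (\<lambda>m. - sin \<beta> *\<^sub>R (S y m *v e))) (at y)"
      using has_derivative_matrix_vector_mult[OF dP has_derivative_const, of e]
      by (simp add: S_def matrix_vector_mult_linear)
    from bounded_linear.has_derivative[OF bounded_linear_vec_nth this] show ?thesis .
  qed
  have dCZ: "((\<lambda>y. C (Z y) h) has_derivative (\<lambda>m. W (Z y) (P y *v m) h)) (at y)" for h
    by (rule has_derivative_compose[OF dZ dC])
  have "((\<lambda>y. \<Sum>i\<in>UNIV. (P y *v e) $ i *\<^sub>R C (Z y) (axis i 1)) has_derivative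
      (\<lambda>m. \<Sum>i\<in>UNIV. (P y *v e) $ i *\<^sub>R W (Z y) (P y *v m) (axis i 1)
        + (- sin \<beta> *\<^sub>R (S y m *v e)) $ i *\<^sub>R C (Z y) (axis i 1))) (at y)"
    by (intro has_derivative_sum has_derivative_scaleR dPe dCZ)
  moreover have "(\<lambda>y. \<Sum>i\<in>UNIV. (P y *v e) $ i *\<^sub>R C (Z y) (axis i 1)) = (\<lambda>y. K y e)"
    by (simp add: K_def linear_axis_expansion[OF C_linear, of _ "P _ *v e"])
  moreover have "(\<Sum>i\<in>UNIV. (P y *v e) $ i *\<^sub>R W (Z y) (P y *v m) (axis i 1)
        + (- sin \<beta> *\<^sub>R (S y m *v e)) $ i *\<^sub>R C (Z y) (axis i 1)) = KK y m e" for m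
    unfolding KK_def linear_axis_expansion[OF C_linear, of _ "- sin \<beta> *\<^sub>R (S y m *v e)"]
      linear_axis_expansion[OF W_linear, of _ _ "P y *v e"]
    by (simp only: sum.distrib)
  ultimately show ?thesis by simp
qed

lemma KK_transpose: "transpose (KK y m e) = KK y m e"
proof -
  have "transpose (A + B) = transpose A + transpose B" for A B :: "real ^ 'n ^ 'n"
    by (simp add: transpose_def vec_eq_iff)
  then show ?thesis by (simp add: KK_def C_transpose W_transpose)
qed

definition dS :: "real ^ 'n \<Rightarrow> real ^ 'n \<Rightarrow> real ^ 'n \<Rightarrow> real ^ 'n ^ 'n" where
  "dS y m e = P y ** K y e ** (- sin \<beta> *\<^sub>R S y m)
    + (P y ** KK y m e + (- sin \<beta> *\<^sub>R S y m) ** K y e) ** P y"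

lemma has_derivative_S: "((\<lambda>y. S y e) has_derivative (\<lambda>m. dS y m e)) (at y)"
  unfolding S_def[of _ e] dS_def
  by (rule has_derivative_matrix_mult[OF has_derivative_matrix_mult[OF dP[folded S_def] dK] dP[folded S_def]])

text \<open>Symmetry of the fourth derivatives of the rotated potential. It makes
  \<open>dS y e e\<close> the Hessian of \<open>w e\<close>, whereas differentiating the gradient
  \<open>S y e *v e\<close> produces \<open>dS y h e *v e\<close>. Both sides expand to the same
  terms by the symmetries of \<open>C\<close> and \<open>W\<close>.\<close>

lemma dS_swap: "dS y m e *v e = dS y e e *v m"
proof -
  let ?s = "- sin \<beta>"
  let ?p = "P y *v e" and ?q = "P y *v m"
  let ?C = "C (Z y)" and ?W = "W (Z y)"
  have Cs: "?C (c *\<^sub>R h) = c *\<^sub>R ?C h" "?C (- h) = - ?C h" for c h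
    using C_linear by (simp_all add: linear_scale linear_neg)
  have "dS y m e *v e = ?s *\<^sub>R (P y *v (K y e *v (S y m *v e)))
      + (P y *v (KK y m e *v ?p) + ?s *\<^sub>R (S y m *v (K y e *v ?p)))"
    by (simp add: dS_def matrix_vector_mult_linear matrix_vector_mul_assoc[symmetric])
  also have "S y m *v (K y e *v ?p) = P y *v (?C (P y *v (K y e *v ?p)) *v ?q)"
    by (simp add: S_vector K_def[of y m] C_swap[of "Z y" ?q])
  also have "KK y m e *v ?p = ?W ?p ?p *v ?q + ?s *\<^sub>R (K y e *v (S y m *v e))"
    by (simp add: KK_def Cs matrix_vector_mult_linear W_swap[of "Z y" ?q] K_def[of y e] C_swap[of "Z y" _ ?p])
  finally have 1: "dS y m e *v e = ?s *\<^sub>R (P y *v (K y e *v (S y e *v m)))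
      + (P y *v (?W ?p ?p *v ?q + ?s *\<^sub>R (K y e *v (S y e *v m)))
        + ?s *\<^sub>R (P y *v (?C (P y *v (K y e *v ?p)) *v ?q)))"
    by (simp only: S_swap[of y m e])
  have "dS y e e *v m = ?s *\<^sub>R (P y *v (K y e *v (S y e *v m)))
      + (P y *v (KK y e e *v ?q) + ?s *\<^sub>R (S y e *v (K y e *v ?q)))"
    by (simp add: dS_def matrix_vector_mult_linear matrix_vector_mul_assoc[symmetric])
  also have "S y e *v (K y e *v ?q) = P y *v (K y e *v (S y e *v m))"
    by (simp add: S_vector)
  also have "KK y e e *v ?q = ?W ?p ?p *v ?q + ?s *\<^sub>R (?C (P y *v (K y e *v ?p)) *v ?q)"
    by (simp add: KK_def Cs matrix_vector_mult_linear S_vector)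
  finally have 2: "dS y e e *v m = ?s *\<^sub>R (P y *v (K y e *v (S y e *v m)))
      + (P y *v (?W ?p ?p *v ?q + ?s *\<^sub>R (?C (P y *v (K y e *v ?p)) *v ?q))
        + ?s *\<^sub>R (P y *v (K y e *v (S y e *v m))))" .
  show ?thesis unfolding 1 2 by (simp add: matrix_vector_mult_linear algebra_simps)
qed

lemma dS_transpose: "transpose (dS y e e) = dS y e e"
proof -
  have t: "transpose (A + B) = transpose A + transpose B" "transpose (A - B) = transpose A - transpose B"
    "transpose (c *\<^sub>R A) = c *\<^sub>R transpose A"
    for A B :: "real ^ 'n ^ 'n" and c :: real
    by (simp_all add: transpose_def vec_eq_iff)
  show ?thesis
    by (simp add: dS_def t matrix_transpose_mul P_transpose K_transpose S_transpose KK_transpose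
        matrix_mult_linear matrix_mul_assoc algebra_simps)
qed

text \<open>The coefficients of the linearized operator: the derivative of arctan evaluated at the
  matrix \<open>M y\<close>.\<close>

definition N :: "real ^ 'n \<Rightarrow> real ^ 'n ^ 'n" where "N y = matrix_inv (mat 1 + M y ** M y)"

lemma T_lower: "(norm h)\<^sup>2 \<le> h \<bullet> ((mat 1 + M y ** M y) *v h)"
proof -
  have "h \<bullet> ((mat 1 + M y ** M y) *v h) = h \<bullet> h + (M y *v h) \<bullet> (M y *v h)"
    using symmetric_inner[OF M_transpose, of h y "M y *v h"]
    by (simp add: matrix_vector_mult_linear matrix_vector_mul_assoc[symmetric] inner_add_right)
  then show ?thesis by (simp add: power2_norm_eq_inner)
qed

lemma TN: "(mat 1 + M y ** M y) ** N y = mat 1" "N y ** (mat 1 + M y ** M y) = mat 1"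
proof -
  have "h = 0" if "(mat 1 + M y ** M y) *v h = 0" for h
    using T_lower[of h y] that by simp
  then have "invertible (mat 1 + M y ** M y)"
    by (metis invertible_left_inverse matrix_left_invertible_ker)
  then have "(mat 1 + M y ** M y) ** N y = mat 1 \<and> N y ** (mat 1 + M y ** M y) = mat 1"
    unfolding N_def matrix_inv_def invertible_def by (rule someI_ex)
  then show "(mat 1 + M y ** M y) ** N y = mat 1" "N y ** (mat 1 + M y ** M y) = mat 1" by blast+
qed

lemma N_bound: "norm (N y *v h) \<le> 1 * norm h"
proof (cases "N y *v h = 0")
  case False
  have "(norm (N y *v h))\<^sup>2 \<le> (N y *v h) \<bullet> h"
    using T_lower[of "N y *v h" y] by (simp only: matrix_vector_mul_assoc TN matrix_vector_mul_lid)
  also have "\<dots> \<le> norm (N y *v h) * norm h" by (rule norm_cauchy_schwarz)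
  finally show ?thesis using False by (simp add: power2_eq_square)
qed simp

lemma N_eigenbasis:
  assumes "eigenbasis (M y) v \<mu>"
  shows "eigenbasis (N y) v (\<lambda>i. 1 / (1 + (\<mu> i)\<^sup>2))"
proof -
  have Mv: "M y *v v i = \<mu> i *\<^sub>R v i" for i using assms by (simp add: eigenbasis_def)
  have "N y *v v i = (1 / (1 + (\<mu> i)\<^sup>2)) *\<^sub>R v i" for i
  proof -
    have pos: "0 < 1 + (\<mu> i)\<^sup>2" by (simp add: add_pos_nonneg)
    have "(mat 1 + M y ** M y) *v v i = (1 + (\<mu> i)\<^sup>2) *\<^sub>R v i"
      by (simp add: matrix_vector_mult_linear matrix_vector_mul_assoc[symmetric] Mv scaleR_add_left power2_eq_square)
    then have "N y *v ((1 + (\<mu> i)\<^sup>2) *\<^sub>R v i) = v i"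
      by (metis TN(2) matrix_vector_mul_assoc matrix_vector_mul_lid)
    then have "v i = (1 + (\<mu> i)\<^sup>2) *\<^sub>R (N y *v v i)" by (simp add: matrix_vector_mult_scaleR)
    then have "(1 / (1 + (\<mu> i)\<^sup>2)) *\<^sub>R v i = (1 / (1 + (\<mu> i)\<^sup>2)) *\<^sub>R ((1 + (\<mu> i)\<^sup>2) *\<^sub>R (N y *v v i))"
      by (rule arg_cong)
    then show ?thesis using pos by simp
  qed
  then show ?thesis using assms by (simp add: eigenbasis_def)
qed

section \<open>The linearized equation and the supersolution property\<close>

lemma arctan_tan_phase: "\<bar>\<phi>\<bar> \<le> \<phi>\<^sub>0 \<Longrightarrow> arctan (tan \<phi>) = \<phi>"
  using phi0_less by (intro arctan_tan) auto

text \<open>The phase is constant, so \<open>trace_function_taylor\<close> bounds the first-order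
  term along a line by a quadratic one. Quadratic minus linear is thus minimal at t = 0, and its
  derivative there vanishes. No eigenvalue is differentiated.\<close>

lemma linearized_equation: "trace (N y ** S y e) = 0"
proof -
  obtain v \<phi> where v: "eigenbasis (M y) v (\<lambda>i. tan (\<phi> i))" and \<phi>: "\<And>i. \<bar>\<phi> i\<bar> \<le> \<phi>\<^sub>0"
    and s: "(\<Sum>i\<in>UNIV. \<phi> i) = - (real CARD('n) - 2) * pi / 2" using M_spectral[of y] by blast
  have o: "orthonormal v" using v by (simp add: eigenbasis_def)
  define \<nu> where "\<nu> i = 1 / (1 + (tan (\<phi> i))\<^sup>2)" for i
  define A where "A t i = (M (y + t *\<^sub>R e) - M y) *v v i" for t i
  have dA: "((\<lambda>t. A t i) has_derivative (\<lambda>t. t *\<^sub>R (S y e *v v i))) (at 0)" for i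
  proof -
    have "((\<lambda>t. y + t *\<^sub>R e) has_derivative (\<lambda>t. t *\<^sub>R e)) (at 0)" by (auto intro!: derivative_eq_intros)
    from has_derivative_compose[OF this, of M "S y"] dM[of y]
    have "((\<lambda>t. M (y + t *\<^sub>R e) - M y) has_derivative (\<lambda>t. S y (t *\<^sub>R e))) (at 0)"
      by (auto intro!: derivative_eq_intros)
    moreover have "S y (t *\<^sub>R e) = t *\<^sub>R S y e" for t
      using linear_scale[OF has_derivative_linear[OF dM[of y]]] by simp
    ultimately have "((\<lambda>t. M (y + t *\<^sub>R e) - M y) has_derivative (\<lambda>t. t *\<^sub>R S y e)) (at 0)" by simp
    from has_derivative_matrix_vector_mult[OF this has_derivative_const, of "v i"]
    show ?thesis by (simp add: A_def matrix_vector_mult_linear)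
  qed
  have taylor: "\<bar>\<Sum>i\<in>UNIV. \<nu> i * (v i \<bullet> A t i)\<bar> \<le> (\<Sum>i\<in>UNIV. A t i \<bullet> A t i)" for t
  proof -
    obtain v' \<phi>' where v': "eigenbasis (M (y + t *\<^sub>R e)) v' (\<lambda>i. tan (\<phi>' i))" and \<phi>': "\<And>i. \<bar>\<phi>' i\<bar> \<le> \<phi>\<^sub>0"
      and s': "(\<Sum>i\<in>UNIV. \<phi>' i) = - (real CARD('n) - 2) * pi / 2" using M_spectral[of "y + t *\<^sub>R e"] by blast
    from trace_function_taylor[OF v v', of arctan "\<lambda>x. 1 / (1 + x\<^sup>2)" 1, OF arctan_taylor] s s'
    show ?thesis
      by (simp add: A_def \<nu>_def arctan_tan_phase \<phi> \<phi>' power2_norm_eq_inner)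
  qed
  let ?h = "\<lambda>t. (\<Sum>i\<in>UNIV. A t i \<bullet> A t i) - (\<Sum>i\<in>UNIV. \<nu> i * (v i \<bullet> A t i))"
  have A0: "A 0 i = 0" for i by (simp add: A_def)
  have "(?h has_derivative (\<lambda>t. (\<Sum>i\<in>UNIV. A 0 i \<bullet> (t *\<^sub>R (S y e *v v i)) + (t *\<^sub>R (S y e *v v i)) \<bullet> A 0 i)
      - (\<Sum>i\<in>UNIV. \<nu> i * (v i \<bullet> (t *\<^sub>R (S y e *v v i)))))) (at 0)"
    by (intro has_derivative_diff has_derivative_sum has_derivative_inner has_derivative_mult_right
        has_derivative_inner_right dA)
  then have "(?h has_derivative (\<lambda>t. (- (\<Sum>i\<in>UNIV. \<nu> i * (v i \<bullet> (S y e *v v i)))) * t)) (at 0)"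
    by (rule has_derivative_eq_rhs) (simp add: A0 fun_eq_iff sum_distrib_left mult_ac)
  then have "DERIV ?h 0 :> - (\<Sum>i\<in>UNIV. \<nu> i * (v i \<bullet> (S y e *v v i)))"
    by (simp only: has_field_derivative_def)
  then have "- (\<Sum>i\<in>UNIV. \<nu> i * (v i \<bullet> (S y e *v v i))) = 0"
  proof (rule DERIV_local_min[OF _ zero_less_one], intro allI impI)
    fix t :: real
    have "(\<Sum>i\<in>UNIV. \<nu> i * (v i \<bullet> A t i)) \<le> (\<Sum>i\<in>UNIV. A t i \<bullet> A t i)" using taylor[of t] by (simp add: abs_le_iff)
    then show "?h 0 \<le> ?h t" by (simp add: A0)
  qed
  moreover have "trace (N y ** S y e) = (\<Sum>i\<in>UNIV. \<nu> i * (v i \<bullet> (S y e *v v i)))"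
    unfolding orthonormal_trace[OF o, symmetric]
    by (simp add: matrix_vector_mul_assoc[symmetric] eigenbasis_transpose[OF N_eigenbasis[OF v]] \<nu>_def)
  ultimately show ?thesis by simp
qed

text \<open>Differentiates \<open>linearized_equation\<close> once more, using the derivative of the
  inverse matrix for \<open>N\<close>.\<close>

lemma trace_N_dS: "trace (N y ** dS y e e) = trace (N y ** (M y ** S y e + S y e ** M y) ** N y ** S y e)"
proof -
  have dT: "((\<lambda>y. mat 1 + M y ** M y) has_derivative (\<lambda>h. M y ** S y h + S y h ** M y)) (at y)"
    by (auto intro!: derivative_eq_intros has_derivative_matrix_mult dM)
  have "norm (N y) \<le> real CARD('n) * (real CARD('n) * 1)" for y
    by (rule norm_matrix_le) (rule N_bound)
  from has_derivative_matrix_inverse[OF dT TN(1) this]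
  have dN: "(N has_derivative (\<lambda>h. - (N y ** (M y ** S y h + S y h ** M y) ** N y))) (at y)" .
  have "bounded_linear (trace :: real ^ 'n ^ 'n \<Rightarrow> real)"
    by (rule linear_conv_bounded_linear[THEN iffD1])
      (auto intro!: linearI simp: trace_def sum_distrib_left sum.distrib)
  from bounded_linear.has_derivative[OF this has_derivative_matrix_mult[OF dN has_derivative_S]]
  have d1: "((\<lambda>y. trace (N y ** S y e)) has_derivative
      (\<lambda>h. trace (N y ** dS y h e + - (N y ** (M y ** S y h + S y h ** M y) ** N y) ** S y e))) (at y)" .
  have d2: "((\<lambda>y. trace (N y ** S y e)) has_derivative (\<lambda>h. 0)) (at y)"
    by (simp add: linearized_equation)
  have "trace (N y ** dS y e e + - (N y ** (M y ** S y e + S y e ** M y) ** N y) ** S y e) = 0"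
    by (rule fun_cong[OF has_derivative_unique[OF d1 d2]])
  then show ?thesis
    by (simp only: matrix_mult_linear(7) add_uminus_conv_diff trace_sub right_minus_eq)
qed

text \<open>In an eigenframe the trace becomes the sum of nu_i nu_j (mu_i + mu_j) a_ij^2. Off the
  diagonal each term is nonpositive by \<open>critical_phase_pair\<close>. The diagonal is handled
  by \<open>critical_phase_diagonal\<close> with the values nu_i a_ii, which sum to zero by
  \<open>linearized_equation\<close>.\<close>

lemma curvature_term:
  assumes v: "eigenbasis (M y) v (\<lambda>i. tan (\<phi> i))" and \<phi>: "\<And>i. \<bar>\<phi> i\<bar> \<le> \<phi>\<^sub>0"
    and crit: "(\<Sum>i\<in>UNIV. \<phi> i) = - (real CARD('n) - 2) * pi / 2"
  shows "(\<Sum>i\<in>UNIV. 1 / (1 + (tan (\<phi> i))\<^sup>2) * (v i \<bullet> (dS y e e *v v i))) \<le> 0"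
proof -
  have o: "orthonormal v" using v by (simp add: eigenbasis_def)
  have \<phi>': "\<bar>\<phi> i\<bar> < pi / 2" for i using \<phi>[of i] phi0_less by simp
  define \<nu> where "\<nu> i = 1 / (1 + (tan (\<phi> i))\<^sup>2)" for i
  define \<mu> where "\<mu> i = tan (\<phi> i)" for i
  have vM: "v i \<bullet> (M y *v x) = \<mu> i * (v i \<bullet> x)" and vN: "v i \<bullet> (N y *v x) = \<nu> i * (v i \<bullet> x)" for i x
    using eigenbasis_transpose[OF v] eigenbasis_transpose[OF N_eigenbasis[OF v]] by (simp_all add: \<mu>_def \<nu>_def)
  define a where "a i j = v j \<bullet> (S y e *v v i)" for i j
  have vS: "v i \<bullet> (S y e *v x) = (\<Sum>j\<in>UNIV. a i j * (v j \<bullet> x))" for i x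
    using orthonormal_parseval[OF o, of "S y e *v v i" x] symmetric_inner[OF S_transpose, of "v i" y e x]
    by (simp add: a_def)
  have tr: "trace (N y ** B) = (\<Sum>i\<in>UNIV. \<nu> i * (v i \<bullet> (B *v v i)))" for B
    unfolding orthonormal_trace[OF o, symmetric] by (simp add: matrix_vector_mul_assoc[symmetric] vN)
  have "(\<Sum>i\<in>UNIV. \<nu> i * (v i \<bullet> (dS y e e *v v i)))
      = (\<Sum>i\<in>UNIV. \<nu> i * (v i \<bullet> (((M y ** S y e + S y e ** M y) ** N y ** S y e) *v v i)))"
    using trace_N_dS[of y e] unfolding tr[symmetric] by (simp add: matrix_mul_assoc)
  also have "\<dots> = (\<Sum>i\<in>UNIV. \<Sum>j\<in>UNIV. \<nu> i * \<nu> j * (\<mu> i + \<mu> j) * (a i j)\<^sup>2)"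
  proof (rule sum.cong[OF refl])
    fix i
    have "v i \<bullet> (((M y ** S y e + S y e ** M y) ** N y ** S y e) *v v i)
        = \<mu> i * (\<Sum>j\<in>UNIV. a i j * (\<nu> j * a i j)) + (\<Sum>j\<in>UNIV. a i j * (\<mu> j * (\<nu> j * a i j)))"
    proof -
      define b where "b = S y e *v v i"
      have "v i \<bullet> (((M y ** S y e + S y e ** M y) ** N y ** S y e) *v v i)
          = v i \<bullet> (M y *v (S y e *v (N y *v b))) + v i \<bullet> (S y e *v (M y *v (N y *v b)))"
        by (simp add: matrix_vector_mul_assoc[symmetric] matrix_vector_mult_linear inner_add_right b_def)
      moreover have "v j \<bullet> b = a i j" for j by (simp add: b_def a_def)
      ultimately show ?thesis by (simp add: vM vS vN)
    qed
    then show "\<nu> i * (v i \<bullet> (((M y ** S y e + S y e ** M y) ** N y ** S y e) *v v i))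
        = (\<Sum>j\<in>UNIV. \<nu> i * \<nu> j * (\<mu> i + \<mu> j) * (a i j)\<^sup>2)"
      by (simp add: sum_distrib_left distrib_left sum.distrib[symmetric] power2_eq_square algebra_simps)
  qed
  also have "\<dots> \<le> (\<Sum>i\<in>UNIV. \<nu> i * \<nu> i * (\<mu> i + \<mu> i) * (a i i)\<^sup>2)"
  proof (rule sum_sum_le_diagonal)
    fix i j :: 'n assume "i \<noteq> j"
    then have "\<phi> i + \<phi> j \<le> 0" by (rule critical_phase_pair[OF \<phi>' crit])
    then have "\<phi> i \<le> - \<phi> j" by linarith
    then have "tan (\<phi> i) \<le> tan (- \<phi> j)"
      using \<phi>'[of i] \<phi>'[of j] by (intro tan_mono_le) auto
    then have "\<mu> i + \<mu> j \<le> 0" by (simp add: \<mu>_def)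
    moreover have "0 \<le> \<nu> i" "0 \<le> \<nu> j" by (simp_all add: \<nu>_def add_nonneg_nonneg)
    ultimately show "\<nu> i * \<nu> j * (\<mu> i + \<mu> j) * (a i j)\<^sup>2 \<le> 0"
      by (intro mult_nonpos_nonneg mult_nonneg_nonpos mult_nonneg_nonneg) auto
  qed
  also have "\<dots> = 2 * (\<Sum>i\<in>UNIV. tan (\<phi> i) * (\<nu> i * a i i)\<^sup>2)"
    by (simp add: sum_distrib_left \<mu>_def power2_eq_square algebra_simps)
  also have "\<dots> \<le> 0"
  proof -
    have "(\<Sum>i\<in>UNIV. \<nu> i * a i i) = 0"
      using linearized_equation[of y e] by (simp add: tr a_def)
    from critical_phase_diagonal[OF \<phi>' crit this] show ?thesis by simp
  qed
  finally show ?thesis by (simp add: \<nu>_def)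
qed

definition w :: "real ^ 'n \<Rightarrow> real ^ 'n \<Rightarrow> real" where "w e y = e \<bullet> (M y *v e)"

text \<open>The weights are 1 / (1 + tan^2) = cos^2 of the rotated angles, hence at least
  \<open>c\<^sub>0\<^sup>2\<close>. The swap laws identify the gradient and the Hessian.\<close>

lemma supersolution_w:
  assumes m: "\<And>y. m \<le> w e y"
  shows "supersolution (c\<^sub>0\<^sup>2) (\<lambda>y. w e y - m) (\<lambda>y. S y e *v e) (\<lambda>y. dS y e e)"
proof
  show "0 < c\<^sub>0\<^sup>2" "c\<^sub>0\<^sup>2 \<le> 1" using c0 by (auto simp: power_le_one)
  fix y
  show "0 \<le> w e y - m" using m by simp
  have "((\<lambda>y. e \<bullet> (M y *v e)) has_derivative (\<lambda>h. e \<bullet> (S y h *v e))) (at y)"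
    using has_derivative_inner_right[OF has_derivative_matrix_vector_mult[OF dM[of y] has_derivative_const[of e]], of e]
    by simp
  from has_derivative_diff[OF this has_derivative_const[of m]]
  have "((\<lambda>y. w e y - m) has_derivative (\<lambda>h. e \<bullet> (S y h *v e))) (at y)"
    by (simp add: w_def)
  moreover have "e \<bullet> (S y h *v e) = (S y e *v e) \<bullet> h" for h
    using symmetric_inner[OF S_transpose, of e y e h] by (simp add: S_swap[of y h e])
  ultimately show "((\<lambda>y. w e y - m) has_derivative (\<lambda>h. (S y e *v e) \<bullet> h)) (at y)" by simp
  have "(\<lambda>h. dS y h e *v e) = (\<lambda>h. dS y e e *v h)" by (rule ext) (rule dS_swap)
  then show "((\<lambda>y. S y e *v e) has_derivative (\<lambda>h. dS y e e *v h)) (at y)"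
    using has_derivative_matrix_vector_mult[OF has_derivative_S[of e y] has_derivative_const[of e]]
    by simp
  show "transpose (dS y e e) = dS y e e" by (rule dS_transpose)
  obtain v \<phi> where v: "eigenbasis (M y) v (\<lambda>i. tan (\<phi> i))" and \<phi>: "\<And>i. \<bar>\<phi> i\<bar> \<le> \<phi>\<^sub>0"
    and crit: "(\<Sum>i\<in>UNIV. \<phi> i) = - (real CARD('n) - 2) * pi / 2" using M_spectral[of y] by blast
  have "c\<^sub>0\<^sup>2 \<le> 1 / (1 + (tan (\<phi> i))\<^sup>2)" for i
  proof -
    have c: "0 < c\<^sub>0" "c\<^sub>0 \<le> cos (\<phi> i)" using cos_pos_bounded[OF \<phi> phi0_less] by (auto simp: c\<^sub>0_def)
    then have "c\<^sub>0\<^sup>2 \<le> (cos (\<phi> i))\<^sup>2" by (intro power_mono) auto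
    also have "\<dots> = 1 / (1 + (tan (\<phi> i))\<^sup>2)"
      using c tan_sec[of "\<phi> i"] by (simp add: power_inverse inverse_eq_divide power_one_over)
    finally show ?thesis .
  qed
  moreover have "1 / (1 + (tan (\<phi> i))\<^sup>2) \<le> 1" for i by (simp add: add_pos_nonneg)
  ultimately show "\<exists>v \<nu>. orthonormal v \<and> (\<forall>i. c\<^sub>0\<^sup>2 \<le> \<nu> i \<and> \<nu> i \<le> 1)
      \<and> (\<Sum>i\<in>UNIV. \<nu> i * (v i \<bullet> (dS y e e *v v i))) \<le> 0"
    using curvature_term[OF v \<phi> crit, of e] v
    by (intro exI[of _ v] exI[of _ "\<lambda>i. 1 / (1 + (tan (\<phi> i))\<^sup>2)"] conjI) (auto simp: eigenbasis_def)
qed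

end

section \<open>Quantitative monotonicity of the phase\<close>

lemma quadratic_error_has_derivative:
  fixes f :: "real \<Rightarrow> real"
  assumes "\<And>s. \<bar>f s - f t - (s - t) * D\<bar> \<le> c * (s - t)\<^sup>2"
  shows "(f has_real_derivative D) (at t)"
  unfolding has_field_derivative_iff
proof (rule LIM_zero_cancel, rule Lim_null_comparison)
  show "\<forall>\<^sub>F s in at t. norm ((f s - f t) / (s - t) - D) \<le> c * \<bar>s - t\<bar>"
  proof (rule eventually_at_filter[THEN iffD2], rule always_eventually, intro allI impI)
    fix s assume s: "s \<noteq> t"
    have "(f s - f t) / (s - t) - D = (f s - f t - (s - t) * D) / (s - t)"
      using s by (simp add: field_simps)
    then have "norm ((f s - f t) / (s - t) - D) = \<bar>f s - f t - (s - t) * D\<bar> / \<bar>s - t\<bar>" by simp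
    also have "\<dots> \<le> c * (s - t)\<^sup>2 / \<bar>s - t\<bar>" by (intro divide_right_mono assms) simp
    also have "\<dots> = c * \<bar>s - t\<bar>" using s by (simp add: power2_eq_square abs_if field_simps)
    finally show "norm ((f s - f t) / (s - t) - D) \<le> c * \<bar>s - t\<bar>" .
  qed
  have "((\<lambda>s. c * \<bar>s - t\<bar>) \<longlongrightarrow> c * \<bar>t - t\<bar>) (at t)" by (intro tendsto_intros)
  then show "((\<lambda>s. c * \<bar>s - t\<bar>) \<longlongrightarrow> 0) (at t)" by simp
qed

text \<open>The Taylor estimate between \<open>A\<close> and itself: all increments vanish.\<close>

lemma eigenbasis_sum_arctan_unique:
  assumes "eigenbasis A v l" "eigenbasis A w m"
  shows "(\<Sum>i\<in>UNIV. arctan (l i)) = (\<Sum>i\<in>UNIV. arctan (m i))"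
  using trace_function_taylor[OF assms arctan_taylor] by simp

lemma eigenvalue_bound:
  fixes A :: "real ^ 'n ^ 'n::finite"
  assumes "eigenbasis A v l" "\<And>h. norm (A *v h) \<le> L * norm h"
  shows "\<bar>l i\<bar> \<le> L"
  using assms(1) assms(2)[of "v i"] norm_orthonormal[of v i] by (simp add: eigenbasis_def)

text \<open>Along the segment from A to B the phase has derivative equal to the weighted trace of B
  - A, with weights at least 1 / (1 + L^2). The eigenbases are picked independently for each t; the
  quadratic error alone makes the phase differentiable.\<close>

lemma trace_le_arctan_increment:
  fixes A B :: "real ^ 'n ^ 'n::finite"
  assumes sym: "transpose A = A" "transpose B = B" and psd: "\<And>h. 0 \<le> h \<bullet> ((B - A) *v h)"
    and bound: "\<And>h. norm (A *v h) \<le> L * norm h" "\<And>h. norm (B *v h) \<le> L * norm h"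
    and eA: "eigenbasis A v a" and eB: "eigenbasis B w b"
  shows "trace (B - A) / (1 + L\<^sup>2) \<le> (\<Sum>i\<in>UNIV. arctan (b i)) - (\<Sum>i\<in>UNIV. arctan (a i))"
proof -
  define G where "G t = A + t *\<^sub>R (B - A)" for t
  have "\<exists>v l. eigenbasis (G t) v l" for t
    using sym by (intro spectral_theorem) (simp add: G_def transpose_def vec_eq_iff)
  then obtain V l where e: "\<And>t. eigenbasis (G t) (V t) (l t)" by metis
  have o: "orthonormal (V t)" for t using e by (simp add: eigenbasis_def)
  define f where "f t = (\<Sum>i\<in>UNIV. arctan (l t i))" for t
  define D where "D t = (\<Sum>i\<in>UNIV. 1 / (1 + (l t i)\<^sup>2) * (V t i \<bullet> ((B - A) *v V t i)))" for t
  have der: "(f has_real_derivative D t) (at t)" for t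
  proof (rule quadratic_error_has_derivative)
    fix s
    have G: "(G s - G t) *v h = (s - t) *\<^sub>R ((B - A) *v h)" for h
    proof -
      have "G s - G t = (s - t) *\<^sub>R (B - A)" by (simp add: G_def scaleR_diff_left)
      then show ?thesis by (simp only: matrix_vector_mult_linear)
    qed
    have "(\<Sum>i\<in>UNIV. 1 / (1 + (l t i)\<^sup>2) * (V t i \<bullet> ((G s - G t) *v V t i))) = (s - t) * D t"
      unfolding G by (simp add: D_def sum_distrib_left mult_ac)
    moreover have "(\<Sum>i\<in>UNIV. (norm ((G s - G t) *v V t i))\<^sup>2)
        = (\<Sum>i\<in>UNIV. (norm ((B - A) *v V t i))\<^sup>2) * (s - t)\<^sup>2"
      unfolding G by (simp add: power_mult_distrib sum_distrib_left mult_ac)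
    ultimately show "\<bar>f s - f t - (s - t) * D t\<bar> \<le> (\<Sum>i\<in>UNIV. (norm ((B - A) *v V t i))\<^sup>2) * (s - t)\<^sup>2"
      using trace_function_taylor[OF e[of t] e[of s] arctan_taylor] by (simp add: f_def)
  qed
  obtain t where t: "0 < t" "t < 1" "f 1 - f 0 = (1 - 0) * D t"
    using MVT2[of 0 1 f D] der by auto
  have Gb: "norm (G t *v h) \<le> L * norm h" for h
  proof -
    have "G t *v h = (1 - t) *\<^sub>R (A *v h) + t *\<^sub>R (B *v h)"
      by (simp add: G_def matrix_vector_mult_linear algebra_simps)
    then have "norm (G t *v h) \<le> norm ((1 - t) *\<^sub>R (A *v h)) + norm (t *\<^sub>R (B *v h))"
      by (simp only: norm_triangle_ineq)
    also have "\<dots> \<le> (1 - t) * (L * norm h) + t * (L * norm h)"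
      using t bound[of h] by (intro add_mono) (auto intro: mult_left_mono)
    also have "\<dots> = L * norm h" by (simp add: algebra_simps)
    finally show ?thesis .
  qed
  have "trace (B - A) / (1 + L\<^sup>2) = (\<Sum>i\<in>UNIV. 1 / (1 + L\<^sup>2) * (V t i \<bullet> ((B - A) *v V t i)))"
    unfolding orthonormal_trace[OF o[of t], symmetric] by (simp add: sum_divide_distrib)
  also have "\<dots> \<le> D t"
    unfolding D_def
  proof (intro sum_mono mult_right_mono psd)
    fix i
    have "\<bar>l t i\<bar> \<le> L" by (rule eigenvalue_bound[OF e Gb])
    then have "(l t i)\<^sup>2 \<le> L\<^sup>2" by (rule abs_le_square_iff[THEN iffD1, OF order_trans]) simp
    then show "1 / (1 + L\<^sup>2) \<le> 1 / (1 + (l t i)\<^sup>2)"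
      by (intro divide_left_mono mult_pos_pos add_pos_nonneg) auto
  qed
  also have "D t = f 1 - f 0" using t by simp
  also have "f 1 = (\<Sum>i\<in>UNIV. arctan (b i))"
    unfolding f_def by (rule eigenbasis_sum_arctan_unique[OF _ eB]) (use e[of 1] in \<open>simp add: G_def\<close>)
  also have "f 0 = (\<Sum>i\<in>UNIV. arctan (a i))"
    unfolding f_def by (rule eigenbasis_sum_arctan_unique[OF _ eA]) (use e[of 0] in \<open>simp add: G_def\<close>)
  finally show ?thesis .
qed

lemma psd_quadratic_le_trace:
  fixes F :: "real ^ 'n ^ 'n::finite"
  assumes "transpose F = F" and psd: "\<And>h. 0 \<le> h \<bullet> (F *v h)" and u: "norm u = 1"
  shows "u \<bullet> (F *v u) \<le> trace F"
proof -
  obtain v l where e: "eigenbasis F v l" using spectral_theorem[OF assms(1)] by blast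
  have o: "orthonormal v" and ev: "\<And>i. F *v v i = l i *\<^sub>R v i" using e by (auto simp: eigenbasis_def)
  have l: "v i \<bullet> (F *v v i) = l i" for i by (simp add: ev orthonormalD[OF o])
  have l0: "0 \<le> l i" for i using psd[of "v i"] l by simp
  have "(v i \<bullet> u)\<^sup>2 \<le> 1" for i
    using Cauchy_Schwarz_ineq2[of "v i" u] u norm_orthonormal[OF o, of i] by (simp add: abs_square_le_1)
  then have "u \<bullet> (F *v u) \<le> (\<Sum>i\<in>UNIV. l i)"
    unfolding eigenbasis_quadratic_form[OF e]
    using l0 mult_left_mono[of "(v _ \<bullet> u)\<^sup>2" 1 "l _"] by (intro sum_mono) simp
  also have "\<dots> = trace F" by (simp add: orthonormal_trace[OF o, symmetric] l)
  finally show ?thesis .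
qed

lemma symmetric_eq_0_if_quadratic_form_0:
  fixes F :: "real ^ 'n ^ 'n::finite"
  assumes "transpose F = F" and q: "\<And>u. norm u = 1 \<Longrightarrow> u \<bullet> (F *v u) = 0"
  shows "F = 0"
proof -
  obtain v l where e: "eigenbasis F v l" using spectral_theorem[OF assms(1)] by blast
  have o: "orthonormal v" and ev: "\<And>i. F *v v i = l i *\<^sub>R v i" using e by (auto simp: eigenbasis_def)
  have "l i = 0" for i using q[OF norm_orthonormal[OF o, of i]] by (simp add: ev orthonormalD[OF o])
  then have "F *v x = 0" for x
    unfolding orthonormal_eq_iff[OF o] by (simp add: eigenbasis_transpose[OF e])
  then show ?thesis by (simp add: matrix_eq)
qed

section \<open>Constancy of the rotated Hessian\<close>

context special_lagrangian_jet
begin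

lemma tan_phi0: "0 \<le> tan \<phi>\<^sub>0" and tan_phase_bound: "\<bar>\<phi>\<bar> \<le> \<phi>\<^sub>0 \<Longrightarrow> \<bar>tan \<phi>\<bar> \<le> tan \<phi>\<^sub>0"
proof -
  have b: "\<bar>tan \<phi>\<bar> \<le> tan \<phi>\<^sub>0" if "\<bar>\<phi>\<bar> \<le> \<phi>\<^sub>0" for \<phi>
  proof -
    have "tan \<phi> \<le> tan \<phi>\<^sub>0" "tan (- \<phi>) \<le> tan \<phi>\<^sub>0"
      using that phi0_less by (auto intro!: tan_mono_le simp del: tan_minus)
    then show ?thesis by (simp add: abs_le_iff)
  qed
  then show "\<bar>\<phi>\<bar> \<le> \<phi>\<^sub>0 \<Longrightarrow> \<bar>tan \<phi>\<bar> \<le> tan \<phi>\<^sub>0" .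
  obtain v :: "'n \<Rightarrow> real ^ 'n" and \<phi> :: "'n \<Rightarrow> real" where "\<And>i. \<bar>\<phi> i\<bar> \<le> \<phi>\<^sub>0"
    using M_spectral[of undefined] by blast
  from order_trans[OF abs_ge_zero this] have "0 \<le> \<phi>\<^sub>0" .
  then show "0 \<le> tan \<phi>\<^sub>0" using b[of 0] by simp
qed

lemma M_bound: "norm (M y *v h) \<le> tan \<phi>\<^sub>0 * norm h"
proof (rule power2_le_imp_le)
  obtain v \<phi> where v: "eigenbasis (M y) v (\<lambda>i. tan (\<phi> i))" and \<phi>: "\<And>i. \<bar>\<phi> i\<bar> \<le> \<phi>\<^sub>0"
    using M_spectral[of y] by blast
  have o: "orthonormal v" using v by (simp add: eigenbasis_def)
  have "(norm (M y *v h))\<^sup>2 = (\<Sum>i\<in>UNIV. (tan (\<phi> i))\<^sup>2 * (v i \<bullet> h)\<^sup>2)"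
    by (simp add: orthonormal_norm[OF o] eigenbasis_transpose[OF v] power_mult_distrib)
  also have "\<dots> \<le> (\<Sum>i\<in>UNIV. (tan \<phi>\<^sub>0)\<^sup>2 * (v i \<bullet> h)\<^sup>2)"
    using tan_phase_bound[OF \<phi>] tan_phi0 by (intro sum_mono mult_right_mono) (auto simp: abs_le_square_iff[symmetric])
  also have "\<dots> = (tan \<phi>\<^sub>0 * norm h)\<^sup>2"
    by (simp add: orthonormal_norm[OF o, of h] power_mult_distrib sum_distrib_left)
  finally show "(norm (M y *v h))\<^sup>2 \<le> (tan \<phi>\<^sub>0 * norm h)\<^sup>2" .
qed (use tan_phi0 in simp)

lemma w_bounds: "\<bar>w e y\<bar> \<le> tan \<phi>\<^sub>0 * (norm e)\<^sup>2"
proof -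
  have "\<bar>w e y\<bar> \<le> norm e * norm (M y *v e)" unfolding w_def by (rule Cauchy_Schwarz_ineq2)
  also have "\<dots> \<le> norm e * (tan \<phi>\<^sub>0 * norm e)" by (intro mult_left_mono M_bound) simp
  finally show ?thesis by (simp add: power2_eq_square mult_ac)
qed

lemma common_near_minimum:
  assumes F: "finite F" and \<epsilon>: "0 < \<epsilon>"
  shows "\<exists>x. \<forall>e\<in>F. \<forall>z. w e x \<le> w e z + \<epsilon>"
proof -
  define m where "m e = Inf (range (w e))" for e
  have bdd: "bdd_below (range (w e))" for e
    using w_bounds[of e] by (intro bdd_belowI[of _ "- (tan \<phi>\<^sub>0 * (norm e)\<^sup>2)"]) (auto simp: abs_le_iff minus_le_iff)
  have m: "m e \<le> w e y" for e y unfolding m_def by (rule cInf_lower[OF _ bdd]) simp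
  have "\<exists>x. \<forall>e\<in>F. w e x - m e \<le> \<epsilon>"
  proof (rule common_near_infimum[OF F _ _ \<epsilon>])
    show "\<exists>D E. supersolution (c\<^sub>0\<^sup>2) (\<lambda>y. w e y - m e) D E" for e
      using supersolution_w[OF m] by blast
    show "\<exists>x. w e x - m e \<le> \<eta>" if "0 < \<eta>" for e \<eta>
    proof -
      have "Inf (range (w e)) < m e + \<eta>" using that by (simp add: m_def)
      then obtain y where "w e y < m e + \<eta>" using cInf_lessD[of "range (w e)" "m e + \<eta>"] by auto
      then show ?thesis by (intro exI[of _ y]) simp
    qed
  qed
  then obtain x where x: "\<And>e. e \<in> F \<Longrightarrow> w e x - m e \<le> \<epsilon>" by blast
  have "w e x \<le> w e z + \<epsilon>" if "e \<in> F" for e z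
    using x[OF that] m[of e z] by linarith
  then show ?thesis by blast
qed

lemma uniform_near_minimum:
  assumes \<epsilon>: "0 < \<epsilon>"
  shows "\<exists>x. \<forall>u z. norm u = 1 \<longrightarrow> w u x \<le> w u z + \<epsilon>"
proof -
  let ?T = "tan \<phi>\<^sub>0"
  \<comment> \<open>Replacing u by a net point costs at most 2 tan \<open>\<phi>\<^sub>0\<close>
    times delta at each of x and z. Together this is at most epsilon / 2; the other half is spent at
    the net point.\<close>
  define \<delta> where "\<delta> = \<epsilon> / (8 * (?T + 1))"
  have \<delta>: "0 < \<delta>" "4 * ?T * \<delta> \<le> \<epsilon> / 2"
    using \<epsilon> tan_phi0 by (auto simp: \<delta>_def field_simps)
  obtain F where F: "finite F" "F \<subseteq> sphere 0 1" "sphere (0 :: real ^ 'n) 1 \<subseteq> (\<Union>e\<in>F. ball e \<delta>)"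
    by (rule compactE_image[of "sphere (0 :: real ^ 'n) 1" "sphere 0 1" "\<lambda>e. ball e \<delta>"]) (use \<delta>(1) in auto)
  have close: "\<bar>w u y - w e y\<bar> \<le> 2 * ?T * \<delta>" if "norm u = 1" "norm e = 1" "dist e u < \<delta>" for u e y
  proof -
    have "w u y - w e y = (u - e) \<bullet> (M y *v u) + e \<bullet> (M y *v (u - e))"
      by (simp add: w_def inner_diff_left matrix_vector_mult_linear inner_diff_right)
    also have "\<bar>\<dots>\<bar> \<le> norm (u - e) * norm (M y *v u) + norm e * norm (M y *v (u - e))"
      by (intro order_trans[OF abs_triangle_ineq] add_mono Cauchy_Schwarz_ineq2)
    also have "\<dots> \<le> norm (u - e) * (?T * norm u) + norm e * (?T * norm (u - e))"
      by (intro add_mono mult_left_mono M_bound) auto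
    also have "\<dots> = 2 * ?T * norm (u - e)" using that by simp
    also have "\<dots> \<le> 2 * ?T * \<delta>"
      using that tan_phi0 by (intro mult_left_mono) (auto simp: dist_norm norm_minus_commute)
    finally show ?thesis .
  qed
  obtain x where x: "\<And>e z. e \<in> F \<Longrightarrow> w e x \<le> w e z + \<epsilon> / 2"
    using common_near_minimum[OF F(1), of "\<epsilon> / 2"] \<epsilon> by auto
  have "w u x \<le> w u z + \<epsilon>" if u: "norm u = 1" for u z
  proof -
    have "u \<in> sphere 0 1" using u by simp
    then obtain e where e: "e \<in> F" "dist e u < \<delta>" using F(3) by auto
    have ne: "norm e = 1" using e(1) F(2) by auto
    show ?thesis
      using close[OF u ne e(2), of x] close[OF u ne e(2), of z] x[OF e(1), of z] \<delta>(2) by linarith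
  qed
  then show ?thesis by blast
qed

text \<open>Near minimality says that B = M z + eps dominates M x. Since M x and M z have the same
  phase and arctan is 1-Lipschitz, the phases of B and M x differ by at most n eps, and
  \<open>trace_le_arctan_increment\<close> bounds the trace of B - M x. The 1 in \<open>L\<close>
  leaves room for eps in the bound on B.\<close>

lemma w_oscillation:
  assumes \<epsilon>: "0 < \<epsilon>" "\<epsilon> \<le> 1" and u: "norm u = 1"
  defines "L \<equiv> tan \<phi>\<^sub>0 + 1"
  shows "\<bar>w u z - w u z'\<bar> \<le> (1 + L\<^sup>2) * (real CARD('n) * \<epsilon>)"
proof -
  obtain x where x: "\<And>u z. norm u = 1 \<Longrightarrow> w u x \<le> w u z + \<epsilon>"
    using uniform_near_minimum[OF \<epsilon>(1)] by blast
  have key: "0 \<le> w u z - w u x + \<epsilon> \<and> w u z - w u x + \<epsilon> \<le> (1 + L\<^sup>2) * (real CARD('n) * \<epsilon>)" for z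
  proof -
    define B where "B = M z + \<epsilon> *\<^sub>R mat 1"
    have Bv: "B *v h = M z *v h + \<epsilon> *\<^sub>R h" for h by (simp add: B_def matrix_vector_mult_linear)
    have symB: "transpose B = B"
      using M_transpose[of z] by (simp add: B_def transpose_def mat_def vec_eq_iff)
    have q: "h \<bullet> ((B - M x) *v h) = w h z - w h x + \<epsilon> * (norm h)\<^sup>2" for h
      by (simp add: w_def matrix_vector_mult_linear Bv inner_add_right inner_diff_right power2_norm_eq_inner)
    have psd: "0 \<le> h \<bullet> ((B - M x) *v h)" for h
    proof (cases "h = 0")
      case False
      define k where "k = h /\<^sub>R norm h"
      have k: "norm k = 1" "h = norm h *\<^sub>R k" using False by (auto simp: k_def)
      have "h \<bullet> ((B - M x) *v h) = (norm h)\<^sup>2 * (k \<bullet> ((B - M x) *v k))"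
        by (subst (1 2) k(2)) (simp add: matrix_vector_mult_scaleR power2_eq_square)
      moreover have "0 \<le> k \<bullet> ((B - M x) *v k)" unfolding q using x[OF k(1), of z] k(1) by simp
      ultimately show ?thesis by simp
    qed simp
    have bM: "norm (M x *v h) \<le> L * norm h" for h
      using M_bound[of x h] mult_right_mono[of "tan \<phi>\<^sub>0" L "norm h"] by (simp add: L_def)
    have bB: "norm (B *v h) \<le> L * norm h" for h
    proof -
      have "norm (B *v h) \<le> norm (M z *v h) + \<epsilon> * norm h"
        using norm_triangle_ineq[of "M z *v h" "\<epsilon> *\<^sub>R h"] \<epsilon> by (simp add: Bv)
      also have "\<dots> \<le> tan \<phi>\<^sub>0 * norm h + 1 * norm h" using \<epsilon> by (intro add_mono M_bound mult_right_mono) auto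
      finally show ?thesis by (simp add: L_def algebra_simps)
    qed
    obtain v \<phi> where v: "eigenbasis (M x) v (\<lambda>i. tan (\<phi> i))" and \<phi>: "\<And>i. \<bar>\<phi> i\<bar> \<le> \<phi>\<^sub>0"
      and s: "(\<Sum>i\<in>UNIV. \<phi> i) = - (real CARD('n) - 2) * pi / 2" using M_spectral[of x] by blast
    obtain v' \<phi>' where v': "eigenbasis (M z) v' (\<lambda>i. tan (\<phi>' i))" and \<phi>': "\<And>i. \<bar>\<phi>' i\<bar> \<le> \<phi>\<^sub>0"
      and s': "(\<Sum>i\<in>UNIV. \<phi>' i) = - (real CARD('n) - 2) * pi / 2" using M_spectral[of z] by blast
    have eB: "eigenbasis B v' (\<lambda>i. tan (\<phi>' i) + \<epsilon>)"
      using v' by (simp add: eigenbasis_def Bv scaleR_add_left)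
    have "arctan (a + \<epsilon>) \<le> arctan a + \<epsilon>" for a
    proof -
      obtain c where c: "arctan (a + \<epsilon>) - arctan a = (a + \<epsilon> - a) * inverse (1 + c\<^sup>2)"
        using MVT2[of a "a + \<epsilon>" arctan "\<lambda>x. inverse (1 + x\<^sup>2)"] DERIV_arctan \<epsilon>(1) by auto
      have "inverse (1 + c\<^sup>2) \<le> 1" by (rule inverse_le_1_iff[THEN iffD2]) simp
      then have "\<epsilon> * inverse (1 + c\<^sup>2) \<le> \<epsilon> * 1" using \<epsilon> by (intro mult_left_mono) auto
      then show ?thesis using c by simp
    qed
    then have "(\<Sum>i\<in>UNIV. arctan (tan (\<phi>' i) + \<epsilon>)) \<le> (\<Sum>i\<in>UNIV. arctan (tan (\<phi>' i)) + \<epsilon>)"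
      by (intro sum_mono)
    also have "\<dots> = (\<Sum>i\<in>UNIV. arctan (tan (\<phi> i))) + real CARD('n) * \<epsilon>"
      using s s' by (simp add: arctan_tan_phase \<phi> \<phi>' sum.distrib)
    finally have "trace (B - M x) / (1 + L\<^sup>2) \<le> real CARD('n) * \<epsilon>"
      using trace_le_arctan_increment[OF M_transpose symB psd bM bB v eB] by linarith
    moreover have "0 < 1 + L\<^sup>2" by (simp add: add_pos_nonneg)
    ultimately have "trace (B - M x) \<le> (1 + L\<^sup>2) * (real CARD('n) * \<epsilon>)"
      by (simp add: pos_divide_le_eq mult.commute)
    moreover have "transpose (B - M x) = B - M x"
      using symB M_transpose[of x] by (simp add: transpose_def vec_eq_iff)
    from psd_quadratic_le_trace[OF this psd u]
    have "u \<bullet> ((B - M x) *v u) \<le> trace (B - M x)" .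
    ultimately show ?thesis using psd[of u] u unfolding q by simp
  qed
  show ?thesis using key[of z] key[of z'] by linarith
qed

lemma M_constant: "M z = M z'"
proof -
  define c where "c = (1 + (tan \<phi>\<^sub>0 + 1)\<^sup>2) * real CARD('n)"
  have c: "0 < c" unfolding c_def by (intro mult_pos_pos) (auto intro: add_pos_nonneg)
  have "w u z = w u z'" if u: "norm u = 1" for u
  proof (rule ccontr)
    assume ne: "w u z \<noteq> w u z'"
    define \<epsilon> where "\<epsilon> = min 1 (\<bar>w u z - w u z'\<bar> / (2 * c))"
    have \<epsilon>: "0 < \<epsilon>" "\<epsilon> \<le> 1" "\<epsilon> \<le> \<bar>w u z - w u z'\<bar> / (2 * c)" using ne c by (auto simp: \<epsilon>_def)
    have "\<bar>w u z - w u z'\<bar> \<le> c * \<epsilon>"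
      using w_oscillation[OF \<epsilon>(1,2) u, of z z'] by (simp add: c_def mult.assoc)
    also have "\<dots> \<le> c * (\<bar>w u z - w u z'\<bar> / (2 * c))" using \<epsilon>(3) c by (intro mult_left_mono) auto
    also have "\<dots> = \<bar>w u z - w u z'\<bar> / 2" using c by simp
    finally show False using ne by simp
  qed
  then have "u \<bullet> ((M z - M z') *v u) = 0" if "norm u = 1" for u
    using that by (simp add: matrix_vector_mult_linear inner_diff_right w_def)
  moreover have "transpose (M z - M z') = M z - M z'"
    using M_transpose[of z] M_transpose[of z'] by (simp add: transpose_def vec_eq_iff)
  ultimately have "M z - M z' = 0" by (rule symmetric_eq_0_if_quadratic_form_0[rotated])
  then show ?thesis by simp
qed

text \<open>Constant \<open>M\<close> makes \<open>P\<close> and its inverse \<open>R\<close>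
  constant, which gives sin beta H; the product of \<open>M\<close> and \<open>R\<close> gives cos
  beta H. Both are needed because either coefficient may vanish.\<close>

theorem hessian_constant: "H x = H x'"
proof -
  let ?y = "X x" and ?y' = "X x'"
  have P: "P ?y = P ?y'" unfolding P_eq using M_constant[of ?y ?y'] by simp
  have RR: "R x = R x'"
  proof -
    have "R x = R x ** (P ?y' ** R x')" by (simp add: P_def QR)
    also have "\<dots> = (R x ** P ?y) ** R x'" by (simp add: P matrix_mul_assoc)
    also have "\<dots> = R x'" by (simp add: P_def RQ)
    finally show ?thesis .
  qed
  have sH: "sin \<beta> *\<^sub>R H x = sin \<beta> *\<^sub>R H x'" using RR by (simp add: R_def)
  have MR: "M (X a) ** R a = cos \<beta> *\<^sub>R H a - sin \<beta> *\<^sub>R mat 1" for a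
    by (simp add: M_def P_def matrix_mul_assoc[symmetric] QR)
  have cH: "cos \<beta> *\<^sub>R H x = cos \<beta> *\<^sub>R H x'"
  proof -
    have "cos \<beta> *\<^sub>R H x - sin \<beta> *\<^sub>R mat 1 = cos \<beta> *\<^sub>R H x' - sin \<beta> *\<^sub>R mat 1"
      by (simp only: MR[symmetric] RR M_constant[of ?y ?y'])
    then show ?thesis by simp
  qed
  have "H a = cos \<beta> *\<^sub>R (cos \<beta> *\<^sub>R H a) + sin \<beta> *\<^sub>R (sin \<beta> *\<^sub>R H a)" for a
    using sin_cos_squared_add3[of \<beta>] by (simp flip: scaleR_add_left)
  then show ?thesis using sH cH by metis
qed

end

section \<open>Smooth functions and the Liouville theorem\<close>

lemma has_derivative_vec_lambda:
  fixes f :: "'n::finite \<Rightarrow> 'a::real_normed_vector \<Rightarrow> 'b::euclidean_space"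
  assumes "\<And>i. (f i has_derivative f' i) F"
  shows "((\<lambda>x. \<chi> i. f i x) has_derivative (\<lambda>h. \<chi> i. f' i h)) F"
proof -
  have ax: "bounded_linear (axis i :: 'b \<Rightarrow> 'b ^ 'n)" for i
    by (rule linear_conv_bounded_linear[THEN iffD1]) (auto intro!: linearI simp: axis_def vec_eq_iff)
  have e: "(\<chi> i. y i) = (\<Sum>i\<in>UNIV. axis i (y i))" for y :: "'n \<Rightarrow> 'b"
    by (simp add: vec_eq_iff axis_def if_distrib[of "\<lambda>z. z _"] sum.delta cong: if_cong)
  show ?thesis
    unfolding e by (intro has_derivative_sum bounded_linear.has_derivative[OF ax] assms)
qed

lemma C_infinity_partial: "C_infinity f \<Longrightarrow> C_infinity (partial_deriv i f)"
  unfolding C_infinity_def using Ck.simps(2) by blast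

lemma C_infinity_differentiable: "C_infinity f \<Longrightarrow> f differentiable (at x)"
  unfolding C_infinity_def using Ck.simps(2) by blast

lemma C_infinity_continuous: "C_infinity f \<Longrightarrow> continuous_on S f"
  unfolding C_infinity_def using Ck.simps(1) continuous_on_subset by blast

lemma C_infinity_has_derivative:
  fixes f :: "real ^ 'n::finite \<Rightarrow> real"
  assumes "C_infinity f"
  shows "(f has_derivative (\<lambda>h. \<Sum>i\<in>UNIV. h $ i * partial_deriv i f x)) (at x)"
proof -
  have d: "(f has_derivative frechet_derivative f (at x)) (at x)"
    using C_infinity_differentiable[OF assms] frechet_derivative_works by blast
  have "frechet_derivative f (at x) = (\<lambda>h. \<Sum>i\<in>UNIV. h $ i * partial_deriv i f x)"
  proof
    fix h
    show "frechet_derivative f (at x) h = (\<Sum>i\<in>UNIV. h $ i * partial_deriv i f x)"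
      using linear_axis_expansion[OF has_derivative_linear[OF d], of h]
      by (simp only: partial_deriv_def real_scaleR_def)
  qed
  then show ?thesis using d by simp
qed

section \<open>Symmetry of mixed partial derivatives\<close>

lemma C_infinity_line:
  fixes f :: "real ^ 'n::finite \<Rightarrow> real"
  assumes "C_infinity f"
  shows "((\<lambda>s. f (y + s *\<^sub>R axis i 1)) has_real_derivative partial_deriv i f (y + s *\<^sub>R axis i 1)) (at s)"
proof -
  have "((\<lambda>s. y + s *\<^sub>R axis i 1) has_derivative (\<lambda>h. h *\<^sub>R axis i 1)) (at s)"
    by (auto intro!: derivative_eq_intros)
  from has_derivative_compose[OF this C_infinity_has_derivative[OF assms]]
  show ?thesis
    by (simp add: has_field_derivative_def axis_def if_distrib[of "\<lambda>z. _ * z"] if_distrib[of "\<lambda>z. z * _"]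
        mult_commute_abs cong: if_cong)
qed

text \<open>Two applications of the mean value theorem, first along axis i and then along axis j.
  The left side is symmetric in i and j, which yields the commutation of partial
  derivatives.\<close>

lemma second_difference:
  fixes f :: "real ^ 'n::finite \<Rightarrow> real"
  assumes f: "C_infinity f" and t: "0 < t"
  shows "\<exists>p. dist p x \<le> 2 * t \<and>
    f (x + t *\<^sub>R axis i 1 + t *\<^sub>R axis j 1) - f (x + t *\<^sub>R axis i 1) - f (x + t *\<^sub>R axis j 1) + f x
      = t * t * partial_deriv j (partial_deriv i f) p"
proof -
  let ?a = "axis i 1 :: real ^ 'n" and ?b = "axis j 1 :: real ^ 'n"
  let ?\<phi> = "\<lambda>s. f ((x + t *\<^sub>R ?b) + s *\<^sub>R ?a) - f (x + s *\<^sub>R ?a)"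
  have "\<exists>s>0. s < t \<and> ?\<phi> t - ?\<phi> 0
      = (t - 0) * (partial_deriv i f ((x + t *\<^sub>R ?b) + s *\<^sub>R ?a) - partial_deriv i f (x + s *\<^sub>R ?a))"
    by (rule MVT2[OF t]) (intro DERIV_diff C_infinity_line f)
  then obtain s where s: "0 < s" "s < t" "?\<phi> t - ?\<phi> 0
      = (t - 0) * (partial_deriv i f ((x + t *\<^sub>R ?b) + s *\<^sub>R ?a) - partial_deriv i f (x + s *\<^sub>R ?a))"
    by blast
  have "\<exists>r>0. r < t \<and> partial_deriv i f ((x + s *\<^sub>R ?a) + t *\<^sub>R ?b) - partial_deriv i f ((x + s *\<^sub>R ?a) + 0 *\<^sub>R ?b)
      = (t - 0) * partial_deriv j (partial_deriv i f) ((x + s *\<^sub>R ?a) + r *\<^sub>R ?b)"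
    by (rule MVT2[OF t]) (intro C_infinity_line C_infinity_partial f)
  then obtain r where r: "0 < r" "r < t" "partial_deriv i f ((x + s *\<^sub>R ?a) + t *\<^sub>R ?b) - partial_deriv i f ((x + s *\<^sub>R ?a) + 0 *\<^sub>R ?b)
      = (t - 0) * partial_deriv j (partial_deriv i f) ((x + s *\<^sub>R ?a) + r *\<^sub>R ?b)"
    by blast
  show ?thesis
  proof (intro exI[of _ "(x + s *\<^sub>R ?a) + r *\<^sub>R ?b"] conjI)
    have "dist (x + s *\<^sub>R ?a + r *\<^sub>R ?b) x = norm (s *\<^sub>R ?a + r *\<^sub>R ?b)" by (simp add: dist_norm)
    also have "\<dots> \<le> norm (s *\<^sub>R ?a) + norm (r *\<^sub>R ?b)" by (rule norm_triangle_ineq)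
    also have "\<dots> \<le> 2 * t" using s r by simp
    finally show "dist (x + s *\<^sub>R ?a + r *\<^sub>R ?b) x \<le> 2 * t" .
    have c: "x + t *\<^sub>R ?b + s *\<^sub>R ?a = x + s *\<^sub>R ?a + t *\<^sub>R ?b" "x + t *\<^sub>R ?b + t *\<^sub>R ?a = x + t *\<^sub>R ?a + t *\<^sub>R ?b"
      by simp_all
    show "f (x + t *\<^sub>R ?a + t *\<^sub>R ?b) - f (x + t *\<^sub>R ?a) - f (x + t *\<^sub>R ?b) + f x
        = t * t * partial_deriv j (partial_deriv i f) (x + s *\<^sub>R ?a + r *\<^sub>R ?b)"
      using s(3) r(3) unfolding c by simp
  qed
qed

lemma partial_deriv_commute:
  fixes f :: "real ^ 'n::finite \<Rightarrow> real"
  assumes f: "C_infinity f"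
  shows "partial_deriv i (partial_deriv j f) = partial_deriv j (partial_deriv i f)"
proof
  fix x
  let ?A = "partial_deriv i (partial_deriv j f)" and ?B = "partial_deriv j (partial_deriv i f)"
  show "?A x = ?B x"
  proof (rule ccontr)
    assume ne: "?A x \<noteq> ?B x"
    define e where "e = \<bar>?A x - ?B x\<bar> / 2"
    have e: "0 < e" using ne by (simp add: e_def)
    have cont: "isCont ?A x" "isCont ?B x"
      using C_infinity_continuous[OF C_infinity_partial[OF C_infinity_partial[OF f]], of UNIV]
      by (auto simp: continuous_on_eq_continuous_at)
    obtain d1 where d1: "0 < d1" "\<And>y. dist y x < d1 \<Longrightarrow> dist (?A y) (?A x) < e"
      using cont(1) e unfolding continuous_at_eps_delta by (auto simp: dist_norm)
    obtain d2 where d2: "0 < d2" "\<And>y. dist y x < d2 \<Longrightarrow> dist (?B y) (?B x) < e"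
      using cont(2) e unfolding continuous_at_eps_delta by (auto simp: dist_norm)
    \<comment> \<open>Both intermediate points lie within 2 t of x, hence inside both continuity
      radii.\<close>
    define t where "t = min d1 d2 / 3"
    have t: "0 < t" "2 * t < d1" "2 * t < d2" using d1 d2 by (auto simp: t_def)
    obtain p where p: "dist p x \<le> 2 * t"
      "f (x + t *\<^sub>R axis j 1 + t *\<^sub>R axis i 1) - f (x + t *\<^sub>R axis j 1) - f (x + t *\<^sub>R axis i 1) + f x = t * t * ?A p"
      using second_difference[OF f t(1), of x j i] by blast
    obtain q where q: "dist q x \<le> 2 * t"
      "f (x + t *\<^sub>R axis i 1 + t *\<^sub>R axis j 1) - f (x + t *\<^sub>R axis i 1) - f (x + t *\<^sub>R axis j 1) + f x = t * t * ?B q"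
      using second_difference[OF f t(1), of x i j] by blast
    have "x + t *\<^sub>R axis j 1 + t *\<^sub>R axis i 1 = x + t *\<^sub>R axis i 1 + t *\<^sub>R axis j 1" by simp
    then have "t * t * ?A p = t * t * ?B q" using p(2) q(2) by (simp only:)
    then have "?A p = ?B q" using t by simp
    moreover have "\<bar>?A p - ?A x\<bar> < e" using d1(2)[of p] p(1) t by (simp add: dist_real_def)
    moreover have "\<bar>?B q - ?B x\<bar> < e" using d2(2)[of q] q(1) t by (simp add: dist_real_def)
    moreover have "\<bar>b - c\<bar> \<le> \<bar>a - b\<bar> + \<bar>a - c\<bar>" for a b c :: real by linarith
    from this[of "?A x" "?B x" "?A p"] have "\<bar>?A x - ?B x\<bar> \<le> \<bar>?A p - ?A x\<bar> + \<bar>?A p - ?B x\<bar>" .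
    ultimately have "\<bar>?A x - ?B x\<bar> < e + e" by simp
    then show False by (simp add: e_def)
  qed
qed

definition third_form :: "(real ^ 'n::finite \<Rightarrow> real) \<Rightarrow> real ^ 'n \<Rightarrow> real ^ 'n \<Rightarrow> real ^ 'n ^ 'n" where
  "third_form u x h = (\<chi> i j. \<Sum>k\<in>UNIV. h $ k * partial_deriv k (partial_deriv i (partial_deriv j u)) x)"

text \<open>The vector h feeds the outermost derivative, k the direction already present in
  \<open>third_form\<close>.\<close>

definition fourth_form :: "(real ^ 'n::finite \<Rightarrow> real) \<Rightarrow> real ^ 'n \<Rightarrow> real ^ 'n \<Rightarrow> real ^ 'n \<Rightarrow> real ^ 'n ^ 'n" where
  "fourth_form u x h k = (\<chi> i j. \<Sum>m\<in>UNIV. k $ m *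
     (\<Sum>l\<in>UNIV. h $ l * partial_deriv l (partial_deriv m (partial_deriv i (partial_deriv j u))) x))"

lemma gradient_has_derivative:
  assumes u: "C_infinity u"
  shows "((\<lambda>x. \<chi> i. partial_deriv i u x) has_derivative (\<lambda>h. hessian u x *v h)) (at x)"
proof -
  have "((\<lambda>x. \<chi> i. partial_deriv i u x) has_derivative
      (\<lambda>h. \<chi> i. \<Sum>k\<in>UNIV. h $ k * partial_deriv k (partial_deriv i u) x)) (at x)"
    by (intro has_derivative_vec_lambda C_infinity_has_derivative C_infinity_partial u)
  moreover have "(\<chi> i. \<Sum>k\<in>UNIV. h $ k * partial_deriv k (partial_deriv i u) x) = hessian u x *v h" for h
    by (simp add: hessian_def matrix_vector_mult_def vec_eq_iff partial_deriv_commute[OF u] mult.commute)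
  ultimately show ?thesis by simp
qed

text \<open>All symmetries reduce to commuting two neighbouring derivatives at depth two, three or
  four, followed by exchanging finite sums.\<close>

lemma gradient_jet_C_infinity:
  fixes u :: "real ^ 'n::finite \<Rightarrow> real"
  assumes u: "C_infinity u"
  shows "gradient_jet (\<lambda>x. \<chi> i. partial_deriv i u x) (hessian u) (third_form u) (fourth_form u)"
proof (rule gradient_jet.intro)
  note Ci = C_infinity_partial
  have s2: "partial_deriv i (partial_deriv j u) = partial_deriv j (partial_deriv i u)" for i j
    by (rule partial_deriv_commute[OF u])
  have s3: "partial_deriv k (partial_deriv i (partial_deriv j u)) = partial_deriv i (partial_deriv k (partial_deriv j u))" for i j k
    by (rule partial_deriv_commute[OF Ci[OF u]])
  have s4: "partial_deriv l (partial_deriv k (partial_deriv i (partial_deriv j u))) =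
      partial_deriv k (partial_deriv l (partial_deriv i (partial_deriv j u)))" for i j k l
    by (rule partial_deriv_commute[OF Ci[OF Ci[OF u]]])
  fix x h k p :: "real ^ 'n"
  show "((\<lambda>x. \<chi> i. partial_deriv i u x) has_derivative (\<lambda>h. hessian u x *v h)) (at x)"
    by (rule gradient_has_derivative[OF u])
  show "(hessian u has_derivative third_form u x) (at x)"
    unfolding hessian_def[abs_def] third_form_def[abs_def]
    by (intro has_derivative_vec_lambda C_infinity_has_derivative Ci u)
  show "((\<lambda>x. third_form u x h) has_derivative (\<lambda>k. fourth_form u x k h)) (at x)"
    unfolding third_form_def fourth_form_def
    by (intro has_derivative_vec_lambda has_derivative_sum has_derivative_mult_right C_infinity_has_derivative Ci u)
  show "transpose (hessian u x) = hessian u x"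
    by (simp add: transpose_def hessian_def vec_eq_iff s2)
  show "transpose (third_form u x h) = third_form u x h"
    by (simp add: transpose_def third_form_def vec_eq_iff s2)
  show "third_form u x h *v k = third_form u x k *v h"
  proof -
    let ?D = "\<lambda>i l j. partial_deriv l (partial_deriv i (partial_deriv j u)) x"
    have "(\<Sum>j\<in>UNIV. (\<Sum>l\<in>UNIV. h $ l * ?D i l j) * k $ j)
        = (\<Sum>j\<in>UNIV. (\<Sum>l\<in>UNIV. k $ l * ?D i l j) * h $ j)" for i
    proof -
      have sw: "?D i l j = ?D i j l" for l j
        by (metis s2 s3)
      have "(\<Sum>j\<in>UNIV. (\<Sum>l\<in>UNIV. h $ l * ?D i l j) * k $ j)
          = (\<Sum>j\<in>UNIV. \<Sum>l\<in>UNIV. h $ l * ?D i l j * k $ j)"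
        by (simp add: sum_distrib_right)
      also have "\<dots> = (\<Sum>l\<in>UNIV. \<Sum>j\<in>UNIV. h $ l * ?D i l j * k $ j)"
        by (rule sum.swap)
      also have "\<dots> = (\<Sum>l\<in>UNIV. \<Sum>j\<in>UNIV. h $ l * ?D i j l * k $ j)"
        by (intro sum.cong refl) (simp only: sw)
      finally show ?thesis by (simp add: sum_distrib_right sum_distrib_left mult_ac)
    qed
    then show ?thesis by (simp add: third_form_def matrix_vector_mult_def vec_eq_iff)
  qed
  show "transpose (fourth_form u x h k) = fourth_form u x h k"
    by (simp add: transpose_def fourth_form_def vec_eq_iff s2)
  show "linear (fourth_form u x h)"
    by (rule linearI) (simp_all add: fourth_form_def vec_eq_iff distrib_right sum.distrib sum_distrib_left[symmetric] mult.assoc)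
  show "fourth_form u x h k *v p = fourth_form u x p k *v h"
  proof -
    have "(\<Sum>j\<in>UNIV. (\<Sum>m\<in>UNIV. k $ m * (\<Sum>l\<in>UNIV. h $ l * partial_deriv l (partial_deriv m (partial_deriv i (partial_deriv j u))) x)) * p $ j)
        = (\<Sum>j\<in>UNIV. (\<Sum>m\<in>UNIV. k $ m * (\<Sum>l\<in>UNIV. p $ l * partial_deriv l (partial_deriv m (partial_deriv i (partial_deriv j u))) x)) * h $ j)" for i
    proof -
      let ?D = "\<lambda>l m j. partial_deriv l (partial_deriv m (partial_deriv i (partial_deriv j u))) x"
      have sw: "?D l m j = ?D j m l" for l m j by (metis s2 s3 s4)
      have "(\<Sum>j\<in>UNIV. (\<Sum>m\<in>UNIV. k $ m * (\<Sum>l\<in>UNIV. h $ l * ?D l m j)) * p $ j)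
          = (\<Sum>j\<in>UNIV. \<Sum>l\<in>UNIV. \<Sum>m\<in>UNIV. k $ m * h $ l * ?D l m j * p $ j)"
      proof (rule sum.cong[OF refl])
        fix j
        have "(\<Sum>m\<in>UNIV. k $ m * (\<Sum>l\<in>UNIV. h $ l * ?D l m j)) * p $ j
            = (\<Sum>m\<in>UNIV. \<Sum>l\<in>UNIV. k $ m * h $ l * ?D l m j * p $ j)"
          by (simp add: sum_distrib_right sum_distrib_left mult_ac)
        also have "\<dots> = (\<Sum>l\<in>UNIV. \<Sum>m\<in>UNIV. k $ m * h $ l * ?D l m j * p $ j)" by (rule sum.swap)
        finally show "(\<Sum>m\<in>UNIV. k $ m * (\<Sum>l\<in>UNIV. h $ l * ?D l m j)) * p $ j
            = (\<Sum>l\<in>UNIV. \<Sum>m\<in>UNIV. k $ m * h $ l * ?D l m j * p $ j)" .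
      qed
      also have "\<dots> = (\<Sum>l\<in>UNIV. \<Sum>j\<in>UNIV. \<Sum>m\<in>UNIV. k $ m * h $ l * ?D l m j * p $ j)" by (rule sum.swap)
      also have "\<dots> = (\<Sum>l\<in>UNIV. \<Sum>j\<in>UNIV. \<Sum>m\<in>UNIV. k $ m * h $ l * ?D j m l * p $ j)"
        by (intro sum.cong refl) (simp only: sw)
      also have "\<dots> = (\<Sum>l\<in>UNIV. \<Sum>m\<in>UNIV. \<Sum>j\<in>UNIV. k $ m * h $ l * ?D j m l * p $ j)"
        by (rule sum.cong[OF refl], rule sum.swap)
      finally show ?thesis by (simp add: sum_distrib_right sum_distrib_left mult_ac)
    qed
    then show ?thesis by (simp add: fourth_form_def matrix_vector_mult_def vec_eq_iff)
  qed
qed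

section \<open>Sign change, integration of the Hessian, and conclusion\<close>

lemma gradient_jet_uminus:
  fixes g :: "real ^ 'n::finite \<Rightarrow> real ^ 'n"
  assumes "gradient_jet g H C W"
  shows "gradient_jet (\<lambda>x. - g x) (\<lambda>x. - H x) (\<lambda>x h. - C x h) (\<lambda>x h k. - W x h k)"
proof -
  interpret gradient_jet g H C W by (rule assms)
  have t: "transpose (- A) = - transpose A" for A :: "real ^ 'n ^ 'n" by (simp add: transpose_def vec_eq_iff)
  show ?thesis
  proof (rule gradient_jet.intro)
    fix x h k p :: "real ^ 'n"
    show "((\<lambda>x. - g x) has_derivative (\<lambda>h. - H x *v h)) (at x)"
      using has_derivative_minus[OF dg] by (simp add: matrix_vector_mult_linear)
    show "((\<lambda>x. - H x) has_derivative (\<lambda>h. - C x h)) (at x)" by (intro has_derivative_minus dH)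
    show "((\<lambda>x. - C x h) has_derivative (\<lambda>k. - W x k h)) (at x)" by (intro has_derivative_minus dC)
    show "linear (\<lambda>k. - W x h k)" by (intro linear_compose_neg W_linear)
    show "- C x h *v k = - C x k *v h" using C_swap[of x h k] by (simp add: matrix_vector_mult_linear)
    show "- W x h k *v p = - W x p k *v h" using W_swap[of x h k p] by (simp add: matrix_vector_mult_linear)
  qed (simp_all add: t H_transpose C_transpose W_transpose)
qed

lemma eigenbasis_uminus: "eigenbasis (- A) v l \<Longrightarrow> eigenbasis A v (\<lambda>i. - l i)"
  by (auto simp: eigenbasis_def matrix_vector_mult_linear minus_equation_iff[of "A *v _"])

text \<open>Integrates twice: the gradient minus A x has zero derivative, and then so has u minus
  the resulting quadratic. The coefficients are halved entries of A.\<close>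

lemma quadratic_polynomial_if_constant_hessian:
  fixes u :: "real ^ 'n::finite \<Rightarrow> real"
  assumes u: "C_infinity u" and const: "\<And>x. hessian u x = A"
  shows "quadratic_polynomial u"
proof -
  let ?g = "\<lambda>x. \<chi> i. partial_deriv i u x"
  have sym: "transpose A = A"
    using gradient_jet.H_transpose[OF gradient_jet_C_infinity[OF u]] by (simp add: const)
  have "((\<lambda>x. ?g x - A *v x) has_derivative (\<lambda>h. A *v h - A *v h)) (at x)" for x
    using gradient_has_derivative[OF u, of x]
    by (intro has_derivative_diff) (auto simp: const intro: bounded_linear_imp_has_derivative matrix_vector_mul_bounded_linear)
  then have "\<exists>b. \<forall>x\<in>UNIV. ?g x - A *v x = b"
    by (intro has_derivative_zero_constant) auto
  then obtain b where b: "\<And>x. ?g x = A *v x + b" by (auto simp: algebra_simps)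
  let ?q = "\<lambda>x. u x - (1 / 2 * (x \<bullet> (A *v x)) + b \<bullet> x)"
  have "(?q has_derivative (\<lambda>h. 0)) (at x)" for x
  proof -
    have "(u has_derivative (\<lambda>h. (A *v x + b) \<bullet> h)) (at x)"
      using C_infinity_has_derivative[OF u, of x] unfolding b[symmetric] by (simp add: inner_vec_def mult.commute)
    moreover have "((\<lambda>x. 1 / 2 * (x \<bullet> (A *v x)) + b \<bullet> x) has_derivative
        (\<lambda>h. 1 / 2 * (x \<bullet> (A *v h) + h \<bullet> (A *v x)) + b \<bullet> h)) (at x)"
      by (intro has_derivative_add has_derivative_mult_right has_derivative_inner has_derivative_inner_right
          has_derivative_ident bounded_linear_imp_has_derivative matrix_vector_mul_bounded_linear)
    ultimately have "(?q has_derivative (\<lambda>h. (A *v x + b) \<bullet> h - (1 / 2 * (x \<bullet> (A *v h) + h \<bullet> (A *v x)) + b \<bullet> h))) (at x)"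
      by (rule has_derivative_diff)
    moreover have "(A *v x + b) \<bullet> h - (1 / 2 * (x \<bullet> (A *v h) + h \<bullet> (A *v x)) + b \<bullet> h) = 0" for h
      using symmetric_inner[OF sym, of x h] by (simp add: inner_add_left inner_commute[of h])
    ultimately show ?thesis by simp
  qed
  then have "\<exists>c. \<forall>x\<in>UNIV. ?q x = c"
    by (intro has_derivative_zero_constant) auto
  then obtain c where c: "\<And>x. u x = 1 / 2 * (x \<bullet> (A *v x)) + b \<bullet> x + c"
    by (auto simp: diff_eq_eq add.commute)
  show ?thesis
    unfolding quadratic_polynomial_def
  proof (intro exI allI)
    fix x
    have "1 / 2 * (x \<bullet> (A *v x)) = (\<Sum>i\<in>UNIV. \<Sum>j\<in>UNIV. A $ i $ j / 2 * x $ i * x $ j)"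
      by (simp add: inner_vec_def matrix_vector_mult_def sum_distrib_left sum_divide_distrib mult_ac)
    then show "u x = (\<Sum>i\<in>UNIV. \<Sum>j\<in>UNIV. A $ i $ j / 2 * x $ i * x $ j) + (\<Sum>i\<in>UNIV. b $ i * x $ i) + c"
      by (simp add: c inner_vec_def)
  qed
qed

theorem theorem1p2:
  fixes u :: "real ^ 'n::finite \<Rightarrow> real" and \<Theta> :: real
  assumes smooth: "C_infinity u"
    and special_Lagrangian:
      "\<forall>x. (\<Sum>i = 1..CARD('n). arctan (eigval (hessian u x) i)) = \<Theta>"
    and pinching:
      "\<exists>\<gamma>::real.
         (\<gamma> > (\<Theta> - pi) / real CARD('n) \<and> (\<forall>x. arctan (eigval (hessian u x) 1) \<ge> \<gamma>)) \<or>
         (\<gamma> < (\<Theta> + pi) / real CARD('n) \<and> (\<forall>x. arctan (eigval (hessian u x) CARD('n)) \<le> \<gamma>))"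
  shows "quadratic_polynomial u"
proof -
  let ?g = "\<lambda>x. \<chi> i. partial_deriv i u x"
  let ?H = "hessian u"
  have jet: "gradient_jet ?g ?H (third_form u) (fourth_form u)"
    by (rule gradient_jet_C_infinity[OF smooth])
  have phase: "(\<Sum>i\<in>UNIV. arctan (l i)) = \<Theta>" if "eigenbasis (?H x) v l" for x v l
    using special_Lagrangian sum_eigval[OF that, of arctan] by simp
  have "?H x = ?H x'" for x x'
  proof (cases "CARD('n) = 1")
    case True
    then obtain k :: 'n where k: "UNIV = {k}" using card_1_singletonE by blast
    \<comment> \<open>In one dimension the equation reads arctan u'' = Theta and fixes the Hessian
      outright.\<close>
    have "?H y *v h = tan \<Theta> *\<^sub>R h" for y h
    proof -
      obtain v l where e: "eigenbasis (?H y) v l"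
        using spectral_theorem[OF gradient_jet.H_transpose[OF jet]] by blast
      have o: "orthonormal v" using e by (simp add: eigenbasis_def)
      have "arctan (l i) = \<Theta>" for i
      proof -
        have "i = k" using k by blast
        then show ?thesis using phase[OF e] by (simp add: k)
      qed
      then have "l i = tan \<Theta>" for i using tan_arctan by metis
      then show ?thesis
        unfolding orthonormal_eq_iff[OF o] by (simp add: eigenbasis_transpose[OF e])
    qed
    then show ?thesis by (simp add: matrix_eq)
  next
    case False
    then have dim: "2 \<le> CARD('n)" using zero_less_card_finite[where 'a='n] by linarith
    obtain \<gamma> where "(\<gamma> > (\<Theta> - pi) / real CARD('n) \<and> (\<forall>x. arctan (eigval (?H x) 1) \<ge> \<gamma>)) \<or>
         (\<gamma> < (\<Theta> + pi) / real CARD('n) \<and> (\<forall>x. arctan (eigval (?H x) CARD('n)) \<le> \<gamma>))"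
      using pinching by blast
    then show ?thesis
    proof
      assume \<gamma>: "\<gamma> > (\<Theta> - pi) / real CARD('n) \<and> (\<forall>x. arctan (eigval (?H x) 1) \<ge> \<gamma>)"
      have "\<gamma> \<le> arctan (l i)" if "eigenbasis (?H x) v l" for x v l i
        using \<gamma> eigval_bounds(1)[OF that, of i] arctan_le_iff order_trans by blast
      then interpret special_lagrangian_jet ?g ?H "third_form u" "fourth_form u" \<Theta> \<gamma>
        using jet phase \<gamma> dim
        by (intro special_lagrangian_jet.intro special_lagrangian_jet_axioms.intro) auto
      show ?thesis by (rule hessian_constant)
    next
      assume \<gamma>: "\<gamma> < (\<Theta> + pi) / real CARD('n) \<and> (\<forall>x. arctan (eigval (?H x) CARD('n)) \<le> \<gamma>)"
      have le: "- \<gamma> \<le> arctan (l i)" if "eigenbasis (- ?H x) v l" for x v l i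
      proof -
        have "arctan (- l i) \<le> \<gamma>"
          using \<gamma> eigval_bounds(2)[OF eigenbasis_uminus[OF that], of i] arctan_le_iff order_trans by blast
        then show ?thesis by (simp add: arctan_minus)
      qed
      have sum: "(\<Sum>i\<in>UNIV. arctan (l i)) = - \<Theta>" if "eigenbasis (- ?H x) v l" for x v l
        using phase[OF eigenbasis_uminus[OF that]] by (simp add: arctan_minus sum_negf)
      have "(- \<Theta> - pi) / real CARD('n) < - \<gamma>" using \<gamma> dim by (simp add: field_simps)
      then interpret special_lagrangian_jet "\<lambda>x. - ?g x" "\<lambda>x. - ?H x" "\<lambda>x h. - third_form u x h"
          "\<lambda>x h k. - fourth_form u x h k" "- \<Theta>" "- \<gamma>"
        using gradient_jet_uminus[OF jet] le sum dim
        by (intro special_lagrangian_jet.intro special_lagrangian_jet_axioms.intro) auto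
      have "- ?H x = - ?H x'" by (rule hessian_constant)
      then show ?thesis by simp
    qed
  qed
  then show ?thesis
    by (intro quadratic_polynomial_if_constant_hessian[OF smooth]) auto
qed

end
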